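(* Let $(\Gamma,\mu)$ be a weighted graph with modulus $\delta$ such that $\|\Gamma\|<\delta$, where $\|\Gamma\|$ is the operator norm of the adjacency matrix of $\Gamma$ on $\ell^2(V)$, and let $\mathcal P$ be its associated bipartite graph planar algebra. If $\mathcal Q$ is a subfactor planar algebra that embeds inside $\mathcal P$ (as a planar subalgebra), then $\mathcal Q$ is non-amenable.
   Context: Weighted graphs. $\Gamma$ is a countable, locally finite, connected, undirected bipartite graph, possibly with multiple edges, with vertex set $V=V^+\sqcup V^-$ (even and odd vertices). Each edge is doubled into two oppositely oriented edges. For a path $a$, $s(a),t(a),\bar a$ denote its source, target and reversed path. $C_0^\pm=V^\pm$; for $n\geq1$, $C_n^\pm$ is the set of oriented paths of length $n$ starting in $V^\pm$; $C_1=C_1^+\cup C_1^-$. A weight is a map $\mu:C_1\to(0,\infty)$ such that (i) $\mu(a_1)\cdots\mu(a_n)=\mu(b_1)\cdots\mu(b_l)$ for any two paths $a_1\cdots a_n$, $b_1\cdots b_l$ with the same source and the same target; (ii) there is $\delta>0$ with $\sum_{c\in C_1:s(c)=v}\mu(c)=\delta$ for all $v\in V$. Then $(\Gamma,\mu)$ is a weighted graph with modulus $\delta$. There is a map $\mu_V:V\to(0,\infty)$, unique up to a positive scalar, with $\mu(a)=\mu_V(t(a))/\mu_V(s(a))$ for all $a\in C_1$. Bipartite graph planar algebra $\mathcal P=(\mathcal P_n^\pm)_{n\ge0}$. $\mathcal P_n^\pm\subset B(\ell^2(C_n^\pm))$ is the von Neumann algebra generated by the matrix units $e_{a,b}$ with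 $a,b\in C_n^\pm$ having the same source and the same target; $\mathcal P_0^\pm=\ell^\infty(V^\pm)$ with minimal projections $e_v$. Shaded planar tangles act by the usual state sum: isotope the tangle so that every disc with $2n$ boundary points is a rectangle with $n$ strings on top, $n$ on the bottom and marked interval on the left. For inputs $e_{a_i,b_i}$, a state assigns even (odd) vertices to unshaded (shaded) regions and to each string an edge joining the vertices of its two adjacent regions, so that reading left to right along the top and bottom of the $i$-th inner rectangle gives $a_i$ and $b_i$ (for a $0$-box $e_v$, the surrounding region carries $v$). A state contributes $\prod(\mu_V(w)/\mu_V(u))^{1/2}$, the product over all local maxima and minima of strings, where $w$ is the vertex of the region on the concave (enclosed) side and $u$ that of the other side, times $e_{a,b}$ where $a,b$ are read along the top and bottom of the outer rectangle; one sums over all states. The involution is the adjoint. Subfactor planar algebras. $\tau_r$ (resp. $\tau_l$) is the map obtained by closing all strings of a box around the right (resp. left). A subfactor planar algebra is a shaded planar $*$-algebra $\mathcal Q=(\mathcal Q_n^\pm)$ with all $\mathcal Q_n^\pm$ finite dimensional, $\mathcal Q_0^\pm=\mathbb C$, spherical ($\tau_l=\tau_r$), and non-degenerate (the forms $(x,y)\mapsto\tau_l(xy^* )$, $(x,y)\mapsto\tau_r(xy^* )$ are positive definite). Its modulus is the value of a closed loop. Amenability. A subfactor planar algebra $\mathcal Q$ with modulus $\delta$ is amenable if $\|\Gamma(\mathcal Q)\|=\delta$, where $\Gamma(\mathcal Q)$ is its principal graph, deduced from the Bratteli diagram of $\mathcal Q_0^+\subset\mathcal Q_1^+\subset\cdots$,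 and $\|\Gamma(\mathcal Q)\|$ is the operator norm of its adjacency matrix on $\ell^2$ of its vertices (equivalently the limit over $n$ of the norms of the Bratteli diagrams of $\mathcal Q_n^+\subset\mathcal Q_{n+1}^+$). *)

theory Defs
  imports "HOL-Analysis.Analysis" "HOL-Library.Function_Algebras"
begin

section \<open>Operators on \<open>\<ell>\<^sup>2(I)\<close>, given by their matrices\<close>

definition ell2 :: "'i set \<Rightarrow> ('i \<Rightarrow> complex) set" where
  "ell2 I = {f. (\<lambda>i. (cmod (f i))\<^sup>2) summable_on I}"

definition ell2_norm :: "'i set \<Rightarrow> ('i \<Rightarrow> complex) \<Rightarrow> real" where
  "ell2_norm I f = sqrt (\<Sum>\<^sub>\<infinity>i\<in>I. (cmod (f i))\<^sup>2)"

definition mat_apply :: "'i set \<Rightarrow> ('i \<Rightarrow> 'i \<Rightarrow> complex) \<Rightarrow> ('i \<Rightarrow> complex) \<Rightarrow> 'i \<Rightarrow> complex" where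
  "mat_apply I A f = (\<lambda>i. \<Sum>\<^sub>\<infinity>j\<in>I. A i j * f j)"

definition op_bound :: "'i set \<Rightarrow> ('i \<Rightarrow> 'i \<Rightarrow> complex) \<Rightarrow> real \<Rightarrow> bool" where
  "op_bound I A C \<longleftrightarrow> 0 \<le> C \<and>
     (\<forall>f\<in>ell2 I. (\<forall>i\<in>I. (\<lambda>j. A i j * f j) summable_on I) \<and>
        mat_apply I A f \<in> ell2 I \<and> ell2_norm I (mat_apply I A f) \<le> C * ell2_norm I f)"

text \<open>The operator norm; its value is \<open>\<infinity>\<close> if the matrix does not define a bounded operator.\<close>

definition op_norm :: "'i set \<Rightarrow> ('i \<Rightarrow> 'i \<Rightarrow> complex) \<Rightarrow> ennreal" where
  "op_norm I A = Inf (ennreal ` {C. op_bound I A C})"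

definition bounded_ops :: "'i set \<Rightarrow> ('i \<Rightarrow> 'i \<Rightarrow> complex) set" where
  "bounded_ops I = {A. (\<forall>i j. A i j \<noteq> 0 \<longrightarrow> i \<in> I \<and> j \<in> I) \<and> (\<exists>C. op_bound I A C)}"

definition mat_mult ::
    "'i set \<Rightarrow> ('i \<Rightarrow> 'i \<Rightarrow> complex) \<Rightarrow> ('i \<Rightarrow> 'i \<Rightarrow> complex) \<Rightarrow> 'i \<Rightarrow> 'i \<Rightarrow> complex" where
  "mat_mult I A B = (\<lambda>i j. \<Sum>\<^sub>\<infinity>k\<in>I. A i k * B k j)"

definition matrix_unit :: "'i \<Rightarrow> 'i \<Rightarrow> 'i \<Rightarrow> 'i \<Rightarrow> complex" where
  "matrix_unit a b = (\<lambda>i j. if i = a \<and> j = b then 1 else 0)"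

definition commutant :: "'i set \<Rightarrow> ('i \<Rightarrow> 'i \<Rightarrow> complex) set \<Rightarrow> ('i \<Rightarrow> 'i \<Rightarrow> complex) set" where
  "commutant I S = {x \<in> bounded_ops I. \<forall>y\<in>S. mat_mult I x y = mat_mult I y x}"

text \<open>For a self-adjoint set \<open>S\<close> of operators.\<close>

definition generated_vN :: "'i set \<Rightarrow> ('i \<Rightarrow> 'i \<Rightarrow> complex) set \<Rightarrow> ('i \<Rightarrow> 'i \<Rightarrow> complex) set" where
  "generated_vN I S = commutant I (commutant I S)"


section \<open>Weighted graphs\<close>

text \<open>The edges of the record are the oriented ones: each unoriented edge occurs twice, and the
  two occurrences are exchanged by \<open>rev_edge\<close>.\<close>

record ('v, 'e) wgraph =
  even_verts :: "'v set"
  odd_verts :: "'v set"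
  edges :: "'e set"
  src :: "'e \<Rightarrow> 'v"
  tgt :: "'e \<Rightarrow> 'v"
  rev_edge :: "'e \<Rightarrow> 'e"
  weight :: "'e \<Rightarrow> real"

definition verts :: "('v, 'e) wgraph \<Rightarrow> 'v set" where
  "verts G = even_verts G \<union> odd_verts G"

fun walk :: "('v, 'e) wgraph \<Rightarrow> 'v \<Rightarrow> 'e list \<Rightarrow> 'v \<Rightarrow> bool" where
  "walk G v [] w \<longleftrightarrow> v \<in> verts G \<and> v = w"
| "walk G v (e # es) w \<longleftrightarrow> e \<in> edges G \<and> src G e = v \<and> walk G (tgt G e) es w"

definition bipartite_graph :: "('v, 'e) wgraph \<Rightarrow> bool" where
  "bipartite_graph G \<longleftrightarrow>
     even_verts G \<inter> odd_verts G = {} \<and>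
     (\<forall>e\<in>edges G. (src G e \<in> even_verts G \<and> tgt G e \<in> odd_verts G) \<or>
                  (src G e \<in> odd_verts G \<and> tgt G e \<in> even_verts G)) \<and>
     (\<forall>e\<in>edges G. rev_edge G e \<in> edges G \<and> rev_edge G (rev_edge G e) = e \<and>
                  src G (rev_edge G e) = tgt G e \<and> tgt G (rev_edge G e) = src G e) \<and>
     countable (verts G) \<and>
     (\<forall>v\<in>verts G. finite {e \<in> edges G. src G e = v}) \<and>
     (\<forall>v\<in>verts G. \<forall>w\<in>verts G. \<exists>es. walk G v es w)"

definition weighted_graph :: "('v, 'e) wgraph \<Rightarrow> real \<Rightarrow> bool" where
  "weighted_graph G \<delta> \<longleftrightarrow>
     bipartite_graph G \<and>
     (\<forall>e\<in>edges G. weight G e > 0) \<and>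
     (\<forall>v w as bs. as \<noteq> [] \<and> bs \<noteq> [] \<and> walk G v as w \<and> walk G v bs w \<longrightarrow>
        prod_list (map (weight G) as) = prod_list (map (weight G) bs)) \<and>
     \<delta> > 0 \<and>
     (\<forall>v\<in>verts G. (\<Sum>e\<in>{e \<in> edges G. src G e = v}. weight G e) = \<delta>)"

definition adjacency :: "('v, 'e) wgraph \<Rightarrow> 'v \<Rightarrow> 'v \<Rightarrow> complex" where
  "adjacency G v w = of_nat (card {e \<in> edges G. src G e = v \<and> tgt G e = w})"

definition is_vertex_weight :: "('v, 'e) wgraph \<Rightarrow> ('v \<Rightarrow> real) \<Rightarrow> bool" where
  "is_vertex_weight G m \<longleftrightarrow> (\<forall>v\<in>verts G. m v > 0) \<and>
     (\<forall>e\<in>edges G. weight G e = m (tgt G e) / m (src G e))"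

text \<open>Such a function is unique up to a scalar, and only ratios of its values are used below.\<close>

definition vertex_weight :: "('v, 'e) wgraph \<Rightarrow> 'v \<Rightarrow> real" where
  "vertex_weight G = (SOME m. is_vertex_weight G m)"

lemma walk_append:
  assumes "bipartite_graph G"
  shows "walk G v (as @ bs) w \<longleftrightarrow> (\<exists>u. walk G v as u \<and> walk G u bs w)"
proof (induction as arbitrary: v)
  case Nil
  have "walk G v bs w \<Longrightarrow> v \<in> verts G"
    using assms by (cases bs) (auto simp: bipartite_graph_def verts_def)
  then show ?case by auto
qed auto

lemma vertex_weight_exists:
  fixes G :: "('v, 'e) wgraph"
  assumes "weighted_graph G \<delta>"
  shows "is_vertex_weight G (vertex_weight G)"
proof -
  have bip: "bipartite_graph G" using assms by (simp add: weighted_graph_def)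
  have indep: "prod_list (map (weight G) as) = prod_list (map (weight G) bs)"
    if "as \<noteq> []" "bs \<noteq> []" "walk G v as w" "walk G v bs w" for v w as bs
    using assms that unfolding weighted_graph_def by blast
  have pos: "prod_list (map (weight G) as) > 0" if "walk G v as w" for v w as
    using that assms by (induction as arbitrary: v) (auto simp: weighted_graph_def)
  have "\<exists>m. is_vertex_weight G m"
  proof (cases "verts G = {}")
    case True
    then show ?thesis using bip
      by (intro exI[of _ "\<lambda>_. 1"]) (auto simp: is_vertex_weight_def bipartite_graph_def verts_def)
  next
    case False
    then obtain v0 where v0: "v0 \<in> verts G" by blast
    have edge: "src G e \<in> verts G" "tgt G e \<in> verts G" if "e \<in> edges G" for e
      using that bip by (auto simp: bipartite_graph_def verts_def)
    show ?thesis
    proof (cases "edges G = {}")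
      case True
      then show ?thesis by (intro exI[of _ "\<lambda>_. 1"]) (auto simp: is_vertex_weight_def)
    next
      case False
      have nonempty: "\<exists>es. es \<noteq> [] \<and> walk G v0 es w" if w: "w \<in> verts G" for w
      proof -
        obtain e where e: "e \<in> edges G" using False by blast
        obtain as where as: "walk G v0 as (src G e)"
          using bip v0 edge[OF e] unfolding bipartite_graph_def by blast
        obtain bs where bs: "walk G (tgt G e) bs w"
          using bip w edge[OF e] unfolding bipartite_graph_def by blast
        have "walk G v0 (as @ e # bs) w" using as bs e walk_append[OF bip] by auto
        then show ?thesis by blast
      qed
      define p where "p w = (SOME es. es \<noteq> [] \<and> walk G v0 es w)" for w
      have p: "p w \<noteq> [] \<and> walk G v0 (p w) w" if "w \<in> verts G" for w
        unfolding p_def using someI_ex[OF nonempty[OF that]] .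
      define m where "m w = prod_list (map (weight G) (p w))" for w
      have mpos: "m w > 0" if "w \<in> verts G" for w
        unfolding m_def using pos p[OF that] by blast
      have "weight G e = m (tgt G e) / m (src G e)" if e: "e \<in> edges G" for e
      proof -
        have "walk G v0 (p (src G e) @ [e]) (tgt G e)"
          using p edge[OF e] e walk_append[OF bip] by auto
        then have "m (tgt G e) = prod_list (map (weight G) (p (src G e) @ [e]))"
          unfolding m_def using indep p edge[OF e] by blast
        then have "m (tgt G e) = m (src G e) * weight G e" by (simp add: m_def)
        then show ?thesis using mpos[OF edge(1)[OF e]] by simp
      qed
      then have "is_vertex_weight G m" using mpos by (simp add: is_vertex_weight_def)
      then show ?thesis by blast
    qed
  qed
  then show ?thesis unfolding vertex_weight_def by (rule someI_ex)
qed


section \<open>Shaded planar tangles\<close>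

text \<open>\<open>Pos\<close> is the unshaded (even) colour and \<open>Neg\<close> the shaded (odd) one.  Crossing \<open>k\<close> strings
  changes the colour \<open>k\<close> times.\<close>

datatype sign = Pos | Neg

definition shade :: "sign \<Rightarrow> nat \<Rightarrow> sign" where
  "shade \<epsilon> k = (if even k then \<epsilon> else (case \<epsilon> of Pos \<Rightarrow> Neg | Neg \<Rightarrow> Pos))"

text \<open>
  A tangle whose inner discs carry labels is written in standard form.  All discs are rectangles
  with as many strings on top as on the bottom and with the marked interval on the left, and the
  heights are generic, so that the tangle is a vertical stack of layers, listed from top to
  bottom.  Each layer contains one local minimum (\<open>Cup\<close>, joining two strings that come from
  above), one local maximum (\<open>Cap\<close>, creating two strings that go down) or one inner rectangle
  (\<open>Box n x\<close>, with \<open>n\<close> strings on top, \<open>n\<close> on the bottom and label \<open>x\<close>); its other strings are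
  vertical.  The number in a layer counts the strings to the left of that piece.

  An action of tangles by multilinear maps is thus a function of labelled tangles that is linear
  in each label.
\<close>

datatype 'x piece = Cup | Cap | Box nat 'x

type_synonym 'x tangle = "(nat \<times> 'x piece) list"

fun ins :: "'x piece \<Rightarrow> nat" where
  "ins Cup = 2"
| "ins Cap = 0"
| "ins (Box n x) = n"

fun outs :: "'x piece \<Rightarrow> nat" where
  "outs Cup = 0"
| "outs Cap = 2"
| "outs (Box n x) = n"

text \<open>\<open>tangle A \<epsilon> m T m'\<close>: \<open>T\<close> is a diagram with \<open>m\<close> strings at the top, \<open>m'\<close> at the bottom and
  leftmost region of colour \<open>\<epsilon>\<close>, and every box with \<open>n\<close> strings whose left side has colour \<open>\<eta>\<close> is
  labelled by an element of \<open>A \<eta> n\<close>.\<close>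

fun tangle :: "(sign \<Rightarrow> nat \<Rightarrow> 'x set) \<Rightarrow> sign \<Rightarrow> nat \<Rightarrow> 'x tangle \<Rightarrow> nat \<Rightarrow> bool" where
  "tangle A \<epsilon> m [] m' \<longleftrightarrow> m = m'"
| "tangle A \<epsilon> m ((k, p) # T) m' \<longleftrightarrow>
     k + ins p \<le> m \<and>
     (case p of Box n x \<Rightarrow> x \<in> A (shade \<epsilon> k) n | _ \<Rightarrow> True) \<and>
     tangle A \<epsilon> (m - ins p + outs p) T m'"

definition shift :: "nat \<Rightarrow> 'x tangle \<Rightarrow> 'x tangle" where
  "shift j T = map (\<lambda>(k, p). (j + k, p)) T"

fun relabel_piece :: "(sign \<Rightarrow> nat \<Rightarrow> 'x \<Rightarrow> 'y) \<Rightarrow> sign \<Rightarrow> 'x piece \<Rightarrow> 'y piece" where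
  "relabel_piece f \<eta> Cup = Cup"
| "relabel_piece f \<eta> Cap = Cap"
| "relabel_piece f \<eta> (Box n x) = Box n (f \<eta> n x)"

definition relabel :: "(sign \<Rightarrow> nat \<Rightarrow> 'x \<Rightarrow> 'y) \<Rightarrow> sign \<Rightarrow> 'x tangle \<Rightarrow> 'y tangle" where
  "relabel f \<epsilon> T = map (\<lambda>(k, p). (k, relabel_piece f (shade \<epsilon> k) p)) T"

fun flip_piece :: "'x piece \<Rightarrow> 'x piece" where
  "flip_piece Cup = Cap"
| "flip_piece Cap = Cup"
| "flip_piece (Box n x) = Box n x"

text \<open>Reflection in a horizontal line (labels unchanged).\<close>

definition reflect :: "'x tangle \<Rightarrow> 'x tangle" where
  "reflect T = rev (map (\<lambda>(k, p). (k, flip_piece p)) T)"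

text \<open>\<open>n\<close> nested maxima (minima), the outermost of which has \<open>k\<close> strings to its left.\<close>

definition caps :: "nat \<Rightarrow> nat \<Rightarrow> 'x tangle" where
  "caps k n = map (\<lambda>i. (k + i, Cap)) [0..<n]"

definition cups :: "nat \<Rightarrow> nat \<Rightarrow> 'x tangle" where
  "cups k n = map (\<lambda>i. (k + i, Cup)) (rev [0..<n])"

text \<open>
  Two standard forms describe isotopic tangles if and only if they are related by the following
  local moves: two pieces, one to the left of the other, exchange their heights; a zigzag is
  straightened; the two ways of turning a disc by half a turn agree, that is, a disc may be
  rotated by a full turn.
\<close>

inductive move :: "'x tangle \<Rightarrow> 'x tangle \<Rightarrow> bool" where
  exchange: "move [(k, p), (k + outs p + d, q)] [(k + ins p + d, q), (k, p)]"
| zigzag1: "move [(k, Cap), (Suc k, Cup)] []"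
| zigzag2: "move [(Suc k, Cap), (k, Cup)] []"
| rotation: "move (caps (k + n) n @ [(k + n, Box n x)] @ cups k n)
                  (caps k n @ [(k + n, Box n x)] @ cups (k + n) n)"

definition isotopic ::
    "(sign \<Rightarrow> nat \<Rightarrow> 'x set) \<Rightarrow> sign \<Rightarrow> nat \<Rightarrow> 'x tangle \<Rightarrow> 'x tangle \<Rightarrow> bool" where
  "isotopic A \<epsilon> n = equivclp (\<lambda>T T'. tangle A \<epsilon> n T n \<and> tangle A \<epsilon> n T' n \<and>
     (\<exists>U V L R. move L R \<and> T = U @ L @ V \<and> T' = U @ R @ V))"


section \<open>Shaded planar \<open>*\<close>-algebras\<close>

text \<open>The spaces \<open>sp Q \<epsilon> n\<close> are subspaces of one ambient vector space, which plays no other role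
  (for an abstract family of spaces one may take their direct sum).  \<open>act Q \<epsilon> n T\<close> is the result of
  applying the tangle \<open>T\<close>, of type \<open>(\<epsilon>, n)\<close>, to its labels.\<close>

record 'x planar_data =
  sp :: "sign \<Rightarrow> nat \<Rightarrow> 'x set"
  scal :: "complex \<Rightarrow> 'x \<Rightarrow> 'x"
  star :: "sign \<Rightarrow> nat \<Rightarrow> 'x \<Rightarrow> 'x"
  act :: "sign \<Rightarrow> nat \<Rightarrow> 'x tangle \<Rightarrow> 'x"

locale planar_star_algebra =
  fixes Q :: "'x::ab_group_add planar_data"
  assumes vector_space: "vector_space (scal Q)"
    and subspace: "module.subspace (scal Q) (sp Q \<epsilon> n)"
    and act_closed: "tangle (sp Q) \<epsilon> n T n \<Longrightarrow> act Q \<epsilon> n T \<in> sp Q \<epsilon> n"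
    and act_linear:
      "\<lbrakk>x \<in> sp Q (shade \<epsilon> k) r; y \<in> sp Q (shade \<epsilon> k) r;
        tangle (sp Q) \<epsilon> n (U @ [(k, Box r x)] @ V) n\<rbrakk> \<Longrightarrow>
        act Q \<epsilon> n (U @ [(k, Box r (scal Q c x + y))] @ V) =
        scal Q c (act Q \<epsilon> n (U @ [(k, Box r x)] @ V)) + act Q \<epsilon> n (U @ [(k, Box r y)] @ V)"
    and act_isotopic: "isotopic (sp Q) \<epsilon> n T T' \<Longrightarrow> act Q \<epsilon> n T = act Q \<epsilon> n T'"
    and act_identity: "x \<in> sp Q \<epsilon> n \<Longrightarrow> act Q \<epsilon> n [(0, Box n x)] = x"
    and act_composition:
      "\<lbrakk>tangle (sp Q) (shade \<epsilon> k) r S r;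
        tangle (sp Q) \<epsilon> n (U @ [(k, Box r (act Q (shade \<epsilon> k) r S))] @ V) n\<rbrakk> \<Longrightarrow>
        act Q \<epsilon> n (U @ [(k, Box r (act Q (shade \<epsilon> k) r S))] @ V) = act Q \<epsilon> n (U @ shift k S @ V)"
    and star_closed: "x \<in> sp Q \<epsilon> n \<Longrightarrow> star Q \<epsilon> n x \<in> sp Q \<epsilon> n"
    and star_star: "x \<in> sp Q \<epsilon> n \<Longrightarrow> star Q \<epsilon> n (star Q \<epsilon> n x) = x"
    and star_antilinear: "\<lbrakk>x \<in> sp Q \<epsilon> n; y \<in> sp Q \<epsilon> n\<rbrakk> \<Longrightarrow>
        star Q \<epsilon> n (scal Q c x + y) = scal Q (cnj c) (star Q \<epsilon> n x) + star Q \<epsilon> n y"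
    and star_act: "tangle (sp Q) \<epsilon> n T n \<Longrightarrow>
        star Q \<epsilon> n (act Q \<epsilon> n T) = act Q \<epsilon> n (reflect (relabel (star Q) \<epsilon> T))"

definition planar_embedding ::
    "'x::ab_group_add planar_data \<Rightarrow> 'y::ab_group_add planar_data \<Rightarrow>
      (sign \<Rightarrow> nat \<Rightarrow> 'x \<Rightarrow> 'y) \<Rightarrow> bool" where
  "planar_embedding Q P \<phi> \<longleftrightarrow>
     (\<forall>\<epsilon> n. \<phi> \<epsilon> n ` sp Q \<epsilon> n \<subseteq> sp P \<epsilon> n \<and> inj_on (\<phi> \<epsilon> n) (sp Q \<epsilon> n)) \<and>
     (\<forall>\<epsilon> n c. \<forall>x\<in>sp Q \<epsilon> n. \<forall>y\<in>sp Q \<epsilon> n.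
        \<phi> \<epsilon> n (scal Q c x + y) = scal P c (\<phi> \<epsilon> n x) + \<phi> \<epsilon> n y) \<and>
     (\<forall>\<epsilon> n. \<forall>x\<in>sp Q \<epsilon> n. \<phi> \<epsilon> n (star Q \<epsilon> n x) = star P \<epsilon> n (\<phi> \<epsilon> n x)) \<and>
     (\<forall>\<epsilon> n T. tangle (sp Q) \<epsilon> n T n \<longrightarrow>
        \<phi> \<epsilon> n (act Q \<epsilon> n T) = act P \<epsilon> n (relabel \<phi> \<epsilon> T))"


section \<open>The planar algebra of a bipartite weighted graph\<close>

text \<open>A path is a pair of its source and the list of its edges.\<close>

type_synonym ('v, 'e) path = "'v \<times> 'e list"
type_synonym ('v, 'e) path_matrix = "('v, 'e) path \<Rightarrow> ('v, 'e) path \<Rightarrow> complex"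

definition endpoint :: "('v, 'e) wgraph \<Rightarrow> ('v, 'e) path \<Rightarrow> 'v" where
  "endpoint G a = (if snd a = [] then fst a else tgt G (last (snd a)))"

definition sign_verts :: "('v, 'e) wgraph \<Rightarrow> sign \<Rightarrow> 'v set" where
  "sign_verts G \<epsilon> = (case \<epsilon> of Pos \<Rightarrow> even_verts G | Neg \<Rightarrow> odd_verts G)"

definition paths :: "('v, 'e) wgraph \<Rightarrow> sign \<Rightarrow> nat \<Rightarrow> ('v, 'e) path set" where
  "paths G \<epsilon> n = {(v, es). v \<in> sign_verts G \<epsilon> \<and> length es = n \<and> (\<exists>w. walk G v es w)}"

definition gpa_space :: "('v, 'e) wgraph \<Rightarrow> sign \<Rightarrow> nat \<Rightarrow> ('v, 'e) path_matrix set" where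
  "gpa_space G \<epsilon> n = generated_vN (paths G \<epsilon> n)
     {matrix_unit a b | a b. a \<in> paths G \<epsilon> n \<and> b \<in> paths G \<epsilon> n \<and>
        fst a = fst b \<and> endpoint G a = endpoint G b}"

text \<open>
  A state of a tangle is recorded by the paths that it induces on the horizontal lines
  between consecutive layers (read from left to right).  The next two functions describe a layer
  with the path \<open>(v, es)\<close> above it and \<open>(v, es')\<close> below it: whether the two paths fit together in
  a state, and the contribution of the layer, in which the label of a box is expanded into matrix
  units.  At a minimum or maximum, whose string is read as the edge \<open>c\<close> where it is entered from the
  left, the enclosed region carries \<open>tgt G c\<close> and the other one \<open>src G c\<close>.
\<close>

fun compatible :: "('v, 'e) wgraph \<Rightarrow> nat \<times> 'x piece \<Rightarrow> 'e list \<Rightarrow> 'e list \<Rightarrow> bool" where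
  "compatible G (k, Cup) es es' \<longleftrightarrow>
     (\<exists>u c w. length u = k \<and> es = u @ [c, rev_edge G c] @ w \<and> es' = u @ w)"
| "compatible G (k, Cap) es es' \<longleftrightarrow>
     (\<exists>u c w. length u = k \<and> es = u @ w \<and> es' = u @ [c, rev_edge G c] @ w)"
| "compatible G (k, Box n x) es es' \<longleftrightarrow>
     (\<exists>u a b w. length u = k \<and> length a = n \<and> length b = n \<and> es = u @ a @ w \<and> es' = u @ b @ w)"

fun contribution :: "('v, 'e) wgraph \<Rightarrow> 'v \<Rightarrow> nat \<times> ('v, 'e) path_matrix piece \<Rightarrow>
    'e list \<Rightarrow> 'e list \<Rightarrow> complex" where
  "contribution G v (k, Cup) es es' =
     of_real (sqrt (vertex_weight G (tgt G (es ! k)) / vertex_weight G (src G (es ! k))))"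
| "contribution G v (k, Cap) es es' =
     of_real (sqrt (vertex_weight G (tgt G (es' ! k)) / vertex_weight G (src G (es' ! k))))"
| "contribution G v (k, Box n x) es es' =
     (let u = endpoint G (v, take k es)
      in x (u, take n (drop k es)) (u, take n (drop k es')))"

text \<open>The states of \<open>T\<close> that read \<open>(v, es)\<close> along the top and \<open>(v, es')\<close> along the bottom, where
  \<open>w\<close> is the vertex of the rightmost region.\<close>

definition states :: "('v, 'e) wgraph \<Rightarrow> 'x tangle \<Rightarrow> 'v \<Rightarrow> 'v \<Rightarrow> 'e list \<Rightarrow> 'e list \<Rightarrow>
    'e list list set" where
  "states G T v w es es' = {\<sigma>. length \<sigma> = Suc (length T) \<and> \<sigma> ! 0 = es \<and> last \<sigma> = es' \<and>
     (\<forall>\<tau>\<in>set \<sigma>. walk G v \<tau> w) \<and>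
     (\<forall>i<length T. compatible G (T ! i) (\<sigma> ! i) (\<sigma> ! Suc i))}"

text \<open>The entry at \<open>(a, b)\<close> of the state sum.  Since \<open>G\<close> is locally finite, the set of states with
  prescribed boundary is finite.\<close>

definition gpa_act :: "('v, 'e) wgraph \<Rightarrow> sign \<Rightarrow> nat \<Rightarrow> ('v, 'e) path_matrix tangle \<Rightarrow>
    ('v, 'e) path_matrix" where
  "gpa_act G \<epsilon> n T = (\<lambda>a b.
     if a \<in> paths G \<epsilon> n \<and> b \<in> paths G \<epsilon> n \<and> fst a = fst b \<and> endpoint G a = endpoint G b
     then \<Sum>\<sigma>\<in>states G T (fst a) (endpoint G a) (snd a) (snd b).
            \<Prod>i<length T. contribution G (fst a) (T ! i) (\<sigma> ! i) (\<sigma> ! Suc i)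
     else 0)"

definition graph_planar_algebra :: "('v, 'e) wgraph \<Rightarrow> ('v, 'e) path_matrix planar_data" where
  "graph_planar_algebra G =
     \<lparr> sp = gpa_space G,
       scal = (\<lambda>c x a b. c * x a b),
       star = (\<lambda>\<epsilon> n x a b. cnj (x b a)),
       act = gpa_act G \<rparr>"


section \<open>Subfactor planar algebras\<close>

definition unit0 :: "'x planar_data \<Rightarrow> sign \<Rightarrow> 'x" where
  "unit0 Q \<epsilon> = act Q \<epsilon> 0 []"

text \<open>The scalar corresponding to an element of \<open>sp Q \<epsilon> 0\<close>, when that space is identified
  with \<open>\<complex>\<close>.\<close>

definition scalar_of :: "'x planar_data \<Rightarrow> sign \<Rightarrow> 'x \<Rightarrow> complex" where
  "scalar_of Q \<epsilon> y = (THE c. y = scal Q c (unit0 Q \<epsilon>))"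

definition mult :: "'x planar_data \<Rightarrow> sign \<Rightarrow> nat \<Rightarrow> 'x \<Rightarrow> 'x \<Rightarrow> 'x" where
  "mult Q \<epsilon> n x y = act Q \<epsilon> n [(0, Box n x), (0, Box n y)]"

definition tau_r :: "'x planar_data \<Rightarrow> sign \<Rightarrow> nat \<Rightarrow> 'x \<Rightarrow> complex" where
  "tau_r Q \<epsilon> n x = scalar_of Q \<epsilon> (act Q \<epsilon> 0 (caps 0 n @ [(0, Box n x)] @ cups 0 n))"

definition tau_l :: "'x planar_data \<Rightarrow> sign \<Rightarrow> nat \<Rightarrow> 'x \<Rightarrow> complex" where
  "tau_l Q \<epsilon> n x =
     scalar_of Q (shade \<epsilon> n) (act Q (shade \<epsilon> n) 0 (caps 0 n @ [(n, Box n x)] @ cups 0 n))"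

locale subfactor_planar_algebra = planar_star_algebra +
  assumes finite_dim: "\<exists>B. finite B \<and> sp Q \<epsilon> n = module.span (scal Q) B"
    and unit0_nonzero: "unit0 Q \<epsilon> \<noteq> 0"
    and space0: "sp Q \<epsilon> 0 = range (\<lambda>c. scal Q c (unit0 Q \<epsilon>))"
    and spherical: "x \<in> sp Q \<epsilon> n \<Longrightarrow> tau_l Q \<epsilon> n x = tau_r Q \<epsilon> n x"
    and tau_l_positive: "\<lbrakk>x \<in> sp Q \<epsilon> n; x \<noteq> 0\<rbrakk> \<Longrightarrow>
      \<exists>r>0. tau_l Q \<epsilon> n (mult Q \<epsilon> n x (star Q \<epsilon> n x)) = complex_of_real r"
    and tau_r_positive: "\<lbrakk>x \<in> sp Q \<epsilon> n; x \<noteq> 0\<rbrakk> \<Longrightarrow>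
      \<exists>r>0. tau_r Q \<epsilon> n (mult Q \<epsilon> n x (star Q \<epsilon> n x)) = complex_of_real r"

text \<open>By sphericity (applied to the vertical string), the loops in the two colours have the same
  value; it is positive by positivity of the traces.\<close>

definition modulus :: "'x planar_data \<Rightarrow> real" where
  "modulus Q = Re (scalar_of Q Pos (act Q Pos 0 [(0, Cap), (0, Cup)]))"


section \<open>Principal graph and amenability\<close>

text \<open>The Bratteli diagram of \<open>sp Q Pos 0 \<subseteq> sp Q Pos 1 \<subseteq> \<dots>\<close>: the vertices at level \<open>n\<close> are the minimal
  central projections of \<open>sp Q Pos n\<close>.\<close>

definition projections :: "'x planar_data \<Rightarrow> nat \<Rightarrow> 'x set" where
  "projections Q n = {f \<in> sp Q Pos n. mult Q Pos n f f = f \<and> star Q Pos n f = f}"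

definition central_projections :: "'x planar_data \<Rightarrow> nat \<Rightarrow> 'x set" where
  "central_projections Q n =
     {f \<in> projections Q n. \<forall>x\<in>sp Q Pos n. mult Q Pos n f x = mult Q Pos n x f}"

definition minimals :: "'x::zero planar_data \<Rightarrow> nat \<Rightarrow> 'x set \<Rightarrow> 'x set" where
  "minimals Q n S = {f \<in> S. f \<noteq> 0 \<and> (\<forall>g\<in>S. g \<noteq> 0 \<and> mult Q Pos n g f = g \<longrightarrow> g = f)}"

abbreviation min_projections :: "'x::zero planar_data \<Rightarrow> nat \<Rightarrow> 'x set" where
  "min_projections Q n \<equiv> minimals Q n (projections Q n)"

abbreviation bratteli_vertices :: "'x::zero planar_data \<Rightarrow> nat \<Rightarrow> 'x set" where
  "bratteli_vertices Q n \<equiv> minimals Q n (central_projections Q n)"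

text \<open>The inclusion adds a vertical string on the right.\<close>

definition incl :: "'x planar_data \<Rightarrow> nat \<Rightarrow> 'x \<Rightarrow> 'x" where
  "incl Q n x = act Q Pos (Suc n) [(0, Box n x)]"

text \<open>The number of edges between \<open>p\<close> at level \<open>n\<close> and \<open>q\<close> at level \<open>n + 1\<close>: the number of minimal
  projections into which \<open>f q\<close> decomposes at level \<open>n + 1\<close>, for a minimal projection \<open>f \<le> p\<close>
  at level \<open>n\<close>.\<close>

definition bratteli_mult :: "'x::ab_group_add planar_data \<Rightarrow> nat \<Rightarrow> 'x \<Rightarrow> 'x \<Rightarrow> nat" where
  "bratteli_mult Q n p q = (THE m. \<exists>f S.
     f \<in> min_projections Q n \<and> mult Q Pos n f p = f \<and>
     S \<subseteq> min_projections Q (Suc n) \<and> finite S \<and> card S = m \<and>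
     (\<forall>g\<in>S. \<forall>h\<in>S. g \<noteq> h \<longrightarrow> mult Q Pos (Suc n) g h = 0) \<and>
     mult Q Pos (Suc n) (incl Q n f) q = \<Sum>S)"

text \<open>The Bratteli diagram between the levels \<open>n - 1\<close> and \<open>n\<close> consists of the reflection of the one
  between the levels \<open>n - 2\<close> and \<open>n - 1\<close> and of a new part.  The reflected vertices at level
  \<open>n\<close> are the summands of the ideal generated by the Jones projection, a multiple of the tangle with
  a minimum above a maximum at the last two strings.  The principal graph consists of the other
  vertices.\<close>

definition principal_vertices :: "'x::ab_group_add planar_data \<Rightarrow> (nat \<times> 'x) set" where
  "principal_vertices Q = {(n, q). q \<in> bratteli_vertices Q n \<and>
     (2 \<le> n \<longrightarrow> mult Q Pos n q (act Q Pos n [(n - 2, Cup), (n - 2, Cap)]) = 0)}"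

definition principal_adjacency ::
    "'x::ab_group_add planar_data \<Rightarrow> nat \<times> 'x \<Rightarrow> nat \<times> 'x \<Rightarrow> complex" where
  "principal_adjacency Q = (\<lambda>(n, p) (m, q).
     if m = Suc n then of_nat (bratteli_mult Q n p q)
     else if n = Suc m then of_nat (bratteli_mult Q m q p)
     else 0)"

definition amenable :: "'x::ab_group_add planar_data \<Rightarrow> bool" where
  "amenable Q \<longleftrightarrow>
     op_norm (principal_vertices Q) (principal_adjacency Q) = ennreal (modulus Q)"

end

theory Submission
  imports Defs "HOL-Computational_Algebra.Fundamental_Theorem_Algebra"
begin

text \<open>
  Since \<open>\<parallel>\<Gamma>\<parallel> < \<delta>\<close>, a resolvent of the adjacency matrix gives a positive function \<open>h\<close> on the
  vertices of \<open>\<Gamma>\<close> with \<open>\<Gamma> h \<le> r h\<close> for some \<open>r < \<delta>\<close>.  Fix an even vertex \<open>v\<close>.  Restricting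
  an element of \<open>Q\<close> to the paths that start at \<open>v\<close> is faithful, because \<open>\<tau>\<^sub>r (x x\<^sup>*)\<close> is a
  positive combination of the squares of the entries that remain.  Weighting the diagonal entry at a path
  by \<open>h\<close> at its endpoint therefore gives a faithful trace on each \<open>sp Q Pos n\<close>, and adding a
  string on the right multiplies it by at most \<open>r\<close>.  Let \<open>\<xi>(p)\<close> be the trace of a minimal projection
  \<open>f\<close> below the vertex \<open>p\<close> of the principal graph.  Decomposing \<open>f \<otimes> 1\<close>, with Frobenius
  reciprocity for the edges that go down, shows that the adjacency matrix sends \<open>\<xi>\<close> to a function
  that is at most \<open>r \<xi>\<close>.  The Schur test bounds the norm of the principal graph by \<open>r\<close>, which is
  less than \<open>\<delta>\<close>, the modulus of \<open>Q\<close>.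
\<close>

section \<open>Finite-dimensional \<open>*\<close>-algebras with a faithful trace\<close>

text \<open>The trace coming from sphericity is multiplied by exactly \<delta> when a string is
  added, so by itself it only yields the bound \<delta>. The gain has to come from \<Gamma>, through
  a trace that is not a Markov trace: for an added string it satisfies only an inequality, and
  closing the last string need not preserve it. The obstacle is therefore the edges that go down.
  One identity survives for every weight at the endpoint: a path that runs along an edge and back
  ends where it started, so a minimum can be moved cyclically around a trace, and the trace of
  \<open>jones m\<close> times x at level m + 2 equals that of \<open>cond_exp m x\<close> at level
  m. The normalising scalars of the projections built for the edges down cancel in this identity, so
  that such an edge contributes precisely the value of \<xi> at its lower end. That these scalars
  are positive is read off from a second trace, weighted by \<open>vertex_weight G\<close>, which
  closing the last string does preserve. The projections for the edges down lie in the Jones ideal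
  and those for the edges up are annihilated by it; both kinds thus fit orthogonally below f with a
  string added.\<close>

locale trace_star_algebra = vs: vector_space scl
  for scl :: "complex \<Rightarrow> 'a::ab_group_add \<Rightarrow> 'a" +
  fixes A :: "'a set" and mul :: "'a \<Rightarrow> 'a \<Rightarrow> 'a" (infixl "\<odot>" 70)
    and st :: "'a \<Rightarrow> 'a" and one :: 'a and tr :: "'a \<Rightarrow> complex"
  assumes subsp: "vs.subspace A"
    and fin_dim: "\<exists>B. finite B \<and> A \<subseteq> vs.span B"
    and mul_closed [simp]: "x \<in> A \<Longrightarrow> y \<in> A \<Longrightarrow> x \<odot> y \<in> A"
    and mul_assoc: "x \<in> A \<Longrightarrow> y \<in> A \<Longrightarrow> z \<in> A \<Longrightarrow> x \<odot> y \<odot> z = x \<odot> (y \<odot> z)"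
    and add_mul: "x \<in> A \<Longrightarrow> y \<in> A \<Longrightarrow> z \<in> A \<Longrightarrow> (x + y) \<odot> z = x \<odot> z + y \<odot> z"
    and mul_add: "x \<in> A \<Longrightarrow> y \<in> A \<Longrightarrow> z \<in> A \<Longrightarrow> z \<odot> (x + y) = z \<odot> x + z \<odot> y"
    and scl_mul: "x \<in> A \<Longrightarrow> y \<in> A \<Longrightarrow> scl c x \<odot> y = scl c (x \<odot> y)"
    and mul_scl: "x \<in> A \<Longrightarrow> y \<in> A \<Longrightarrow> x \<odot> scl c y = scl c (x \<odot> y)"
    and one_closed [simp]: "one \<in> A"
    and one_mul [simp]: "x \<in> A \<Longrightarrow> one \<odot> x = x"
    and mul_one [simp]: "x \<in> A \<Longrightarrow> x \<odot> one = x"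
    and st_closed [simp]: "x \<in> A \<Longrightarrow> st x \<in> A"
    and st_st [simp]: "x \<in> A \<Longrightarrow> st (st x) = x"
    and st_add: "x \<in> A \<Longrightarrow> y \<in> A \<Longrightarrow> st (x + y) = st x + st y"
    and st_scl: "x \<in> A \<Longrightarrow> st (scl c x) = scl (cnj c) (st x)"
    and st_mul: "x \<in> A \<Longrightarrow> y \<in> A \<Longrightarrow> st (x \<odot> y) = st y \<odot> st x"
    and tr_add: "x \<in> A \<Longrightarrow> y \<in> A \<Longrightarrow> tr (x + y) = tr x + tr y"
    and tr_scl: "x \<in> A \<Longrightarrow> tr (scl c x) = c * tr x"
    and tr_mul: "x \<in> A \<Longrightarrow> y \<in> A \<Longrightarrow> tr (x \<odot> y) = tr (y \<odot> x)"
    and tr_pos: "x \<in> A \<Longrightarrow> x \<noteq> 0 \<Longrightarrow> \<exists>r>0. tr (x \<odot> st x) = complex_of_real r"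
begin

lemma zero_closed [simp]: "0 \<in> A"
  and add_closed [simp]: "x \<in> A \<Longrightarrow> y \<in> A \<Longrightarrow> x + y \<in> A"
  and scl_closed [simp]: "x \<in> A \<Longrightarrow> scl c x \<in> A"
  and diff_closed [simp]: "x \<in> A \<Longrightarrow> y \<in> A \<Longrightarrow> x - y \<in> A"
  and sum_closed [simp]: "(\<And>i. i \<in> I \<Longrightarrow> F i \<in> A) \<Longrightarrow> sum F I \<in> A"
  using subsp by (auto simp: vs.subspace_def intro: vs.subspace_diff vs.subspace_sum)

lemma zero_mul [simp]: "x \<in> A \<Longrightarrow> 0 \<odot> x = 0"
  using scl_mul[of x x 0] by simp

lemma mul_zero [simp]: "x \<in> A \<Longrightarrow> x \<odot> 0 = 0"
  using mul_scl[of x x 0] by simp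

lemma tr_zero [simp]: "tr 0 = 0"
  using tr_scl[of 0 0] by simp

lemma diff_eq: "x - y = x + scl (-1) y"
  by simp

lemma diff_mul: "x \<in> A \<Longrightarrow> y \<in> A \<Longrightarrow> z \<in> A \<Longrightarrow> (x - y) \<odot> z = x \<odot> z - y \<odot> z"
  unfolding diff_eq by (subst add_mul) (auto simp: scl_mul simp del: vs.scale_minus_left)

lemma mul_diff: "x \<in> A \<Longrightarrow> y \<in> A \<Longrightarrow> z \<in> A \<Longrightarrow> z \<odot> (x - y) = z \<odot> x - z \<odot> y"
  unfolding diff_eq by (subst mul_add) (auto simp: mul_scl simp del: vs.scale_minus_left)

lemma st_diff: "x \<in> A \<Longrightarrow> y \<in> A \<Longrightarrow> st (x - y) = st x - st y"
  unfolding diff_eq by (subst st_add) (auto simp: st_scl simp del: vs.scale_minus_left)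

lemma tr_diff: "x \<in> A \<Longrightarrow> y \<in> A \<Longrightarrow> tr (x - y) = tr x - tr y"
  unfolding diff_eq by (subst tr_add) (auto simp: tr_scl simp del: vs.scale_minus_left)

lemma st_zero [simp]: "st 0 = 0"
  using st_diff[of 0 0] by simp

lemma sum_mul: "(\<And>i. i \<in> I \<Longrightarrow> F i \<in> A) \<Longrightarrow> x \<in> A \<Longrightarrow> sum F I \<odot> x = (\<Sum>i\<in>I. F i \<odot> x)"
  by (induction I rule: infinite_finite_induct) (auto simp: add_mul)

lemma mul_sum: "(\<And>i. i \<in> I \<Longrightarrow> F i \<in> A) \<Longrightarrow> x \<in> A \<Longrightarrow> x \<odot> sum F I = (\<Sum>i\<in>I. x \<odot> F i)"
  by (induction I rule: infinite_finite_induct) (auto simp: mul_add)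

lemma st_sum: "(\<And>i. i \<in> I \<Longrightarrow> F i \<in> A) \<Longrightarrow> st (sum F I) = (\<Sum>i\<in>I. st (F i))"
  by (induction I rule: infinite_finite_induct) (auto simp: st_add)

lemma tr_sum: "(\<And>i. i \<in> I \<Longrightarrow> F i \<in> A) \<Longrightarrow> tr (sum F I) = (\<Sum>i\<in>I. tr (F i))"
  by (induction I rule: infinite_finite_induct) (auto simp: tr_add)

section \<open>The inner product given by the trace\<close>

lemma tr_eq_0: "x \<in> A \<Longrightarrow> tr (x \<odot> st x) = 0 \<longleftrightarrow> x = 0"
  using tr_pos[of x] by fastforce

lemma tr_eq_0': "x \<in> A \<Longrightarrow> tr (st x \<odot> x) = 0 \<longleftrightarrow> x = 0"
  using tr_eq_0[of x] tr_mul[of x "st x"] by simp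

lemma span_subset: "B \<subseteq> A \<Longrightarrow> vs.span B \<subseteq> A"
  using subsp by (rule vs.span_minimal[rotated])

text \<open>Gram-Schmidt for the form \<open>tr (st x \<odot> w)\<close>, which is positive definite
  by \<open>tr_pos\<close>. Units of ideals, and through them the projections that the structure
  theory needs, are obtained from this inner product.\<close>

lemma orth_projection_span:
  assumes "finite B" "B \<subseteq> A"
  shows "\<forall>w\<in>A. \<exists>j\<in>vs.span B. \<forall>x\<in>vs.span B. tr (st x \<odot> (w - j)) = 0"
  using assms
proof (induction B)
  case empty
  then show ?case by (simp add: tr_mul[of 0])
next
  case (insert b B)
  have sub: "vs.span B \<subseteq> A" using insert.prems span_subset by blast
  have bA: "b \<in> A" using insert.prems by blast
  obtain k where k: "k \<in> vs.span B" "\<And>x. x \<in> vs.span B \<Longrightarrow> tr (st x \<odot> (b - k)) = 0"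
    using insert bA by blast
  define b' where "b' = b - k"
  have kA: "k \<in> A" and b'A: "b' \<in> A" using k(1) sub bA by (auto simp: b'_def)
  have span: "vs.span (insert b B) = {x. \<exists>c. x - scl c b' \<in> vs.span B}"
  proof -
    have "x - scl c b \<in> vs.span B \<longleftrightarrow> x - scl c b' \<in> vs.span B" for x c
    proof -
      have *: "x - scl c b' = (x - scl c b) + scl c k"
        by (simp add: b'_def vs.scale_right_diff_distrib)
      show ?thesis unfolding * using vs.span_add_eq2[of "scl c k" B] k(1) vs.span_scale by blast
    qed
    then show ?thesis by (simp add: vs.span_insert)
  qed
  have orth: "tr (st x \<odot> b') = 0" "tr (st b' \<odot> x) = 0" if "x \<in> vs.span B" for x
  proof -
    show 1: "tr (st x \<odot> b') = 0" using k(2)[OF that] by (simp add: b'_def)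
    have x: "x \<in> A" using that sub by blast
    \<comment> \<open>Conjugate symmetry of the form is derived by polarisation:
      \<open>tr (st y \<odot> y)\<close> is real for y = x + d b', and taking d = 1 and d the
      imaginary unit forces the second cross term to vanish along with the first.\<close>
    show "tr (st b' \<odot> x) = 0"
    proof (rule ccontr)
      have *: "tr (y \<odot> st y) = cnj (tr (y \<odot> st y))" if "y \<in> A" for y
        using tr_pos[OF that] that by (cases "y = 0") auto
      define a c where "a = tr (st x \<odot> b')" and "c = tr (st b' \<odot> x)"
      have s: "tr (y \<odot> st y) = tr (st y \<odot> y)" if "y \<in> A" for y
        using that by (simp add: tr_mul)
      have e: "tr (st (x + scl d b') \<odot> (x + scl d b')) =
          tr (st x \<odot> x) + d * a + cnj d * c + cnj d * d * tr (st b' \<odot> b')" for d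
        using x b'A
        by (simp add: a_def c_def st_add st_scl add_mul mul_add scl_mul mul_scl tr_add tr_scl algebra_simps)
      have r: "tr (st y \<odot> y) = cnj (tr (st y \<odot> y))" if "y \<in> A" for y
        using *[OF that] s[OF that] by simp
      have "d * a + cnj d * c = cnj (d * a + cnj d * c)" for d
      proof -
        have "tr (st x \<odot> x) + d * a + cnj d * c + cnj d * d * tr (st b' \<odot> b') =
          cnj (tr (st x \<odot> x) + d * a + cnj d * c + cnj d * d * tr (st b' \<odot> b'))"
          using r[of "x + scl d b'"] x b'A unfolding e by simp
        then show ?thesis using r[OF x] r[OF b'A] by (simp add: algebra_simps)
      qed
      from this[of 1] this[of \<i>] have "c = 0" using 1
        by (auto simp: a_def[symmetric] complex_eq_iff)
      moreover assume "tr (st b' \<odot> x) \<noteq> 0"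
      ultimately show False by (simp add: c_def)
    qed
  qed
  show ?case
  proof
    fix w assume w: "w \<in> A"
    obtain l where l: "l \<in> vs.span B" "\<And>x. x \<in> vs.span B \<Longrightarrow> tr (st x \<odot> (w - l)) = 0"
      using insert w by blast
    have lA: "l \<in> A" using l(1) sub by blast
    \<comment> \<open>The Fourier coefficient of w along b'; it is set to 0 when b already lies in
      the span of B.\<close>
    define c where "c = (if b' = 0 then 0 else tr (st b' \<odot> w) / tr (st b' \<odot> b'))"
    define j where "j = l + scl c b'"
    have jA: "j \<in> A" using lA b'A by (simp add: j_def)
    have "j \<in> vs.span (insert b B)" unfolding span j_def using l(1) by (auto intro!: exI[of _ c])
    moreover have "tr (st x \<odot> (w - j)) = 0" if x: "x \<in> vs.span (insert b B)" for x
    proof -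
      obtain d where d: "x - scl d b' \<in> vs.span B" using x unfolding span by blast
      define y where "y = x - scl d b'"
      have y: "y \<in> vs.span B" "y \<in> A" using d sub by (auto simp: y_def)
      have xe: "x = y + scl d b'" by (simp add: y_def)
      have wj: "w - j = (w - l) - scl c b'" by (simp add: j_def)
      have "tr (st y \<odot> (w - j)) = 0"
        unfolding wj using y w lA b'A l(2)[OF y(1)] orth(1)[OF y(1)]
        by (simp add: mul_diff[of "w - l"] mul_scl tr_diff[of "st y \<odot> (w - l)"] tr_scl)
      moreover have "tr (st b' \<odot> (w - j)) = 0"
        unfolding wj using w lA b'A orth(2)[OF l(1)] tr_eq_0'[OF b'A]
        by (auto simp: mul_diff mul_scl tr_diff tr_scl c_def)
      ultimately show ?thesis
        unfolding xe using y w jA b'A by (simp add: st_add st_scl add_mul scl_mul tr_add tr_scl)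
    qed
    ultimately show "\<exists>j\<in>vs.span (insert b B). \<forall>x\<in>vs.span (insert b B). tr (st x \<odot> (w - j)) = 0"
      by blast
  qed
qed

lemma finite_independent:
  obtains N where "\<And>S. vs.independent S \<Longrightarrow> S \<subseteq> A \<Longrightarrow> finite S \<and> card S \<le> N"
proof -
  obtain B where "finite B" "A \<subseteq> vs.span B" using fin_dim by blast
  then have "finite S \<and> card S \<le> card B" if "vs.independent S" "S \<subseteq> A" for S
    using vs.independent_span_bound[of B S] that by blast
  then show thesis using that by blast
qed

lemma orth_projection:
  assumes "vs.subspace I" "I \<subseteq> A" "w \<in> A"
  obtains j where "j \<in> I" "\<And>x. x \<in> I \<Longrightarrow> tr (st x \<odot> (w - j)) = 0"
proof -
  obtain B where B: "B \<subseteq> I" "vs.independent B" "I \<subseteq> vs.span B"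
    using vs.maximal_independent_subset by blast
  have "finite B" using finite_independent B assms by (metis order_trans)
  moreover have "vs.span B = I" using B assms(1) by (simp add: vs.span_subspace)
  ultimately show thesis using orth_projection_span[of B] assms B that by blast
qed

section \<open>Projections, central projections and minimality\<close>

definition proj :: "'a set" where
  "proj = {f \<in> A. f \<odot> f = f \<and> st f = f}"

definition cproj :: "'a set" where
  "cproj = {f \<in> proj. \<forall>x\<in>A. f \<odot> x = x \<odot> f}"

definition minims :: "'a set \<Rightarrow> 'a set" where
  "minims S = {f \<in> S. f \<noteq> 0 \<and> (\<forall>g\<in>S. g \<noteq> 0 \<and> g \<odot> f = g \<longrightarrow> g = f)}"

lemma projD: "f \<in> proj \<Longrightarrow> f \<in> A" "f \<in> proj \<Longrightarrow> f \<odot> f = f" "f \<in> proj \<Longrightarrow> st f = f"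
  by (auto simp: proj_def)

lemma minims_projD:
  assumes "f \<in> minims proj"
  shows "f \<in> proj" "f \<in> A" "f \<odot> f = f" "st f = f" "f \<noteq> 0"
  using assms by (auto simp: minims_def proj_def)

lemma minims_cprojD:
  assumes "f \<in> minims cproj"
  shows "f \<in> cproj" "f \<in> proj" "f \<in> A" "f \<odot> f = f" "st f = f" "f \<noteq> 0"
    "\<And>x. x \<in> A \<Longrightarrow> f \<odot> x = x \<odot> f"
  using assms by (auto simp: minims_def cproj_def proj_def)

lemma cprojD:
  assumes "p \<in> cproj"
  shows "p \<in> proj" "p \<in> A" "p \<odot> p = p" "st p = p" "\<And>x. x \<in> A \<Longrightarrow> p \<odot> x = x \<odot> p"
  using assms by (auto simp: cproj_def proj_def)

lemma cproj_mul:
  assumes p: "p \<in> cproj" and e: "e \<in> proj"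
  shows "e \<odot> p \<in> proj"
proof -
  note pD = cprojD[OF p] and eD = projD[OF e]
  have pe: "p \<odot> e = e \<odot> p" using pD(5) eD(1) .
  have "p \<odot> (e \<odot> p) = e \<odot> p" using pD(2,3) eD(1) pe by (metis mul_assoc)
  then have "e \<odot> p \<odot> (e \<odot> p) = e \<odot> p" using pD(2) eD(1,2) by (metis mul_assoc mul_closed)
  moreover have "st (e \<odot> p) = e \<odot> p" using pD(2,4) eD pe by (simp add: st_mul)
  ultimately show ?thesis using pD(2) eD(1) by (simp add: proj_def)
qed

lemma cproj_mul_cproj:
  assumes p: "p \<in> cproj" and q: "q \<in> cproj"
  shows "p \<odot> q \<in> cproj"
proof -
  note pD = cprojD[OF p] and qD = cprojD[OF q]
  have "p \<odot> q \<odot> x = x \<odot> (p \<odot> q)" if x: "x \<in> A" for x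
  proof -
    have "p \<odot> q \<odot> x = p \<odot> (x \<odot> q)" using x pD(2) qD(2) qD(5)[OF x] by (simp add: mul_assoc)
    also have "\<dots> = x \<odot> p \<odot> q" using x pD(2) qD(2) pD(5)[OF x] by (simp add: mul_assoc[symmetric])
    finally show ?thesis using x pD(2) qD(2) by (simp add: mul_assoc)
  qed
  then show ?thesis using cproj_mul[OF q pD(1)] by (simp add: cproj_def)
qed

lemma proj_mul_commute:
  assumes "f \<in> proj" "g \<in> proj" "g \<odot> f = g"
  shows "f \<odot> g = g"
  using assms by (metis projD(1) projD(3) st_mul)

lemma minims_projI:
  assumes "f \<in> minims proj" "g \<in> proj" "g \<noteq> 0" "f \<odot> g = g"
  shows "g = f"
proof -
  have "g \<odot> f = g" using proj_mul_commute assms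
    by (metis minims_projD(1) projD(1) projD(3) st_mul)
  then show ?thesis using assms by (auto simp: minims_def)
qed

text \<open>The unit is the orthogonal projection j of \<open>one\<close> onto the ideal. For x in I
  put k = st x (one - j): the element x k lies in I, hence is orthogonal to one - j, so the trace of
  st k k vanishes and k = 0. This makes j self-adjoint and idempotent.\<close>

lemma right_ideal_unit:
  assumes "vs.subspace I" "I \<subseteq> A" "\<And>x a. x \<in> I \<Longrightarrow> a \<in> A \<Longrightarrow> x \<odot> a \<in> I"
  obtains j where "j \<in> I" "j \<in> proj" "\<And>x. x \<in> I \<Longrightarrow> j \<odot> x = x"
proof -
  obtain j where j: "j \<in> I" "\<And>x. x \<in> I \<Longrightarrow> tr (st x \<odot> (one - j)) = 0"
    using orth_projection[OF assms(1,2) one_closed] by blast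
  have jA: "j \<in> A" using j assms by blast
  have *: "st j \<odot> x = x" if x: "x \<in> I" for x
  proof -
    have xA: "x \<in> A" using x assms by blast
    define k where "k = st x \<odot> (one - j)"
    have kA: "k \<in> A" using xA jA by (simp add: k_def)
    have "tr (st (x \<odot> k) \<odot> (one - j)) = 0" using j(2) assms(3)[OF x kA] by blast
    then have "tr (st k \<odot> k) = 0"
      using xA kA jA by (simp add: st_mul mul_assoc k_def)
    then have "k = 0" using kA tr_eq_0' by blast
    then have "st x = st x \<odot> j" using xA jA by (simp add: k_def mul_diff)
    then show ?thesis using xA jA by (metis st_mul st_st st_closed)
  qed
  have "st j \<odot> j = j" using * j(1) .
  then have sj: "st j = j" using jA by (metis st_mul st_st st_closed)
  have "j \<in> proj" using sj *[OF j(1)] jA by (simp add: proj_def)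
  then show thesis using j(1) * sj that by simp
qed

text \<open>For any x the product x j lies in the ideal, so j x j = x j. The same for st x, followed
  by the adjoint, gives j x j = j x.\<close>

lemma ideal_unit_central:
  assumes "vs.subspace I" "I \<subseteq> A" "\<And>x a. x \<in> I \<Longrightarrow> a \<in> A \<Longrightarrow> x \<odot> a \<in> I"
    "\<And>x a. x \<in> I \<Longrightarrow> a \<in> A \<Longrightarrow> a \<odot> x \<in> I"
  obtains j where "j \<in> I" "j \<in> cproj" "\<And>x. x \<in> I \<Longrightarrow> j \<odot> x = x"
proof -
  obtain j where j: "j \<in> I" "j \<in> proj" "\<And>x. x \<in> I \<Longrightarrow> j \<odot> x = x"
    using right_ideal_unit[OF assms(1-3)] by blast
  have jA: "j \<in> A" "st j = j" using j(2) by (auto simp: proj_def)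
  have 1: "j \<odot> (x \<odot> j) = x \<odot> j" if "x \<in> A" for x using j assms that by blast
  have "j \<odot> x = x \<odot> j" if x: "x \<in> A" for x
  proof -
    have "st (j \<odot> (st x \<odot> j)) = st (st x \<odot> j)" using 1 x by simp
    then have "j \<odot> x \<odot> j = j \<odot> x" using x jA by (simp add: st_mul)
    then show ?thesis using 1 x jA by (simp add: mul_assoc)
  qed
  then show thesis using j that by (auto simp: cproj_def)
qed

text \<open>The right annihilator of x below f is a right ideal, whose unit is a projection below f.
  By minimality this unit is 0 or f, and f would give x = x f = 0.\<close>

lemma corner_no_zero_divisors:
  assumes f: "f \<in> minims proj" and x: "x \<in> A" "x \<odot> f = x" "x \<noteq> 0"
    and y: "y \<in> A" "f \<odot> y = y" "x \<odot> y = 0"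
  shows "y = 0"
proof -
  note fD = minims_projD[OF f]
  define I where "I = {a \<in> A. f \<odot> a = a \<and> x \<odot> a = 0}"
  have "vs.subspace I"
    using fD x by (auto simp: I_def vs.subspace_def mul_add mul_scl)
  moreover have "I \<subseteq> A" by (auto simp: I_def)
  moreover have "a \<odot> b \<in> I" if "a \<in> I" "b \<in> A" for a b
    using that fD x by (auto simp: I_def mul_assoc[symmetric])
  ultimately obtain j where j: "j \<in> I" "j \<in> proj" "\<And>x. x \<in> I \<Longrightarrow> j \<odot> x = x"
    using right_ideal_unit by blast
  have "j \<noteq> f" using j(1) x by (auto simp: I_def)
  then have "j = 0" using minims_projI[OF f j(2)] j(1) by (auto simp: I_def)
  moreover have "y \<in> I" using y by (simp add: I_def)
  ultimately show ?thesis using j(3)[of y] y by simp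
qed

text \<open>The powers of x are linearly dependent, so x has a minimal polynomial. A complex root c
  splits off a factor x - c f, the cofactor is nonzero by minimality of the degree, and the absence
  of zero divisors forces x - c f = 0.\<close>

lemma minims_proj_corner:
  assumes f: "f \<in> minims proj" and x: "x \<in> A" "f \<odot> x = x" "x \<odot> f = x"
  obtains c where "x = scl c f"
proof -
  note fD = minims_projD[OF f]
  \<comment> \<open>\<open>E p\<close> is p evaluated at x in the corner, whose unit is f: constant
    coefficients are multiplied by f, not by \<open>one\<close>.\<close>
  define E where "E p = fold_coeffs (\<lambda>a y. scl a f + x \<odot> y) p 0" for p
  have E0 [simp]: "E 0 = 0" by (simp add: E_def)
  have EC: "E (pCons a p) = scl a f + x \<odot> E p" for a p
    by (cases "p = 0 \<and> a = 0") (use x in \<open>auto simp: E_def\<close>)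
  have EA: "E p \<in> A \<and> f \<odot> E p = E p" for p
    by (induction p) (use x fD in \<open>auto simp: EC mul_add mul_scl mul_assoc[symmetric]\<close>)
  have Eadd: "E (p + q) = E p + E q" for p q
    by (induction p q rule: poly_induct2) (use x EA in \<open>auto simp: EC mul_add vs.scale_left_distrib\<close>)
  have Esmult: "E (smult c p) = scl c (E p)" for c p
    by (induction p) (use x EA in \<open>auto simp: EC mul_scl vs.scale_right_distrib\<close>)
  have Esum: "E (sum F I) = (\<Sum>i\<in>I. E (F i))" for F and I :: "nat set"
    by (induction I rule: infinite_finite_induct) (auto simp: Eadd)
  have "\<exists>p. p \<noteq> 0 \<and> E p = 0"
  proof (cases "inj (\<lambda>i. E (monom 1 i))")
    case False
    then obtain i j where "i \<noteq> j" "E (monom 1 i) = E (monom 1 j)" by (auto simp: inj_def)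
    then have "E (monom 1 i + smult (-1) (monom 1 j)) = 0"
      unfolding Eadd Esmult by simp
    moreover have "coeff (monom 1 i + smult (-1) (monom 1 j)) i \<noteq> (0::complex)"
      using \<open>i \<noteq> j\<close> by simp
    ultimately show ?thesis by (metis coeff_0)
  next
    case True
    have "\<not> vs.independent (range (\<lambda>i. E (monom 1 i)))"
    proof
      assume "vs.independent (range (\<lambda>i. E (monom 1 i)))"
      moreover have "range (\<lambda>i. E (monom 1 i)) \<subseteq> A" using EA by auto
      ultimately have "finite (range (\<lambda>i. E (monom 1 i)))"
        using finite_independent by metis
      then show False using True finite_imageD by blast
    qed
    then obtain T u where T: "finite T" "T \<subseteq> range (\<lambda>i. E (monom 1 i))"
      "(\<Sum>w\<in>T. scl (u w) w) = 0" "\<exists>w\<in>T. u w \<noteq> 0"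
      unfolding vs.dependent_explicit by blast
    obtain J where J: "T = (\<lambda>i. E (monom 1 i)) ` J" using T(2) subset_imageE by blast
    have inj: "inj_on (\<lambda>i. E (monom 1 i)) J" using True by (simp add: inj_on_def inj_def)
    have finJ: "finite J" using T(1) J inj finite_imageD by blast
    define p where "p = (\<Sum>i\<in>J. smult (u (E (monom 1 i))) (monom 1 i))"
    have "E p = 0"
      using T(3) unfolding J p_def by (simp add: Esum Esmult sum.reindex[OF inj] del: smult_monom)
    moreover obtain i where i: "i \<in> J" "u (E (monom 1 i)) \<noteq> 0" using T(4) J by blast
    have "coeff p i = (\<Sum>j\<in>J. if j = i then u (E (monom 1 i)) else 0)"
      unfolding p_def coeff_sum by (rule sum.cong) auto
    then have "coeff p i \<noteq> 0" using i finJ by simp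
    ultimately show ?thesis by (metis coeff_0)
  qed
  then obtain p where p: "p \<noteq> 0" "E p = 0" and
    min: "\<And>q. q \<noteq> 0 \<and> E q = 0 \<Longrightarrow> degree p \<le> degree q"
    using ex_has_least_nat[of "\<lambda>p. p \<noteq> 0 \<and> E p = 0" _ degree] by blast
  have "degree p \<noteq> 0"
  proof
    assume "degree p = 0"
    then obtain a where "p = [:a:]" by (metis degree_eq_zeroE)
    then have "scl a f = 0" "a \<noteq> 0" using p x by (auto simp: EC)
    then show False using fD by simp
  qed
  then obtain c where "poly p c = 0"
    using fundamental_theorem_of_algebra[of p] constant_degree[of p] by auto
  then obtain q where q: "p = [:-c, 1:] * q" by (auto simp: poly_eq_0_iff_dvd)
  have q0: "q \<noteq> 0" using p q by auto
  have "degree p = Suc (degree q)" using q0 unfolding q by (subst degree_mult_eq) auto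
  then have Eq0: "E q \<noteq> 0" using min[of q] q0 by auto
  have "p = smult (-c) q + pCons 0 q" unfolding q by simp
  then have "E p = scl (-c) (E q) + x \<odot> E q" by (simp only: Eadd Esmult EC) simp
  then have z: "(x - scl c f) \<odot> E q = 0"
    using p(2) EA[of q] x fD by (simp add: diff_mul scl_mul)
  have "x - scl c f = 0"
  proof (rule ccontr)
    assume "x - scl c f \<noteq> 0"
    then have "E q = 0"
      using corner_no_zero_divisors[OF f, of "x - scl c f" "E q"] z EA[of q] x fD
      by (simp add: diff_mul scl_mul)
    then show False using Eq0 by simp
  qed
  then show thesis using that[of c] by simp
qed

lemma tr_proj:
  assumes "f \<in> proj"
  shows "tr f = complex_of_real (Re (tr f))" "Re (tr f) \<ge> 0" "f \<noteq> 0 \<Longrightarrow> Re (tr f) > 0"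
  using tr_pos[of f] assms by (cases "f = 0"; force simp: proj_def)+

text \<open>If f A g were 0, the elements z with f A z = 0 would form an ideal containing g; its
  central unit j would dominate p by minimality of p, and f = f j p would be 0. For a nonzero y in f
  A g, the elements y st y and st y y are the same multiple c of f and of g, and c > 0 by positivity
  of the trace, so y rescales to a partial isometry.\<close>

lemma minims_proj_equiv:
  assumes p: "p \<in> minims cproj" and f: "f \<in> minims proj" "f \<odot> p = f"
    and g: "g \<in> minims proj" "g \<odot> p = g"
  obtains u where "u \<in> A" "u \<odot> st u = f" "st u \<odot> u = g" "f \<odot> u = u" "u \<odot> g = u"
proof -
  note fD = minims_projD[OF f(1)] and gD = minims_projD[OF g(1)] and pD = minims_cprojD[OF p]
  have "\<exists>x\<in>A. f \<odot> x \<odot> g \<noteq> 0"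
  proof (rule ccontr)
    assume no: "\<not> (\<exists>x\<in>A. f \<odot> x \<odot> g \<noteq> 0)"
    define I where "I = {z \<in> A. \<forall>x\<in>A. f \<odot> x \<odot> z = 0}"
    have gI: "g \<in> I" using no gD by (auto simp: I_def)
    have "vs.subspace I" using fD by (auto simp: I_def vs.subspace_def mul_add mul_scl)
    moreover have "I \<subseteq> A" by (auto simp: I_def)
    moreover have "x \<odot> a \<in> I" if "x \<in> I" "a \<in> A" for x a
      using that fD by (auto simp: I_def mul_assoc[symmetric])
    moreover have "a \<odot> x \<in> I" if "x \<in> I" "a \<in> A" for x a
    proof -
      have "f \<odot> b \<odot> (a \<odot> x) = 0" if "b \<in> A" for b
      proof -
        have "f \<odot> b \<odot> (a \<odot> x) = f \<odot> (b \<odot> a) \<odot> x"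
          using that \<open>a \<in> A\<close> \<open>x \<in> I\<close> fD by (simp add: I_def mul_assoc)
        then show ?thesis using \<open>x \<in> I\<close> \<open>a \<in> A\<close> that by (simp add: I_def)
      qed
      then show ?thesis using that by (simp add: I_def)
    qed
    ultimately obtain j where j: "j \<in> I" "j \<in> cproj" "\<And>x. x \<in> I \<Longrightarrow> j \<odot> x = x"
      using ideal_unit_central by blast
    note jD = cprojD[OF j(2)]
    have pj: "p \<odot> j \<in> A" using pD(3) jD(2) by simp
    have "p \<odot> j \<in> cproj" using cproj_mul_cproj pD(1) j(2) .
    moreover have "p \<odot> j \<odot> p = p \<odot> j"
      using pD(7)[OF pj] pD(3,4) jD(2) mul_assoc[of p p j] by simp
    moreover have "p \<odot> j \<noteq> 0"
    proof
      assume z: "p \<odot> j = 0"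
      have "g = p \<odot> (j \<odot> g)" using pD(7)[OF gD(2)] g(2) j(3)[OF gI] by simp
      also have "\<dots> = 0" using z gD(2) pD(3) jD(2) by (simp add: mul_assoc[symmetric])
      finally show False using gD by simp
    qed
    ultimately have "p \<odot> j = p" using p by (auto simp: minims_def)
    then have "f = f \<odot> (j \<odot> p)" using f(2) jD(5)[OF pD(3)] by simp
    also have "\<dots> = f \<odot> one \<odot> j \<odot> p" using fD(2) pD(3) jD(2) by (simp add: mul_assoc)
    also have "f \<odot> one \<odot> j = 0" using j(1) one_closed unfolding I_def by blast
    finally show False using fD(5) pD(3) by simp
  qed
  then obtain x where x: "x \<in> A" "f \<odot> x \<odot> g \<noteq> 0" by blast
  define y where "y = f \<odot> x \<odot> g"
  have y: "y \<in> A" "y \<noteq> 0" "f \<odot> y = y" "y \<odot> g = y"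
    using x fD gD by (auto simp: y_def mul_assoc, simp add: mul_assoc[symmetric])
  have sy: "st y \<odot> f = st y" "g \<odot> st y = st y"
    using y fD gD by (metis st_mul)+
  obtain c where c: "y \<odot> st y = scl c f"
    using minims_proj_corner[OF f(1), of "y \<odot> st y"] y sy fD by (metis mul_assoc mul_closed st_closed)
  obtain d where d: "st y \<odot> y = scl d g"
    using minims_proj_corner[OF g(1), of "st y \<odot> y"] y sy gD by (metis mul_assoc mul_closed st_closed)
  have "scl c y = scl d y"
  proof -
    have "y \<odot> st y \<odot> y = scl c y" using c y fD by (simp add: scl_mul)
    moreover have "y \<odot> (st y \<odot> y) = scl d y" using d y gD by (simp add: mul_scl)
    ultimately show ?thesis using y by (simp add: mul_assoc)
  qed
  then have cd: "c = d" using y by simp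
  obtain r where r: "r > 0" "tr (y \<odot> st y) = complex_of_real r" using tr_pos y by blast
  have "c * tr f = complex_of_real r" using c r fD by (simp add: tr_scl)
  then have cr: "c = complex_of_real (r / Re (tr f))" and pos: "r / Re (tr f) > 0"
    using tr_proj(1,3)[OF fD(1)] fD(5) r(1)
    by (metis nonzero_eq_divide_eq of_real_divide of_real_eq_0_iff order_less_irrefl) (use tr_proj(3)[OF fD(1)] fD(5) r(1) in simp)
  define s where "s = sqrt (r / Re (tr f))"
  have s: "s > 0" "complex_of_real s * complex_of_real s = c"
  proof -
    show "s > 0" using pos by (simp add: s_def)
    have "s * s = r / Re (tr f)" unfolding s_def using pos real_sqrt_mult_self[of "r / Re (tr f)"] by linarith
    then show "complex_of_real s * complex_of_real s = c" using cr by (metis of_real_mult)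
  qed
  define u where "u = scl (1 / complex_of_real s) y"
  have "c \<noteq> 0" using s by auto
  then have "u \<odot> st u = f" "st u \<odot> u = g"
    using y fD gD s by (auto simp: u_def st_scl scl_mul mul_scl c d[folded cd] field_simps)
  moreover have "u \<in> A" "f \<odot> u = u" "u \<odot> g = u"
    using y fD gD by (auto simp: u_def mul_scl scl_mul)
  ultimately show thesis using that by blast
qed

lemma tr_minims_eq:
  assumes "p \<in> minims cproj" "f \<in> minims proj" "f \<odot> p = f" "g \<in> minims proj" "g \<odot> p = g"
  shows "tr f = tr g"
proof -
  obtain u where "u \<in> A" "u \<odot> st u = f" "st u \<odot> u = g"
    using minims_proj_equiv assms by metis
  then show ?thesis using tr_mul[of u "st u"] by simp
qed

section \<open>Orthogonal families of projections\<close>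

definition orth :: "'a set \<Rightarrow> bool" where
  "orth S \<longleftrightarrow> (\<forall>g\<in>S. \<forall>h\<in>S. g \<noteq> h \<longrightarrow> g \<odot> h = 0)"

lemma orth_independent:
  assumes "S \<subseteq> proj" "0 \<notin> S" "orth S"
  shows "vs.independent S"
proof -
  have SA: "S \<subseteq> A" using assms projD by blast
  have "u v = 0" if T: "finite T" "T \<subseteq> S" "(\<Sum>w\<in>T. scl (u w) w) = 0" "v \<in> T" for T u v
  proof -
    have vA: "v \<in> A" using T SA by auto
    have "0 = v \<odot> (\<Sum>w\<in>T. scl (u w) w)" using T(3) vA by simp
    also have "\<dots> = (\<Sum>w\<in>T. scl (u w) (v \<odot> w))"
      using T SA vA by (subst mul_sum) (auto simp: mul_scl subset_iff intro!: sum.cong)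
    also have "\<dots> = (\<Sum>w\<in>T. if w = v then scl (u v) v else 0)"
      using T assms projD(2)[of v] by (intro sum.cong) (auto simp: orth_def subset_iff)
    also have "\<dots> = scl (u v) v" using T by simp
    finally have "scl (u v) v = 0" by simp
    moreover have "v \<noteq> 0" using assms T by auto
    ultimately show ?thesis by simp
  qed
  then show ?thesis unfolding vs.dependent_explicit by blast
qed

lemma orth_bound:
  obtains N where "\<And>S. S \<subseteq> proj \<Longrightarrow> 0 \<notin> S \<Longrightarrow> orth S \<Longrightarrow> finite S \<and> card S \<le> N"
proof -
  obtain N where "\<And>S. vs.independent S \<Longrightarrow> S \<subseteq> A \<Longrightarrow> finite S \<and> card S \<le> N"
    using finite_independent by blast
  then show thesis using that[of N] orth_independent projD(1) by (metis subset_iff)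
qed

lemma proj_diff:
  assumes "e \<in> proj" "f \<in> proj" "f \<odot> e = f"
  shows "e - f \<in> proj" "f \<odot> (e - f) = 0" "(e - f) \<odot> f = 0"
proof -
  note eD = projD[OF assms(1)] and fD = projD[OF assms(2)]
  have "e \<odot> f = f" using proj_mul_commute assms by blast
  then show "e - f \<in> proj" "f \<odot> (e - f) = 0" "(e - f) \<odot> f = 0"
    using eD fD assms(3) by (auto simp: proj_def mul_diff diff_mul st_diff)
qed

lemma orth_sum_mul:
  assumes "finite S" "S \<subseteq> proj" "orth S" "g \<in> S"
  shows "g \<odot> \<Sum>S = g" "\<Sum>S \<odot> g = g"
proof -
  have A: "g \<in> A" "\<And>h. h \<in> S \<Longrightarrow> h \<in> A" using assms projD by auto
  have "g \<odot> \<Sum>S = (\<Sum>h\<in>S. g \<odot> h)" using A by (simp add: mul_sum)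
  also have "\<dots> = (\<Sum>h\<in>S. if h = g then g else 0)"
    using A assms projD(2)[of g] by (intro sum.cong) (auto simp: orth_def)
  finally show "g \<odot> \<Sum>S = g" using assms by simp
  have "\<Sum>S \<odot> g = (\<Sum>h\<in>S. h \<odot> g)" using A by (simp add: sum_mul)
  also have "\<dots> = (\<Sum>h\<in>S. if h = g then g else 0)"
    using A assms projD(2)[of g] by (intro sum.cong) (auto simp: orth_def)
  finally show "\<Sum>S \<odot> g = g" using assms by simp
qed

text \<open>Orthogonal families of nonzero projections with sum e have bounded size, so one of
  maximal size exists. A member g that is not minimal could be replaced by some k below it and g -
  k, which would enlarge the family.\<close>

lemma proj_decomp:
  assumes e: "e \<in> proj"
  obtains S where "finite S" "S \<subseteq> minims proj" "orth S" "\<Sum>S = e"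
proof -
  define C where "C S \<longleftrightarrow> S \<subseteq> proj \<and> 0 \<notin> S \<and> orth S \<and> finite S \<and> \<Sum>S = e" for S
  obtain N where N: "\<And>S. S \<subseteq> proj \<Longrightarrow> 0 \<notin> S \<Longrightarrow> orth S \<Longrightarrow> finite S \<and> card S \<le> N"
    using orth_bound by blast
  \<comment> \<open>Some family exists to begin with; for e = 0 it is the empty one, as members have
    to be nonzero.\<close>
  have "C (if e = 0 then {} else {e})" using e by (auto simp: C_def orth_def)
  moreover have "\<forall>T. C T \<longrightarrow> card T < Suc N" using N by (simp add: C_def less_Suc_eq_le)
  ultimately have "\<exists>S. C S \<and> (\<forall>T. C T \<longrightarrow> card T \<le> card S)"
    by (rule ex_has_greatest_nat)
  then obtain S where S: "C S" "\<And>T. C T \<Longrightarrow> card T \<le> card S" by auto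
  have "g \<in> minims proj" if g: "g \<in> S" for g
  proof (rule ccontr)
    assume nm: "g \<notin> minims proj"
    have gp: "g \<in> proj" "g \<noteq> 0" using g S by (auto simp: C_def)
    with nm obtain k where k: "k \<in> proj" "k \<noteq> 0" "k \<odot> g = k" "k \<noteq> g"
      by (auto simp: minims_def)
    define l where "l = g - k"
    note d = proj_diff[OF gp(1) k(1,3), folded l_def]
    have lk: "l \<noteq> k" using d k projD(2)[OF k(1)] by auto
    have l0: "l \<noteq> 0" using k by (simp add: l_def)
    have gk: "g \<odot> k = k" using proj_mul_commute gp k by blast
    have lg: "l \<odot> g = l" "g \<odot> l = l"
      using gk k(3) projD(1,2)[OF gp(1)] projD(1)[OF k(1)] by (auto simp: l_def diff_mul mul_diff)
    have other: "k \<odot> h = 0" "h \<odot> k = 0" "l \<odot> h = 0" "h \<odot> l = 0" if h: "h \<in> S" "h \<noteq> g" for h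
    proof -
      have hA: "h \<in> A" and z: "g \<odot> h = 0" "h \<odot> g = 0"
        using h g S(1) projD by (auto simp: C_def orth_def)
      have kA: "k \<in> A" and lA: "l \<in> A" and gA: "g \<in> A" using k d gp projD by auto
      show "k \<odot> h = 0" "l \<odot> h = 0"
        using mul_assoc[OF kA gA hA] mul_assoc[OF lA gA hA] z kA lA k(3) lg by auto
      show "h \<odot> k = 0" "h \<odot> l = 0"
        using mul_assoc[OF hA gA kA] mul_assoc[OF hA gA lA] z kA lA gk lg by auto
    qed
    define T where "T = insert k (insert l (S - {g}))"
    have fin: "finite S" using S by (simp add: C_def)
    have "k \<notin> S - {g}" using other(1)[of k] projD(2)[OF k(1)] k(2) by auto
    moreover have "l \<notin> S - {g}" using other(3)[of l] projD(2)[OF d(1)] l0 by auto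
    moreover have "card (S - {g}) = card S - 1" "card S > 0"
      using g fin card_gt_0_iff by auto
    ultimately have card: "card T = Suc (card S)" and sm: "\<Sum>T = k + (l + \<Sum>(S - {g}))"
      using fin lk by (auto simp: T_def)
    have "\<Sum>(S - {g}) = e - g" using S(1) g fin by (simp add: C_def sum_diff1)
    then have "\<Sum>T = e" using sm by (simp add: l_def)
    moreover have "orth T" using S(1) other d k by (auto simp: orth_def T_def C_def)
    ultimately have "C T" using S(1) k l0 d fin by (auto simp: C_def T_def)
    then show False using S(2) card by fastforce
  qed
  then show thesis using that[of S] S(1) by (auto simp: C_def)
qed

lemma minims_below:
  assumes "p \<in> minims cproj"
  obtains f where "f \<in> minims proj" "f \<odot> p = f"
proof -
  note pD = minims_cprojD[OF assms]
  obtain S where S: "finite S" "S \<subseteq> minims proj" "orth S" "\<Sum>S = p"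
    using proj_decomp pD by blast
  then obtain f where "f \<in> S" using pD(6) by fastforce
  moreover have "S \<subseteq> proj" using S minims_projD by blast
  ultimately show thesis using that S orth_sum_mul by blast
qed

lemma minims_cproj_orth:
  assumes "p \<in> minims cproj" "q \<in> minims cproj" "p \<noteq> q"
  shows "p \<odot> q = 0"
proof (rule ccontr)
  note pD = minims_cprojD[OF assms(1)] and qD = minims_cprojD[OF assms(2)]
  assume nz: "p \<odot> q \<noteq> 0"
  have c: "p \<odot> q \<in> cproj" using cproj_mul_cproj pD(1) qD(1) .
  have "p \<odot> q \<odot> q = p \<odot> q" using pD(3) qD(3,4) by (simp add: mul_assoc)
  then have "p \<odot> q = q" using c nz assms(2) by (auto simp: minims_def)
  moreover have "p \<odot> q \<odot> p = p \<odot> q"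
    using pD(7)[of "p \<odot> q"] pD(3,4) qD(3) mul_assoc[of p p q] by simp
  then have "p \<odot> q = p" using c nz assms(1) by (auto simp: minims_def)
  ultimately show False using assms by simp
qed

lemma finite_minims_cproj: "finite (minims cproj)"
proof -
  have "minims cproj \<subseteq> proj" using minims_cprojD(2) by blast
  moreover have "0 \<notin> minims cproj" using minims_cprojD(6) by blast
  moreover have "orth (minims cproj)" using minims_cproj_orth by (auto simp: orth_def)
  moreover obtain N where "\<And>S. S \<subseteq> proj \<Longrightarrow> 0 \<notin> S \<Longrightarrow> orth S \<Longrightarrow> finite S \<and> card S \<le> N"
    using orth_bound by blast
  ultimately show ?thesis by simp
qed

text \<open>The sum of the family is a projection below e, and its difference from e is again a
  projection, of nonnegative trace. The family is indexed because several members may be 0 and would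
  collapse in a set.\<close>

lemma tr_orth_family_le:
  assumes "finite I" "e \<in> proj" "\<And>i. i \<in> I \<Longrightarrow> P i \<in> proj" "\<And>i. i \<in> I \<Longrightarrow> P i \<odot> e = P i"
    and "\<And>i j. i \<in> I \<Longrightarrow> j \<in> I \<Longrightarrow> i \<noteq> j \<Longrightarrow> P i \<odot> P j = 0"
  shows "(\<Sum>i\<in>I. Re (tr (P i))) \<le> Re (tr e)"
proof -
  define s where "s = sum P I"
  have PA: "P i \<in> A" if "i \<in> I" for i using assms(3) that projD by blast
  have eD: "e \<in> A" using assms(2) projD by blast
  have sA: "s \<in> A" using PA by (simp add: s_def)
  have "s \<odot> s = (\<Sum>i\<in>I. P i \<odot> s)" using sum_mul[of I P s] PA sA unfolding s_def[symmetric] by simp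
  also have "\<dots> = (\<Sum>i\<in>I. P i)"
  proof (rule sum.cong)
    fix i assume i: "i \<in> I"
    have "P i \<odot> s = (\<Sum>j\<in>I. P i \<odot> P j)" using i PA by (simp add: s_def mul_sum)
    also have "\<dots> = (\<Sum>j\<in>I. if j = i then P i else 0)"
      using i assms(3,5) projD(2) by (intro sum.cong) auto
    finally show "P i \<odot> s = P i" using i assms(1) by simp
  qed simp
  finally have "s \<odot> s = s" by (simp add: s_def)
  moreover have "st s = s" unfolding s_def using PA assms(3) projD(3) by (simp add: st_sum)
  ultimately have sp: "s \<in> proj" using sA by (simp add: proj_def)
  have "s \<odot> e = s" unfolding s_def using PA eD assms(4) by (simp add: sum_mul)
  then have "e - s \<in> proj" using proj_diff sp assms(2) by blast
  then have "Re (tr (e - s)) \<ge> 0" using tr_proj by blast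
  then show ?thesis using sA eD PA by (simp add: tr_diff s_def tr_sum)
qed

end

section \<open>Norms of adjacency matrices\<close>

text \<open>In each row Cauchy-Schwarz is applied to the factors sqrt(M \<xi>) and sqrt(M / \<xi>)
  |f|, and \<open>sub\<close> bounds the sum of the squares of the first ones. After summation over
  the rows, symmetry of M lets \<open>sub\<close> bound the rest. Finite partial sums suffice, as
  all terms are nonnegative.\<close>

lemma schur_test:
  fixes M :: "'i \<Rightarrow> 'i \<Rightarrow> real" and \<xi> :: "'i \<Rightarrow> real"
  assumes nonneg: "\<And>i j. M i j \<ge> 0" and sym: "\<And>i j. M i j = M j i"
    and fin: "\<And>i. i \<in> I \<Longrightarrow> finite {j \<in> I. M i j \<noteq> 0}"
    and \<xi>: "\<And>i. i \<in> I \<Longrightarrow> \<xi> i > 0" and C: "C \<ge> 0"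
    and sub: "\<And>i F. i \<in> I \<Longrightarrow> finite F \<Longrightarrow> F \<subseteq> I \<Longrightarrow> (\<Sum>j\<in>F. M i j * \<xi> j) \<le> C * \<xi> i"
  shows "op_bound I (\<lambda>i j. complex_of_real (M i j)) C"
proof -
  define supp where "supp i = {j \<in> I. M i j \<noteq> 0}" for i
  have bound: "(\<Sum>i\<in>F. (cmod (mat_apply I (\<lambda>i j. complex_of_real (M i j)) f i))\<^sup>2)
      \<le> C\<^sup>2 * (\<Sum>\<^sub>\<infinity>j\<in>I. (cmod (f j))\<^sup>2)"
    if f: "f \<in> ell2 I" and F: "finite F" "F \<subseteq> I" for f F
  proof -
    \<comment> \<open>All columns met by the finitely many rows in F, so that these rows become sums
      over one finite set.\<close>
    define J where "J = (\<Union>i\<in>F. supp i)"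
    have J: "finite J" "J \<subseteq> I" using F fin by (auto simp: J_def supp_def)
    have row: "(cmod (mat_apply I (\<lambda>i j. complex_of_real (M i j)) f i))\<^sup>2
        \<le> C * \<xi> i * (\<Sum>j\<in>J. M i j * (cmod (f j))\<^sup>2 / \<xi> j)" if i: "i \<in> F" for i
    proof -
      have "mat_apply I (\<lambda>i j. complex_of_real (M i j)) f i = (\<Sum>\<^sub>\<infinity>j\<in>J. complex_of_real (M i j) * f j)"
        unfolding mat_apply_def
        by (rule infsum_cong_neutral) (use i J in \<open>auto simp: J_def supp_def\<close>)
      also have "\<dots> = (\<Sum>j\<in>J. complex_of_real (M i j) * f j)" using J by simp
      finally have "cmod (mat_apply I (\<lambda>i j. complex_of_real (M i j)) f i)
          \<le> (\<Sum>j\<in>J. cmod (complex_of_real (M i j) * f j))" by (simp add: norm_sum)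
      also have "\<dots> = (\<Sum>j\<in>J. sqrt (M i j * \<xi> j) * (sqrt (M i j / \<xi> j) * cmod (f j)))"
      proof (rule sum.cong)
        fix j assume "j \<in> J"
        then have "\<xi> j > 0" using J \<xi> by auto
        then have "sqrt (M i j * \<xi> j) * sqrt (M i j / \<xi> j) = M i j"
          using nonneg[of i j] by (simp flip: real_sqrt_mult)
        then show "cmod (complex_of_real (M i j) * f j) =
            sqrt (M i j * \<xi> j) * (sqrt (M i j / \<xi> j) * cmod (f j))"
          using nonneg[of i j] by (simp add: norm_mult mult.assoc[symmetric])
      qed simp
      finally have "(cmod (mat_apply I (\<lambda>i j. complex_of_real (M i j)) f i))\<^sup>2 \<le>
          (\<Sum>j\<in>J. sqrt (M i j * \<xi> j) * (sqrt (M i j / \<xi> j) * cmod (f j)))\<^sup>2"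
        by (simp add: power_mono)
      also have "\<dots> \<le> (\<Sum>j\<in>J. (sqrt (M i j * \<xi> j))\<^sup>2) * (\<Sum>j\<in>J. (sqrt (M i j / \<xi> j) * cmod (f j))\<^sup>2)"
        by (rule Cauchy_Schwarz_ineq_sum)
      also have "(\<Sum>j\<in>J. (sqrt (M i j * \<xi> j))\<^sup>2) = (\<Sum>j\<in>J. M i j * \<xi> j)"
        using J by (intro sum.cong refl real_sqrt_pow2 mult_nonneg_nonneg nonneg less_imp_le[OF \<xi>]) auto
      also have "(\<Sum>j\<in>J. (sqrt (M i j / \<xi> j) * cmod (f j))\<^sup>2) = (\<Sum>j\<in>J. M i j * (cmod (f j))\<^sup>2 / \<xi> j)"
        using J \<xi> nonneg
        by (intro sum.cong) (auto simp: power_mult_distrib real_sqrt_pow2 less_imp_le subset_iff)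
      also have "(\<Sum>j\<in>J. M i j * \<xi> j) * (\<Sum>j\<in>J. M i j * (cmod (f j))\<^sup>2 / \<xi> j)
          \<le> C * \<xi> i * (\<Sum>j\<in>J. M i j * (cmod (f j))\<^sup>2 / \<xi> j)"
        using J \<xi> nonneg i F sub[of i J]
        by (intro mult_right_mono sum_nonneg) (auto intro!: divide_nonneg_pos mult_nonneg_nonneg)
      finally show ?thesis .
    qed
    have "(\<Sum>i\<in>F. (cmod (mat_apply I (\<lambda>i j. complex_of_real (M i j)) f i))\<^sup>2)
        \<le> (\<Sum>i\<in>F. C * \<xi> i * (\<Sum>j\<in>J. M i j * (cmod (f j))\<^sup>2 / \<xi> j))"
      using row by (rule sum_mono)
    also have "\<dots> = (\<Sum>j\<in>J. C * (cmod (f j))\<^sup>2 / \<xi> j * (\<Sum>i\<in>F. M j i * \<xi> i))"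
      unfolding sum_distrib_left by (subst sum.swap) (simp add: sym mult_ac)
    also have "\<dots> \<le> (\<Sum>j\<in>J. C * (cmod (f j))\<^sup>2 / \<xi> j * (C * \<xi> j))"
      using J F C \<xi> sub[of _ F]
      by (intro sum_mono mult_left_mono) (auto intro!: divide_nonneg_pos mult_nonneg_nonneg)
    also have "\<dots> = C\<^sup>2 * (\<Sum>j\<in>J. (cmod (f j))\<^sup>2)"
    proof -
      have "\<xi> j \<noteq> 0" if "j \<in> J" for j using \<xi>[of j] J that by auto
      then show ?thesis unfolding sum_distrib_left
        by (intro sum.cong) (auto simp: field_simps power2_eq_square)
    qed
    also have "(\<Sum>j\<in>J. (cmod (f j))\<^sup>2) \<le> (\<Sum>\<^sub>\<infinity>j\<in>I. (cmod (f j))\<^sup>2)"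
      using f J by (intro finite_sum_le_infsum) (auto simp: ell2_def)
    finally show ?thesis by (simp add: mult_left_mono)
  qed
  show ?thesis unfolding op_bound_def
  proof (intro conjI ballI C)
    fix f assume f: "f \<in> ell2 I"
    show "(\<lambda>j. complex_of_real (M i j) * f j) summable_on I" if "i \<in> I" for i
    proof -
      have "(\<lambda>j. complex_of_real (M i j) * f j) summable_on supp i"
        using fin[OF that] by (simp add: supp_def)
      then show ?thesis
        by (rule summable_on_cong_neutral[THEN iffD1, rotated -1]) (auto simp: supp_def)
    qed
    let ?g = "mat_apply I (\<lambda>i j. complex_of_real (M i j)) f"
    have s: "(\<lambda>i. (cmod (?g i))\<^sup>2) summable_on I"
      by (rule nonneg_bdd_above_summable_on) (use bound[OF f] in \<open>auto intro!: bdd_aboveI2\<close>)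
    then show "?g \<in> ell2 I" by (simp add: ell2_def)
    have "(\<Sum>\<^sub>\<infinity>i\<in>I. (cmod (?g i))\<^sup>2) \<le> C\<^sup>2 * (\<Sum>\<^sub>\<infinity>j\<in>I. (cmod (f j))\<^sup>2)"
      using s bound[OF f] by (rule infsum_le_finite_sums)
    then have "ell2_norm I ?g \<le> sqrt (C\<^sup>2 * (\<Sum>\<^sub>\<infinity>j\<in>I. (cmod (f j))\<^sup>2))"
      by (simp add: ell2_norm_def)
    then show "ell2_norm I ?g \<le> C * ell2_norm I f" using C by (simp add: ell2_norm_def real_sqrt_mult)
  qed
qed

lemma op_norm_le: "op_bound I M C \<Longrightarrow> op_norm I M \<le> ennreal C"
  unfolding op_norm_def by (rule Inf_lower) simp

section \<open>A positive superharmonic function on the graph\<close>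

abbreviation out_edges :: "('v, 'e) wgraph \<Rightarrow> 'v \<Rightarrow> 'e set" where
  "out_edges G v \<equiv> {e \<in> edges G. src G e = v}"

text \<open>As a function of w this is the n-th power of the adjacency matrix applied to the
  indicator of v. The recursion is on the first edge of a walk from w to v, so that a further step
  is one more application of the matrix.\<close>

fun walk_count :: "('v, 'e) wgraph \<Rightarrow> 'v \<Rightarrow> nat \<Rightarrow> 'v \<Rightarrow> real" where
  "walk_count G v 0 w = (if w = v then 1 else 0)"
| "walk_count G v (Suc n) w = (\<Sum>e\<in>out_edges G w. walk_count G v n (tgt G e))"

lemma walk_count_nonneg: "walk_count G v n w \<ge> 0"
  by (induction n arbitrary: w) (auto intro: sum_nonneg)

lemma walk_start_verts: "bipartite_graph G \<Longrightarrow> walk G v es w \<Longrightarrow> v \<in> verts G"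
  by (cases es) (auto simp: bipartite_graph_def verts_def)

lemma walk_end_verts: "walk G v es w \<Longrightarrow> w \<in> verts G"
  by (induction es arbitrary: v) auto

lemma walk_count_pos:
  assumes "bipartite_graph G"
  shows "walk G w es v \<Longrightarrow> walk_count G v (length es) w > 0"
proof (induction es arbitrary: w)
  case (Cons e es)
  have "finite (out_edges G w)"
    using assms walk_start_verts[OF assms Cons.prems] by (auto simp: bipartite_graph_def)
  then show ?case
    using Cons by (auto intro!: sum_pos2[of _ e] walk_count_nonneg)
qed auto

lemma ell2_cong: "(\<And>i. i \<in> I \<Longrightarrow> f i = g i) \<Longrightarrow> f \<in> ell2 I \<longleftrightarrow> g \<in> ell2 I"
  unfolding ell2_def mem_Collect_eq by (rule summable_on_cong) simp

lemma ell2_norm_cong: "(\<And>i. i \<in> I \<Longrightarrow> f i = g i) \<Longrightarrow> ell2_norm I f = ell2_norm I g"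
  unfolding ell2_norm_def by (simp cong: infsum_cong)

text \<open>Grouping the edges out of w by their targets produces the multiplicities in the matrix;
  local finiteness makes the sum finite.\<close>

lemma mat_apply_adjacency:
  assumes G: "bipartite_graph G" and w: "w \<in> verts G"
  shows "mat_apply (verts G) (adjacency G) f w = (\<Sum>e\<in>out_edges G w. f (tgt G e))"
proof -
  have fin: "finite (out_edges G w)" using G w by (auto simp: bipartite_graph_def)
  have "adjacency G w u * f u = 0" if "u \<notin> tgt G ` out_edges G w" for u
  proof -
    have "{e \<in> edges G. src G e = w \<and> tgt G e = u} = {}" using that by auto
    then show ?thesis unfolding adjacency_def by (simp only: card.empty) simp
  qed
  moreover have "tgt G ` out_edges G w \<subseteq> verts G" using G by (auto simp: bipartite_graph_def verts_def)
  ultimately have "mat_apply (verts G) (adjacency G) f w =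
      (\<Sum>\<^sub>\<infinity>u\<in>tgt G ` out_edges G w. adjacency G w u * f u)"
    unfolding mat_apply_def by (intro infsum_cong_neutral) auto
  also have "\<dots> = (\<Sum>u\<in>tgt G ` out_edges G w. of_nat (card {e \<in> out_edges G w. tgt G e = u}) * f u)"
    using fin by (simp add: adjacency_def conj_assoc)
  also have "\<dots> = (\<Sum>e\<in>out_edges G w. f (tgt G e))"
    using fin by (subst sum_fun_comp[of _ "tgt G ` out_edges G w"]) auto
  finally show ?thesis .
qed

text \<open>h is the Neumann series of the resolvent at r, applied to the indicator of v. Its n-th
  term is at most (C / r)^n, hence convergence; the adjacency matrix shifts the series and leaves r
  times h minus the indicator of v. Connectedness makes h positive everywhere.\<close>

lemma superharmonic_exists:
  assumes G: "bipartite_graph G" and v: "v \<in> verts G"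
    and norm: "op_norm (verts G) (adjacency G) < ennreal \<delta>"
  obtains r h where "0 \<le> r" "r < \<delta>" "\<And>w. w \<in> verts G \<Longrightarrow> h w > (0::real)"
    "\<And>w. w \<in> verts G \<Longrightarrow> (\<Sum>e\<in>out_edges G w. h (tgt G e)) \<le> r * h w"
proof -
  \<comment> \<open>The norm is an infimum, so some bound C already lies below \<delta>.\<close>
  obtain C where C: "op_bound (verts G) (adjacency G) C" "C < \<delta>" "0 \<le> C"
    using norm unfolding op_norm_def Inf_less_iff by (auto simp: op_bound_def ennreal_less_iff)
  define f where "f n w = complex_of_real (walk_count G v n w)" for n w
  have f: "f n \<in> ell2 (verts G) \<and> ell2_norm (verts G) (f n) \<le> C ^ n" for n
  proof (induction n)
    case 0
    have e: "(\<lambda>w. (cmod (f 0 w))\<^sup>2) = (\<lambda>w. if w = v then 1 else 0)" by (auto simp: f_def)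
    have "((\<lambda>w. if w = v then 1 else 0) has_sum (1::real)) (verts G)"
      using has_sum_finite[of "{v}" "\<lambda>w. if w = v then 1 else (0::real)"] v
      by (subst has_sum_cong_neutral[where T = "{v}"]) auto
    then show ?case unfolding ell2_def ell2_norm_def mem_Collect_eq e
      by (auto simp: has_sum_imp_summable dest: infsumI)
  next
    case (Suc n)
    have *: "mat_apply (verts G) (adjacency G) (f n) w = f (Suc n) w" if "w \<in> verts G" for w
      using mat_apply_adjacency[OF G that] by (simp add: f_def)
    have "mat_apply (verts G) (adjacency G) (f n) \<in> ell2 (verts G)"
      "ell2_norm (verts G) (mat_apply (verts G) (adjacency G) (f n)) \<le> C * ell2_norm (verts G) (f n)"
      using C(1) Suc by (auto simp: op_bound_def)
    then have "f (Suc n) \<in> ell2 (verts G)"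
      "ell2_norm (verts G) (f (Suc n)) \<le> C * ell2_norm (verts G) (f n)"
      using * ell2_cong[of "verts G" "mat_apply (verts G) (adjacency G) (f n)" "f (Suc n)"]
        ell2_norm_cong[of "verts G" "mat_apply (verts G) (adjacency G) (f n)" "f (Suc n)"] by auto
    moreover have "C * ell2_norm (verts G) (f n) \<le> C * C ^ n"
      using Suc C(3) by (simp add: mult_left_mono)
    ultimately show ?case by simp
  qed
  have bound: "walk_count G v n w \<le> C ^ n" if w: "w \<in> verts G" for n w
  proof -
    have "(cmod (f n w))\<^sup>2 \<le> (\<Sum>\<^sub>\<infinity>w\<in>verts G. (cmod (f n w))\<^sup>2)"
      using finite_sum_le_infsum[of "\<lambda>w. (cmod (f n w))\<^sup>2" "verts G" "{w}"] f[of n] w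
      by (simp add: ell2_def)
    then have "cmod (f n w) \<le> ell2_norm (verts G) (f n)"
      by (simp add: ell2_norm_def real_le_rsqrt)
    then show ?thesis using f[of n] walk_count_nonneg[of G v n w] by (simp add: f_def)
  qed
  \<comment> \<open>Any number strictly between C and \<delta> would serve; it is positive even when
    C = 0.\<close>
  define r where "r = (C + \<delta>) / 2"
  have r: "C < r" "r < \<delta>" "r > 0" using C by (auto simp: r_def)
  define h where "h w = (\<Sum>n. walk_count G v n w / r ^ n)" for w
  have summ: "summable (\<lambda>n. walk_count G v n w / r ^ n)" if w: "w \<in> verts G" for w
  proof (rule summable_comparison_test)
    show "summable (\<lambda>n. (C / r) ^ n)" using C r by (intro summable_geometric) auto
    show "\<exists>N. \<forall>n\<ge>N. norm (walk_count G v n w / r ^ n) \<le> (C / r) ^ n"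
      using bound[OF w] walk_count_nonneg[of G v _ w] r
      by (auto simp: power_divide intro!: divide_right_mono)
  qed
  show thesis
  proof (rule that[of r h])
    fix w assume w: "w \<in> verts G"
    obtain es where es: "walk G w es v" using G v w unfolding bipartite_graph_def by blast
    show "h w > 0" unfolding h_def
      using walk_count_pos[OF G es] r walk_count_nonneg[of G v _ w]
      by (intro suminf_pos2[OF summ[OF w], of "length es"]) (auto intro!: divide_nonneg_pos)
    have fin: "finite (out_edges G w)" using G w by (auto simp: bipartite_graph_def)
    have tv: "tgt G e \<in> verts G" if "e \<in> out_edges G w" for e
      using that G by (auto simp: bipartite_graph_def verts_def)
    have "(\<Sum>e\<in>out_edges G w. h (tgt G e)) = (\<Sum>n. \<Sum>e\<in>out_edges G w. walk_count G v n (tgt G e) / r ^ n)"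
      unfolding h_def using summ tv by (subst suminf_sum) auto
    also have "\<dots> = (\<Sum>n. r * (walk_count G v (Suc n) w / r ^ Suc n))"
      using r by (simp add: sum_divide_distrib sum_distrib_left)
    also have "\<dots> = r * (\<Sum>n. walk_count G v (Suc n) w / r ^ Suc n)"
      using summ[OF w] by (intro suminf_mult) (subst summable_Suc_iff)
    also have "(\<Sum>n. walk_count G v (Suc n) w / r ^ Suc n) = h w - walk_count G v 0 w / r ^ 0"
      unfolding h_def using suminf_split_head[OF summ[OF w]] by simp
    \<comment> \<open>The subtracted term for n = 0 is the indicator of v, which is
      nonnegative.\<close>
    also have "r * \<dots> \<le> r * h w" using r by (intro mult_left_mono) auto
    finally show "(\<Sum>e\<in>out_edges G w. h (tgt G e)) \<le> r * h w" .
  qed (use r in auto)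
qed

section \<open>State sums\<close>

definition walks_from :: "('v, 'e) wgraph \<Rightarrow> 'v \<Rightarrow> nat \<Rightarrow> 'e list set" where
  "walks_from G v n = {es. length es = n \<and> (\<exists>w. walk G v es w)}"

lemma walk_endpoint: "walk G v es w \<Longrightarrow> endpoint G (v, es) = w"
proof (induction es arbitrary: v)
  case (Cons e es)
  then show ?case by (cases es) (auto simp: endpoint_def)
qed (simp add: endpoint_def)

lemma walk_iff_endpoint:
  "walk G v es w \<longleftrightarrow> es \<in> walks_from G v (length es) \<and> endpoint G (v, es) = w"
  unfolding walks_from_def mem_Collect_eq using walk_endpoint by metis

lemma walks_from_walk: "es \<in> walks_from G v n \<Longrightarrow> walk G v es (endpoint G (v, es))"
  unfolding walks_from_def mem_Collect_eq using walk_endpoint by metis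

lemma walks_from_length: "es \<in> walks_from G v n \<Longrightarrow> length es = n"
  by (simp add: walks_from_def)

lemma finite_walks_from:
  assumes "bipartite_graph G"
  shows "finite (walks_from G v n)"
proof (induction n arbitrary: v)
  case (Suc n)
  have "finite {e \<in> edges G. src G e = v}"
  proof (cases "v \<in> verts G")
    case False
    then have "{e \<in> edges G. src G e = v} = {}"
      using assms by (auto simp: bipartite_graph_def verts_def)
    then show ?thesis by (simp only: finite.emptyI)
  qed (use assms in \<open>auto simp: bipartite_graph_def\<close>)
  moreover have "walks_from G v (Suc n) \<subseteq>
      (\<Union>e\<in>{e \<in> edges G. src G e = v}. Cons e ` walks_from G (tgt G e) n)"
    by (fastforce simp: walks_from_def length_Suc_conv)
  ultimately show ?case using Suc by (meson finite_UN_I finite_imageI finite_subset)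
qed (auto simp: walks_from_def)

section \<open>States taken apart layer by layer\<close>

lemma compatible_length:
  assumes "compatible G (k, p) es es'"
  shows "length es' = length es - ins p + outs p"
  using assms by (cases p) auto

text \<open>The sum inside \<open>gpa_act\<close>, with the vertices v and w of the leftmost and the
  rightmost region as parameters. Both are the same on every horizontal line of a state.\<close>

definition state_sum ::
    "('v, 'e) wgraph \<Rightarrow> ('v, 'e) path_matrix tangle \<Rightarrow> 'v \<Rightarrow> 'v \<Rightarrow> 'e list \<Rightarrow> 'e list \<Rightarrow> complex" where
  "state_sum G T v w es es' = (\<Sum>\<sigma>\<in>states G T v w es es'.
     \<Prod>i<length T. contribution G v (T ! i) (\<sigma> ! i) (\<sigma> ! Suc i))"

lemma states_Nil: "states G [] v w es es' = (if es = es' \<and> walk G v es w then {[es]} else {})"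
  by (auto simp: states_def length_Suc_conv)

lemma states_Cons:
  "states G (l # T) v w es es' = (if walk G v es w
     then Cons es ` (\<Union>\<tau>\<in>{\<tau>. compatible G l es \<tau> \<and> walk G v \<tau> w}. states G T v w \<tau> es') else {})"
  (is "?L = ?R")
proof (intro equalityI subsetI)
  fix \<sigma> assume s: "\<sigma> \<in> ?L"
  then obtain \<tau> \<sigma>' where e: "\<sigma> = es # \<tau> # \<sigma>'"
    by (auto simp: states_def length_Suc_conv)
  have "walk G v es w" "compatible G l es \<tau>" "walk G v \<tau> w" using s by (auto simp: states_def e)
  moreover have "compatible G (T ! i) ((\<tau> # \<sigma>') ! i) ((\<tau> # \<sigma>') ! Suc i)" if "i < length T" for i
  proof -
    have "Suc i < length (l # T)" using that by simp
    then have "compatible G ((l # T) ! Suc i) (\<sigma> ! Suc i) (\<sigma> ! Suc (Suc i))"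
      using s unfolding states_def by blast
    then show ?thesis by (simp add: e)
  qed
  then have "\<tau> # \<sigma>' \<in> states G T v w \<tau> es'" using s by (auto simp: states_def e)
  ultimately show "\<sigma> \<in> ?R" by (auto simp: e)
next
  fix \<sigma> assume s: "\<sigma> \<in> ?R"
  then obtain \<tau> \<sigma>' where e: "\<sigma> = es # \<sigma>'" "walk G v es w" "compatible G l es \<tau>" "walk G v \<tau> w"
    "\<sigma>' \<in> states G T v w \<tau> es'" by (auto split: if_splits)
  then have "compatible G ((l # T) ! i) (\<sigma> ! i) (\<sigma> ! Suc i)" if "i < length (l # T)" for i
    using that by (cases i) (auto simp: states_def)
  then show "\<sigma> \<in> ?L" using e by (auto simp: states_def)
qed

lemma finite_compatible:
  assumes "bipartite_graph G"
  shows "finite {\<tau>. compatible G l es \<tau> \<and> walk G v \<tau> w}"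
proof -
  obtain k p where l: "l = (k, p)" by (cases l)
  have "{\<tau>. compatible G l es \<tau> \<and> walk G v \<tau> w} \<subseteq> walks_from G v (length es - ins p + outs p)"
    using compatible_length by (auto simp: l walks_from_def)
  then show ?thesis using finite_walks_from[OF assms] finite_subset by blast
qed

lemma finite_states:
  assumes "bipartite_graph G"
  shows "finite (states G T v w es es')"
  by (induction T arbitrary: es)
    (auto simp: states_Nil states_Cons intro!: finite_imageI finite_UN_I finite_compatible assms)

lemma state_sum_Nil: "state_sum G [] v w es es' = (if es = es' \<and> walk G v es w then 1 else 0)"
  by (auto simp: state_sum_def states_Nil)

text \<open>A layer acts as a transfer matrix indexed by the paths from v to w: every state factors
  through the path just below the first layer.\<close>

lemma state_sum_Cons:
  assumes G: "bipartite_graph G" and "walk G v es w"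
  shows "state_sum G (l # T) v w es es' =
    (\<Sum>\<tau>\<in>{\<tau>. compatible G l es \<tau> \<and> walk G v \<tau> w}.
       contribution G v l es \<tau> * state_sum G T v w \<tau> es')"
proof -
  let ?S = "{\<tau>. compatible G l es \<tau> \<and> walk G v \<tau> w}"
  have "state_sum G (l # T) v w es es' =
      (\<Sum>\<sigma>\<in>(\<Union>\<tau>\<in>?S. states G T v w \<tau> es').
        \<Prod>i<Suc (length T). contribution G v ((l # T) ! i) ((es # \<sigma>) ! i) ((es # \<sigma>) ! Suc i))"
    using assms(2) by (simp add: state_sum_def states_Cons sum.reindex)
  also have "\<dots> = (\<Sum>\<sigma>\<in>(\<Union>\<tau>\<in>?S. states G T v w \<tau> es'). contribution G v l es (\<sigma> ! 0) *
        (\<Prod>i<length T. contribution G v (T ! i) (\<sigma> ! i) (\<sigma> ! Suc i)))"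
    by (subst prod.lessThan_Suc_shift) simp
  also have "\<dots> = (\<Sum>\<tau>\<in>?S. \<Sum>\<sigma>\<in>states G T v w \<tau> es'. contribution G v l es (\<sigma> ! 0) *
        (\<Prod>i<length T. contribution G v (T ! i) (\<sigma> ! i) (\<sigma> ! Suc i)))"
    by (intro sum.UNION_disjoint ballI impI finite_compatible finite_states G) (auto simp: states_def)
  also have "\<dots> = (\<Sum>\<tau>\<in>?S. contribution G v l es \<tau> * state_sum G T v w \<tau> es')"
    unfolding state_sum_def sum_distrib_left
    by (intro sum.cong refl) (auto simp: states_def)
  finally show ?thesis .
qed

lemma state_sum_no_walk: "\<not> walk G v es w \<Longrightarrow> state_sum G T v w es es' = 0"
  by (cases T) (auto simp: state_sum_def states_Nil states_Cons)

lemma state_sum_single: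
  assumes G: "bipartite_graph G"
  shows "state_sum G [l] v w es es' =
    (if walk G v es w \<and> walk G v es' w \<and> compatible G l es es' then contribution G v l es es' else 0)"
proof (cases "walk G v es w")
  case True
  have "state_sum G [l] v w es es' = (\<Sum>\<tau>\<in>{\<tau>. compatible G l es \<tau> \<and> walk G v \<tau> w}.
      if \<tau> = es' then contribution G v l es es' else 0)"
    unfolding state_sum_Cons[OF G True] by (rule sum.cong) (auto simp: state_sum_Nil)
  then show ?thesis using True finite_compatible[OF G, of l es v w] by simp
qed (simp add: state_sum_no_walk)

abbreviation tangle_shape :: "nat \<Rightarrow> 'x tangle \<Rightarrow> nat \<Rightarrow> bool" where
  "tangle_shape \<equiv> tangle (\<lambda>_ _. UNIV) Pos"

text \<open>This is multiplication of transfer matrices. The shape hypothesis fixes the length m of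
  the path between the two tangles, so that the intermediate sum runs over a finite set known in
  advance.\<close>

lemma state_sum_append:
  assumes G: "bipartite_graph G" and "tangle_shape (length es) T m"
  shows "state_sum G (T @ T') v w es es' =
    (\<Sum>\<tau>\<in>{\<tau> \<in> walks_from G v m. endpoint G (v, \<tau>) = w}. state_sum G T v w es \<tau> * state_sum G T' v w \<tau> es')"
  using assms(2)
proof (induction T arbitrary: es)
  case Nil
  let ?W = "{\<tau> \<in> walks_from G v m. endpoint G (v, \<tau>) = w}"
  have fin: "finite ?W" using finite_walks_from[OF G, of v m] by simp
  have W: "walk G v es w \<longleftrightarrow> es \<in> ?W" using Nil walk_iff_endpoint[of G v es w] by simp
  have walk: "walk G v \<tau> w" if "\<tau> \<in> ?W" for \<tau> using that walks_from_walk[of \<tau> G v m] by simp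
  have "(\<Sum>\<tau>\<in>?W. state_sum G [] v w es \<tau> * state_sum G T' v w \<tau> es') =
      (\<Sum>\<tau>\<in>?W. if \<tau> = es then state_sum G T' v w es es' else 0)"
  proof (rule sum.cong)
    fix \<tau> assume "\<tau> \<in> ?W"
    from walk[OF this] show "state_sum G [] v w es \<tau> * state_sum G T' v w \<tau> es' =
        (if \<tau> = es then state_sum G T' v w es es' else 0)"
      by (auto simp: state_sum_Nil)
  qed simp
  also have "\<dots> = (if es \<in> ?W then state_sum G T' v w es es' else 0)" using fin by (rule sum.delta)
  also have "\<dots> = state_sum G T' v w es es'" using state_sum_no_walk W by metis
  finally show ?case by simp
next
  case (Cons l T)
  show ?case
  proof (cases "walk G v es w")
    case True
    let ?W = "{\<tau> \<in> walks_from G v m. endpoint G (v, \<tau>) = w}"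
    let ?S = "{\<tau>. compatible G l es \<tau> \<and> walk G v \<tau> w}"
    have "state_sum G ((l # T) @ T') v w es es' =
        (\<Sum>\<tau>\<in>?S. contribution G v l es \<tau> * state_sum G (T @ T') v w \<tau> es')"
      using state_sum_Cons[OF G True] by simp
    also have "\<dots> = (\<Sum>\<tau>\<in>?S. contribution G v l es \<tau> *
        (\<Sum>\<rho>\<in>?W. state_sum G T v w \<tau> \<rho> * state_sum G T' v w \<rho> es'))"
    proof (rule sum.cong)
      fix \<tau> assume "\<tau> \<in> ?S"
      then have "tangle_shape (length \<tau>) T m"
        using Cons.prems compatible_length[of G "fst l" "snd l" es \<tau>]
        by (cases l) auto
      from Cons.IH[OF this] show "contribution G v l es \<tau> * state_sum G (T @ T') v w \<tau> es' =
        contribution G v l es \<tau> * (\<Sum>\<rho>\<in>?W. state_sum G T v w \<tau> \<rho> * state_sum G T' v w \<rho> es')"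
        by simp
    qed simp
    also have "\<dots> = (\<Sum>\<rho>\<in>?W. state_sum G (l # T) v w es \<rho> * state_sum G T' v w \<rho> es')"
      unfolding state_sum_Cons[OF G True] sum_distrib_left sum_distrib_right
      by (subst sum.swap) (simp add: mult.assoc)
    finally show ?thesis .
  qed (simp add: state_sum_no_walk)
qed

lemma compatible_box0:
  "compatible G (0, Box n x) es es' \<longleftrightarrow> n \<le> length es \<and> n \<le> length es' \<and> drop n es = drop n es'"
proof
  assume "n \<le> length es \<and> n \<le> length es' \<and> drop n es = drop n es'"
  then have "length (take n es) = n" "length (take n es') = n"
    "es = [] @ take n es @ drop n es'" "es' = [] @ take n es' @ drop n es'"
    by (auto, metis append_take_drop_id)
  then show "compatible G (0, Box n x) es es'" unfolding compatible.simps by blast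
qed auto

lemma contribution_box0:
  "contribution G v (0, Box n x) es es' = x (v, take n es) (v, take n es')"
  by (simp add: endpoint_def)

lemma state_sum_box:
  assumes "bipartite_graph G" "walk G v es w" "walk G v es' w" "length es = n" "length es' = n"
  shows "state_sum G [(0, Box n x)] v w es es' = x (v, es) (v, es')"
  unfolding state_sum_single[OF assms(1)] compatible_box0 contribution_box0 using assms by simp

lemma state_sum_mult:
  assumes "bipartite_graph G" "walk G v es w" "walk G v es' w" "length es = n" "length es' = n"
  shows "state_sum G [(0, Box n x), (0, Box n y)] v w es es' =
    (\<Sum>\<tau>\<in>{\<tau> \<in> walks_from G v n. endpoint G (v, \<tau>) = w}. x (v, es) (v, \<tau>) * y (v, \<tau>) (v, es'))"
proof -
  have *: "walk G v \<tau> w" "length \<tau> = n" if "\<tau> \<in> walks_from G v n" "endpoint G (v, \<tau>) = w" for \<tau>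
    using walks_from_walk[OF that(1)] walks_from_length[OF that(1)] that(2) by simp_all
  have "state_sum G [(0, Box n x), (0, Box n y)] v w es es' =
    (\<Sum>\<tau>\<in>{\<tau> \<in> walks_from G v n. endpoint G (v, \<tau>) = w}.
      state_sum G [(0, Box n x)] v w es \<tau> * state_sum G [(0, Box n y)] v w \<tau> es')"
    using state_sum_append[OF assms(1), of es "[(0, Box n x)]" n "[(0, Box n y)]" v w es'] assms
    by simp
  also have "\<dots> = (\<Sum>\<tau>\<in>{\<tau> \<in> walks_from G v n. endpoint G (v, \<tau>) = w}.
      x (v, es) (v, \<tau>) * y (v, \<tau>) (v, es'))"
    using assms by (intro sum.cong refl) (simp add: state_sum_box *)
  finally show ?thesis .
qed

section \<open>Traces over paths, weighted at the endpoint\<close>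

definition state_trace ::
    "('v, 'e) wgraph \<Rightarrow> 'v \<Rightarrow> ('v \<Rightarrow> real) \<Rightarrow> nat \<Rightarrow> ('v, 'e) path_matrix tangle \<Rightarrow> complex" where
  "state_trace G v h n T = (\<Sum>es\<in>walks_from G v n.
     complex_of_real (h (endpoint G (v, es))) * state_sum G T v (endpoint G (v, es)) es es)"

text \<open>All paths of a state end at the same vertex w, so h w is a common factor and the claim
  is cyclicity of the trace of a matrix product for each w. As n and m may differ, a single minimum
  can be moved around the trace.\<close>

lemma state_trace_cyclic:
  assumes G: "bipartite_graph G" and T: "tangle_shape n T m" "tangle_shape m T' n"
  shows "state_trace G v h n (T @ T') = state_trace G v h m (T' @ T)"
proof -
  have *: "state_trace G v h n (T @ T') = (\<Sum>es\<in>walks_from G v n. \<Sum>\<tau>\<in>walks_from G v m.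
      if endpoint G (v, \<tau>) = endpoint G (v, es)
      then complex_of_real (h (endpoint G (v, es))) *
        (state_sum G T v (endpoint G (v, es)) es \<tau> * state_sum G T' v (endpoint G (v, es)) \<tau> es) else 0)"
    if "tangle_shape n T m" for n m T T'
    unfolding state_trace_def
  proof (rule sum.cong)
    fix es assume "es \<in> walks_from G v n"
    then have "tangle_shape (length es) T m" using that by (simp add: walks_from_def)
    from state_sum_append[OF G this, of T' v "endpoint G (v, es)" es]
    show "complex_of_real (h (endpoint G (v, es))) * state_sum G (T @ T') v (endpoint G (v, es)) es es =
      (\<Sum>\<tau>\<in>walks_from G v m. if endpoint G (v, \<tau>) = endpoint G (v, es)
        then complex_of_real (h (endpoint G (v, es))) *
        (state_sum G T v (endpoint G (v, es)) es \<tau> * state_sum G T' v (endpoint G (v, es)) \<tau> es) else 0)"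
      using finite_walks_from[OF G, of v m]
      by (auto simp: sum_distrib_left sum.inter_filter intro!: sum.cong)
  qed simp
  show ?thesis unfolding *[OF T(1)] *[OF T(2)]
    by (subst sum.swap) (intro sum.cong refl, auto simp: mult_ac)
qed

lemma walks_from_Suc:
  "walks_from G v (Suc n) =
    (\<lambda>(a, c). a @ [c]) ` (SIGMA a:walks_from G v n. {c \<in> edges G. src G c = endpoint G (v, a)})"
  if G: "bipartite_graph G"
proof (intro equalityI subsetI)
  fix es assume "es \<in> walks_from G v (Suc n)"
  then obtain w where w: "length es = Suc n" "walk G v es w" by (auto simp: walks_from_def)
  then obtain a c where es: "es = a @ [c]" by (cases es rule: rev_cases) auto
  then obtain u where u: "walk G v a u" "walk G u [c] w" using w walk_append[OF G] by blast
  then have "a \<in> walks_from G v n" "c \<in> edges G" "src G c = endpoint G (v, a)"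
    using w es walk_endpoint[OF u(1)] by (auto simp: walks_from_def)
  then show "es \<in> (\<lambda>(a, c). a @ [c]) `
      (SIGMA a:walks_from G v n. {c \<in> edges G. src G c = endpoint G (v, a)})" using es by force
next
  fix es assume "es \<in> (\<lambda>(a, c). a @ [c]) `
      (SIGMA a:walks_from G v n. {c \<in> edges G. src G c = endpoint G (v, a)})"
  then obtain a c where es: "es = a @ [c]" "a \<in> walks_from G v n" "c \<in> edges G"
    "src G c = endpoint G (v, a)" by auto
  have "walk G (endpoint G (v, a)) [c] (tgt G c)"
    using es G by (auto simp: bipartite_graph_def verts_def)
  moreover have "walk G v a (endpoint G (v, a))" using walks_from_walk[OF es(2)] .
  ultimately have "walk G v es (tgt G c)" using walk_append[OF G] es by blast
  then show "es \<in> walks_from G v (Suc n)" using es by (auto simp: walks_from_def)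
qed

lemma sum_walks_from_Suc:
  assumes G: "bipartite_graph G"
  shows "(\<Sum>es\<in>walks_from G v (Suc n). F es) =
    (\<Sum>a\<in>walks_from G v n. \<Sum>c\<in>{c \<in> edges G. src G c = endpoint G (v, a)}. F (a @ [c]))"
proof -
  have fin: "finite {c \<in> edges G. src G c = u}" for u
  proof -
    have "inj_on (\<lambda>c. [c]) {c \<in> edges G. src G c = u}" by (simp add: inj_on_def)
    moreover have "(\<lambda>c. [c]) ` {c \<in> edges G. src G c = u} \<subseteq> walks_from G u 1"
      using G by (auto simp: walks_from_def bipartite_graph_def verts_def)
    ultimately show ?thesis using finite_walks_from[OF G, of u 1] by (meson inj_on_finite)
  qed
  show ?thesis unfolding walks_from_Suc[OF G]
    by (subst sum.reindex) (auto simp: inj_on_def sum.Sigma finite_walks_from[OF G] fin case_prod_beta)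
qed

text \<open>The added string carries a last edge that the box does not see. Summing h over the
  targets of this edge replaces h by its image under the adjacency matrix.\<close>

lemma state_trace_incl:
  assumes G: "bipartite_graph G"
  shows "state_trace G v h (Suc n) [(0, Box n x)] =
    (\<Sum>a\<in>walks_from G v n. complex_of_real (\<Sum>c\<in>{c \<in> edges G. src G c = endpoint G (v, a)}. h (tgt G c))
      * x (v, a) (v, a))"
proof -
  have *: "state_sum G [(0, Box n x)] v (endpoint G (v, es)) es es = x (v, take n es) (v, take n es)"
    if "es \<in> walks_from G v (Suc n)" for es
    unfolding state_sum_single[OF G] compatible_box0 contribution_box0
    using walks_from_walk[OF that] walks_from_length[OF that] by simp
  have "state_trace G v h (Suc n) [(0, Box n x)] = (\<Sum>es\<in>walks_from G v (Suc n).
      complex_of_real (h (endpoint G (v, es))) * x (v, take n es) (v, take n es))"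
    unfolding state_trace_def by (intro sum.cong refl) (simp add: *)
  also have "\<dots> = (\<Sum>a\<in>walks_from G v n. \<Sum>c\<in>{c \<in> edges G. src G c = endpoint G (v, a)}.
      complex_of_real (h (tgt G c)) * x (v, a) (v, a))"
    unfolding sum_walks_from_Suc[OF G]
    by (intro sum.cong refl) (auto simp: walks_from_def endpoint_def)
  finally show ?thesis by (simp add: sum_distrib_right)
qed

section \<open>Closing the last string\<close>

lemma compatible_last_cap:
  assumes G: "bipartite_graph G" and a: "walk G v a w" "length a = m"
  shows "{\<tau>. compatible G (m, Cap) a \<tau> \<and> walk G v \<tau> w} =
    (\<lambda>c. a @ [c, rev_edge G c]) ` {c \<in> edges G. src G c = w}"
proof (intro equalityI subsetI)
  fix \<tau> assume "\<tau> \<in> {\<tau>. compatible G (m, Cap) a \<tau> \<and> walk G v \<tau> w}"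
  then have t: "walk G v \<tau> w" and "compatible G (m, Cap) a \<tau>" by simp_all
  then obtain u' c z where "length u' = m" "a = u' @ z" "\<tau> = u' @ [c, rev_edge G c] @ z"
    unfolding compatible.simps by blast
  then have c: "\<tau> = a @ [c, rev_edge G c]" using a(2) by simp
  obtain u where u: "walk G v a u" "walk G u [c, rev_edge G c] w"
    using t[unfolded c] walk_append[OF G] by blast
  then have "c \<in> edges G" "src G c = w" using walk_endpoint[OF a(1)] walk_endpoint[OF u(1)] by auto
  then show "\<tau> \<in> (\<lambda>c. a @ [c, rev_edge G c]) ` {c \<in> edges G. src G c = w}" using c by blast
next
  fix \<tau> assume "\<tau> \<in> (\<lambda>c. a @ [c, rev_edge G c]) ` {c \<in> edges G. src G c = w}"
  then obtain c where c: "\<tau> = a @ [c, rev_edge G c]" "c \<in> edges G" "src G c = w" by blast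
  have "walk G w [c, rev_edge G c] w" using c G by (auto simp: bipartite_graph_def verts_def)
  then have "walk G v \<tau> w" using a walk_append[OF G] c by blast
  moreover have "compatible G (m, Cap) a \<tau>" unfolding compatible.simps
    by (rule exI[of _ a], rule exI[of _ c], rule exI[of _ "[]"]) (simp add: a c)
  ultimately show "\<tau> \<in> {\<tau>. compatible G (m, Cap) a \<tau> \<and> walk G v \<tau> w}" by blast
qed

lemma vertex_weight_edge:
  assumes "weighted_graph G \<delta>" "c \<in> edges G"
  shows "vertex_weight G (src G c) > 0" "vertex_weight G (tgt G c) > 0"
    "vertex_weight G (tgt G c) / vertex_weight G (src G c) = weight G c"
proof -
  have "src G c \<in> verts G" "tgt G c \<in> verts G"
    using assms by (auto simp: weighted_graph_def bipartite_graph_def verts_def)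
  then show "vertex_weight G (src G c) > 0" "vertex_weight G (tgt G c) > 0"
    "vertex_weight G (tgt G c) / vertex_weight G (src G c) = weight G c"
    using vertex_weight_exists[OF assms(1)] assms(2) by (auto simp: is_vertex_weight_def)
qed

text \<open>The maximum and the minimum of the closed string each contribute the square root of the
  same ratio of vertex weights, and that ratio is the weight of c.\<close>

lemma cap_cup_weight:
  assumes "weighted_graph G \<delta>" "c \<in> edges G" "length a = m"
  shows "contribution G v (m, Cap) a (a @ [c, rev_edge G c]) *
    contribution G v (m, Cup) (a @ [c, rev_edge G c]) a = complex_of_real (weight G c)"
proof -
  have "weight G c > 0" using assms(1,2) unfolding weighted_graph_def by blast
  then have sq: "sqrt (weight G c) * sqrt (weight G c) = weight G c" by simp
  have "(a @ [c, rev_edge G c]) ! m = c" using assms(3) by (simp add: nth_append)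
  then have "contribution G v (m, Cap) a (a @ [c, rev_edge G c]) = complex_of_real (sqrt (weight G c))"
    "contribution G v (m, Cup) (a @ [c, rev_edge G c]) a = complex_of_real (sqrt (weight G c))"
    unfolding contribution.simps by (simp_all only: vertex_weight_edge(3)[OF assms(1,2)])
  then show ?thesis by (simp only: sq flip: of_real_mult)
qed

text \<open>The closed string passes to the right of the box and carries the reverse of c there.
  This forces the same edge at the maximum and at the minimum, so that only diagonal entries of x
  survive.\<close>

lemma state_sum_cap_box_cup:
  fixes G :: "('v, 'e) wgraph"
  assumes W: "weighted_graph G \<delta>" and a: "walk G v a w" "length a = m"
  shows "state_sum G [(m, Cap), (0, Box (Suc m) x), (m, Cup)] v w a a =
    (\<Sum>c\<in>{c \<in> edges G. src G c = w}. complex_of_real (weight G c) * x (v, a @ [c]) (v, a @ [c]))"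
proof -
  have G: "bipartite_graph G" using W by (simp add: weighted_graph_def)
  have inj: "inj_on (\<lambda>c. a @ [c, rev_edge G c]) {c \<in> edges G. src G c = w}" by (simp add: inj_on_def)
  have rr: "rev_edge G (rev_edge G c) = c" if "c \<in> edges G" for c
    using that G by (simp add: bipartite_graph_def)
  have "state_sum G [(0, Box (Suc m) x), (m, Cup)] v w (a @ [c, rev_edge G c]) a =
      x (v, a @ [c]) (v, a @ [c]) * contribution G v (m, Cup) (a @ [c, rev_edge G c]) a"
    if c: "c \<in> edges G" "src G c = w" for c
  proof -
    let ?t = "a @ [c, rev_edge G c]"
    let ?S = "{\<tau>. compatible G (0, Box (Suc m) x) ?t \<tau> \<and> walk G v \<tau> w}"
    have t: "walk G v ?t w" using compatible_last_cap[OF G a] c by blast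
    have tS: "?t \<in> ?S" using t a by (simp only: compatible_box0) simp
    have "state_sum G [(0, Box (Suc m) x), (m, Cup)] v w ?t a =
        (\<Sum>\<tau>\<in>?S. contribution G v (0, Box (Suc m) x) ?t \<tau> * state_sum G [(m, Cup)] v w \<tau> a)"
      by (rule state_sum_Cons[OF G t])
    also have "\<dots> = (\<Sum>\<tau>\<in>{?t}. contribution G v (0, Box (Suc m) x) ?t \<tau> * state_sum G [(m, Cup)] v w \<tau> a)"
    proof (rule sum.mono_neutral_right)
      show "finite ?S" by (rule finite_compatible[OF G])
      show "{?t} \<subseteq> ?S" using tS by blast
      show "\<forall>\<tau>\<in>?S - {?t}. contribution G v (0, Box (Suc m) x) ?t \<tau> * state_sum G [(m, Cup)] v w \<tau> a = 0"
      proof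
        fix \<tau> assume \<tau>: "\<tau> \<in> ?S - {?t}"
        have "\<not> compatible G (m, Cup :: ('v, 'e) path_matrix piece) \<tau> a"
        proof
          assume "compatible G (m, Cup :: ('v, 'e) path_matrix piece) \<tau> a"
          then obtain u d z where "length u = m" "\<tau> = u @ [d, rev_edge G d] @ z" "a = u @ z"
            unfolding compatible.simps by blast
          then have d: "\<tau> = a @ [d, rev_edge G d]" using a(2) by simp
          \<comment> \<open>The box leaves everything to its right unchanged, hence the reverses of
            c and d coincide.\<close>
          have "drop (Suc m) ?t = drop (Suc m) \<tau>" using \<tau> by (simp only: compatible_box0) simp
          then have "rev_edge G d = rev_edge G c" using a by (simp add: d)
          moreover have "d \<in> edges G"
            using \<tau> walk_append[OF G, of v a "[d, rev_edge G d]" w] by (auto simp: d)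
          ultimately have "d = c" using rr c by metis
          then show False using \<tau> d by simp
        qed
        then show "contribution G v (0, Box (Suc m) x) ?t \<tau> * state_sum G [(m, Cup)] v w \<tau> a = 0"
          by (simp add: state_sum_single[OF G] del: compatible.simps)
      qed
    qed
    also have "\<dots> = x (v, a @ [c]) (v, a @ [c]) * contribution G v (m, Cup) ?t a"
    proof -
      have "compatible G (m, Cup :: ('v, 'e) path_matrix piece) ?t a" unfolding compatible.simps
        by (rule exI[of _ a], rule exI[of _ c], rule exI[of _ "[]"]) (simp add: a)
      then have "state_sum G [(m, Cup)] v w ?t a = contribution G v (m, Cup) ?t a"
        using t a by (simp add: state_sum_single[OF G] del: compatible.simps contribution.simps)
      then show ?thesis using a(2) by (simp add: contribution_box0 del: contribution.simps)
    qed
    finally show ?thesis .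
  qed
  then have "state_sum G [(m, Cap), (0, Box (Suc m) x), (m, Cup)] v w a a =
    (\<Sum>c\<in>{c \<in> edges G. src G c = w}. contribution G v (m, Cap) a (a @ [c, rev_edge G c]) *
       (x (v, a @ [c]) (v, a @ [c]) * contribution G v (m, Cup) (a @ [c, rev_edge G c]) a))"
    unfolding state_sum_Cons[OF G a(1)] compatible_last_cap[OF G a] sum.reindex[OF inj]
    by (intro sum.cong refl) (simp del: contribution.simps)
  also have "\<dots> = (\<Sum>c\<in>{c \<in> edges G. src G c = w}. complex_of_real (weight G c) * x (v, a @ [c]) (v, a @ [c]))"
  proof (rule sum.cong)
    fix c assume "c \<in> {c \<in> edges G. src G c = w}"
    have rearrange: "p * (y * q) = (p * q) * y" for p q y :: complex by simp
    from \<open>c \<in> _\<close> have "contribution G v (m, Cap) a (a @ [c, rev_edge G c]) *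
      contribution G v (m, Cup) (a @ [c, rev_edge G c]) a = complex_of_real (weight G c)"
      using cap_cup_weight[OF W _ a(2)] by blast
    then show "contribution G v (m, Cap) a (a @ [c, rev_edge G c]) *
       (x (v, a @ [c]) (v, a @ [c]) * contribution G v (m, Cup) (a @ [c, rev_edge G c]) a) =
       complex_of_real (weight G c) * x (v, a @ [c]) (v, a @ [c])"
      by (simp only: rearrange)
  qed simp
  finally show ?thesis .
qed

text \<open>The weight of c turns the vertex weight at the end of a into the one at the end of a
  extended by c. The argument depends on the trace being weighted by
  \<open>vertex_weight G\<close>.\<close>

lemma state_trace_cond_exp:
  assumes W: "weighted_graph G \<delta>"
  shows "state_trace G v (vertex_weight G) m [(m, Cap), (0, Box (Suc m) x), (m, Cup)] =
    state_trace G v (vertex_weight G) (Suc m) [(0, Box (Suc m) x)]"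
proof -
  have G: "bipartite_graph G" using W by (simp add: weighted_graph_def)
  have "state_trace G v (vertex_weight G) (Suc m) [(0, Box (Suc m) x)] =
    (\<Sum>es\<in>walks_from G v (Suc m). complex_of_real (vertex_weight G (endpoint G (v, es))) * x (v, es) (v, es))"
    unfolding state_trace_def
    by (intro sum.cong refl) (simp only: state_sum_box[OF G walks_from_walk walks_from_walk walks_from_length walks_from_length])
  also have "\<dots> = (\<Sum>a\<in>walks_from G v m. \<Sum>c\<in>{c \<in> edges G. src G c = endpoint G (v, a)}.
      complex_of_real (vertex_weight G (tgt G c)) * x (v, a @ [c]) (v, a @ [c]))"
    unfolding sum_walks_from_Suc[OF G] by (simp add: endpoint_def)
  also have "\<dots> = (\<Sum>a\<in>walks_from G v m. complex_of_real (vertex_weight G (endpoint G (v, a))) *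
      (\<Sum>c\<in>{c \<in> edges G. src G c = endpoint G (v, a)}. complex_of_real (weight G c) * x (v, a @ [c]) (v, a @ [c])))"
    unfolding sum_distrib_left
  proof (intro sum.cong refl)
    fix a c assume c: "c \<in> {c \<in> edges G. src G c = endpoint G (v, a)}"
    then have "vertex_weight G (tgt G c) = vertex_weight G (endpoint G (v, a)) * weight G c"
      using vertex_weight_edge[OF W, of c] by (auto simp: field_simps)
    then show "complex_of_real (vertex_weight G (tgt G c)) * x (v, a @ [c]) (v, a @ [c]) =
      complex_of_real (vertex_weight G (endpoint G (v, a))) *
        (complex_of_real (weight G c) * x (v, a @ [c]) (v, a @ [c]))" by simp
  qed
  also have "\<dots> = state_trace G v (vertex_weight G) m [(m, Cap), (0, Box (Suc m) x), (m, Cup)]"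
    unfolding state_trace_def
    by (intro sum.cong refl) (simp only: state_sum_cap_box_cup[OF W walks_from_walk walks_from_length])
  finally show ?thesis by simp
qed

text \<open>The loop carries an arbitrary edge out of v, and the weights of these edges add up to
  \<delta>.\<close>

lemma state_sum_loop:
  fixes G :: "('v, 'e) wgraph"
  assumes W: "weighted_graph G \<delta>" and v: "v \<in> verts G"
  shows "state_sum G [(0, Cap), (0, Cup)] v v [] [] = complex_of_real \<delta>"
proof -
  have G: "bipartite_graph G" using W by (simp add: weighted_graph_def)
  have w: "walk G v [] v" using v by simp
  have inj: "inj_on (\<lambda>c. [] @ [c, rev_edge G c]) {c \<in> edges G. src G c = v}" by (simp add: inj_on_def)
  have "state_sum G [(0, Cap), (0, Cup)] v v [] [] =
      (\<Sum>c\<in>{c \<in> edges G. src G c = v}. complex_of_real (weight G c))"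
    unfolding state_sum_Cons[OF G w] compatible_last_cap[OF G w list.size(3)] sum.reindex[OF inj] comp_def
  proof (intro sum.cong refl)
    fix c assume c: "c \<in> {c \<in> edges G. src G c = v}"
    have t: "walk G v ([] @ [c, rev_edge G c]) v" using compatible_last_cap[OF G w list.size(3)] c by blast
    have "compatible G (0, Cup :: ('v, 'e) path_matrix piece) ([] @ [c, rev_edge G c]) []" by simp
    with t w have "state_sum G [(0, Cup)] v v ([] @ [c, rev_edge G c]) [] =
        contribution G v (0, Cup) ([] @ [c, rev_edge G c]) []"
      unfolding state_sum_single[OF G] by (simp only: simp_thms if_True)
    then show "contribution G v (0, Cap) [] ([] @ [c, rev_edge G c]) *
        state_sum G [(0, Cup)] v v ([] @ [c, rev_edge G c]) [] = complex_of_real (weight G c)"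
      using cap_cup_weight[OF W _ list.size(3), of c v] c by (simp only: append_Nil mem_Collect_eq)
  qed
  also have "\<dots> = complex_of_real \<delta>"
    using W v by (simp add: weighted_graph_def flip: of_real_sum)
  finally show ?thesis .
qed

text \<open>A box without strings to its left borders on the leftmost region, which carries v in
  every state. Each state thus has a factor that is an entry of x at v.\<close>

lemma state_sum_zero_box:
  assumes "\<And>a b. x (v, a) (v, b) = 0"
  shows "state_sum G (U @ [(0, Box n x)] @ V) v w es es' = 0"
proof -
  have "(\<Prod>i<length (U @ [(0, Box n x)] @ V).
      contribution G v ((U @ [(0, Box n x)] @ V) ! i) (\<sigma> ! i) (\<sigma> ! Suc i)) = 0" for \<sigma>
  proof (rule prod_zero)
    have "contribution G v ((U @ [(0, Box n x)] @ V) ! length U) (\<sigma> ! length U) (\<sigma> ! Suc (length U)) = 0"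
      using assms by (simp add: endpoint_def nth_append)
    then show "\<exists>i\<in>{..<length (U @ [(0, Box n x)] @ V)}.
        contribution G v ((U @ [(0, Box n x)] @ V) ! i) (\<sigma> ! i) (\<sigma> ! Suc i) = 0"
      by (intro bexI[of _ "length U"]) auto
  qed simp
  then show ?thesis unfolding state_sum_def by (intro sum.neutral ballI)
qed

lemma paths_iff:
  "v \<in> sign_verts G \<epsilon> \<Longrightarrow> (v, es) \<in> paths G \<epsilon> n \<longleftrightarrow> es \<in> walks_from G v n"
  by (auto simp: paths_def walks_from_def)

lemma gpa_act_entry:
  assumes "v \<in> sign_verts G \<epsilon>" "es \<in> walks_from G v n" "es' \<in> walks_from G v n"
    "endpoint G (v, es) = endpoint G (v, es')"
  shows "gpa_act G \<epsilon> n T (v, es) (v, es') = state_sum G T v (endpoint G (v, es)) es es'"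
  using assms by (simp add: gpa_act_def paths_iff state_sum_def)

lemma gpa_act_nonzero:
  assumes "gpa_act G \<epsilon> n T (v, es) (u, es') \<noteq> 0"
  shows "es \<in> walks_from G v n" "es' \<in> walks_from G u n" "v = u"
    "endpoint G (v, es) = endpoint G (u, es')"
proof -
  have "(v, es) \<in> paths G \<epsilon> n \<and> (u, es') \<in> paths G \<epsilon> n \<and> v = u \<and>
      endpoint G (v, es) = endpoint G (u, es')"
    using assms unfolding gpa_act_def fst_conv by (meson)
  then show "es \<in> walks_from G v n" "es' \<in> walks_from G u n" "v = u"
    "endpoint G (v, es) = endpoint G (u, es')"
    unfolding paths_def walks_from_def by blast+
qed

section \<open>Planar subalgebras of a graph planar algebra\<close>

lemma shade_0 [simp]: "shade \<epsilon> 0 = \<epsilon>"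
  by (simp add: shade_def)

lemma shift_0 [simp]: "shift 0 T = T"
  by (simp add: shift_def)

lemma tangle_append:
  "tangle A \<epsilon> m (U @ V) m' \<longleftrightarrow> (\<exists>k. tangle A \<epsilon> m U k \<and> tangle A \<epsilon> k V m')"
proof (induction U arbitrary: m)
  case (Cons l U)
  obtain k p where "l = (k, p)" by (cases l)
  then show ?case using Cons.IH by simp
qed simp

lemma relabel_append: "relabel f \<epsilon> (U @ V) = relabel f \<epsilon> U @ relabel f \<epsilon> V"
  by (simp add: relabel_def)

lemma caps_Suc: "caps k (Suc n) = caps k n @ [(k + n, Cap)]"
  by (simp add: caps_def)

lemma cups_Suc: "cups k (Suc n) = (k + n, Cup) # cups k n"
  by (simp add: cups_def)

lemma tangle_caps: "k \<le> m \<Longrightarrow> tangle A \<epsilon> m (caps k n) (m + 2 * n)"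
proof (induction n)
  case (Suc n)
  then show ?case by (auto simp: caps_Suc tangle_append intro!: exI[of _ "m + 2 * n"])
qed (simp add: caps_def)

lemma tangle_cups: "k \<le> m \<Longrightarrow> tangle A \<epsilon> (m + 2 * n) (cups k n) m"
  by (induction n) (auto simp: cups_Suc, simp add: cups_def)

text \<open>The data fixed for the rest of the argument: an embedding, a base vertex v, and a pair
  h, r as provided by \<open>superharmonic_exists\<close>.\<close>

locale embedded_planar_algebra = subfactor_planar_algebra Q
  for Q :: "'q::ab_group_add planar_data" +
  fixes G :: "('v, 'e) wgraph" and \<delta> :: real
    and \<phi> :: "sign \<Rightarrow> nat \<Rightarrow> 'q \<Rightarrow> ('v, 'e) path_matrix"
    and v :: 'v and h :: "'v \<Rightarrow> real" and r :: real
  assumes weighted: "weighted_graph G \<delta>"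
    and embedding: "planar_embedding Q (graph_planar_algebra G) \<phi>"
    and v_even: "v \<in> even_verts G"
    and h_pos: "\<And>w. w \<in> verts G \<Longrightarrow> h w > 0"
    and h_superharmonic: "\<And>w. w \<in> verts G \<Longrightarrow> (\<Sum>e\<in>out_edges G w. h (tgt G e)) \<le> r * h w"
begin

abbreviation V :: "nat \<Rightarrow> 'q set" where "V n \<equiv> sp Q Pos n"
abbreviation ac :: "nat \<Rightarrow> 'q tangle \<Rightarrow> 'q" where "ac n T \<equiv> act Q Pos n T"
abbreviation tg :: "nat \<Rightarrow> 'q tangle \<Rightarrow> nat \<Rightarrow> bool" where "tg \<equiv> tangle (sp Q) Pos"
abbreviation ml :: "nat \<Rightarrow> 'q \<Rightarrow> 'q \<Rightarrow> 'q" where "ml n \<equiv> mult Q Pos n"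
abbreviation st :: "nat \<Rightarrow> 'q \<Rightarrow> 'q" where "st n \<equiv> star Q Pos n"

lemma bipartite: "bipartite_graph G"
  using weighted by (simp add: weighted_graph_def)

lemma v_sign: "v \<in> sign_verts G Pos"
  using v_even by (simp add: sign_verts_def)

lemma v_verts: "v \<in> verts G"
  using v_even by (simp add: verts_def)

lemma end_verts: "es \<in> walks_from G v n \<Longrightarrow> endpoint G (v, es) \<in> verts G"
  using walks_from_walk walk_end_verts by metis

lemma V_sub: "module.subspace (scal Q) (V n)"
  by (rule subspace)

interpretation vs: vector_space "scal Q" by (rule vector_space)

lemma V_zero [simp]: "0 \<in> V n"
  and V_add [simp]: "x \<in> V n \<Longrightarrow> y \<in> V n \<Longrightarrow> x + y \<in> V n"
  and V_scal [simp]: "x \<in> V n \<Longrightarrow> scal Q c x \<in> V n"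
  using V_sub[of n] by (auto simp: vs.subspace_def)

lemma ac_closed: "tg n T n \<Longrightarrow> ac n T \<in> V n"
  by (rule act_closed)

text \<open>Composition at a box with no strings to its left, where neither the colour changes nor a
  shift occurs.\<close>

lemma ac_comp:
  assumes "tg k T k" "tg n (U @ [(0, Box k (ac k T))] @ W) n"
  shows "ac n (U @ [(0, Box k (ac k T))] @ W) = ac n (U @ T @ W)"
  using act_composition[of Pos 0 k T n U W] assms by simp

lemma ac_linear:
  assumes "\<And>x. x \<in> V k \<Longrightarrow> tg n (U @ [(0, Box k x)] @ W) n" "x \<in> V k" "y \<in> V k"
  shows "ac n (U @ [(0, Box k (scal Q c x + y))] @ W) =
    scal Q c (ac n (U @ [(0, Box k x)] @ W)) + ac n (U @ [(0, Box k y)] @ W)"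
  using act_linear[of x Pos 0 k y n U W c] assms by simp

lemma ac_box_add:
  assumes "\<And>x. x \<in> V k \<Longrightarrow> tg n (U @ [(0, Box k x)] @ W) n" "x \<in> V k" "y \<in> V k"
  shows "ac n (U @ [(0, Box k (x + y))] @ W) =
    ac n (U @ [(0, Box k x)] @ W) + ac n (U @ [(0, Box k y)] @ W)"
  using ac_linear[OF assms, of 1] by simp

lemma ac_box_scal:
  assumes "\<And>x. x \<in> V k \<Longrightarrow> tg n (U @ [(0, Box k x)] @ W) n" "x \<in> V k"
  shows "ac n (U @ [(0, Box k (scal Q c x))] @ W) = scal Q c (ac n (U @ [(0, Box k x)] @ W))"
proof -
  have "ac n (U @ [(0, Box k 0)] @ W) = ac n (U @ [(0, Box k 0)] @ W) + ac n (U @ [(0, Box k 0)] @ W)"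
    using ac_box_add[OF assms(1), of 0 0] by simp
  then have "ac n (U @ [(0, Box k 0)] @ W) = 0" by (simp only: add_cancel_right_right)
  then show ?thesis using ac_linear[OF assms(1,2), of 0 c] by simp
qed

lemma mult_closed: "x \<in> V n \<Longrightarrow> y \<in> V n \<Longrightarrow> ml n x y \<in> V n"
  unfolding mult_def by (rule ac_closed) simp

lemma mult_ac:
  assumes "tg n S n" "tg n T n"
  shows "ml n (ac n S) (ac n T) = ac n (S @ T)"
proof -
  have "ml n (ac n S) (ac n T) = ac n (S @ [(0, Box n (ac n T))])"
    unfolding mult_def using ac_comp[of n S n "[]" "[(0, Box n (ac n T))]"] assms ac_closed by simp
  also have "\<dots> = ac n (S @ T)"
    using ac_comp[of n T n S "[]"] assms ac_closed by (auto simp: tangle_append)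
  finally show ?thesis .
qed

lemma ac_box: "x \<in> V n \<Longrightarrow> ac n [(0, Box n x)] = x"
  by (rule act_identity)

lemma star_ac: "tg n T n \<Longrightarrow> st n (ac n T) = ac n (reflect (relabel (star Q) Pos T))"
  by (rule star_act)

section \<open>Entries of the image of \<open>Q\<close> and the traces they define\<close>

lemma phi_linear:
  assumes "x \<in> V n" "y \<in> V n"
  shows "\<phi> Pos n (scal Q c x + y) a b = c * \<phi> Pos n x a b + \<phi> Pos n y a b"
  using embedding assms unfolding planar_embedding_def graph_planar_algebra_def by simp

lemma phi_zero: "\<phi> Pos n 0 a b = 0"
  using phi_linear[of 0 n 0 1 a b] by simp

lemma phi_add: "x \<in> V n \<Longrightarrow> y \<in> V n \<Longrightarrow> \<phi> Pos n (x + y) a b = \<phi> Pos n x a b + \<phi> Pos n y a b"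
  using phi_linear[of x n y 1] by simp

lemma phi_scal: "x \<in> V n \<Longrightarrow> \<phi> Pos n (scal Q c x) a b = c * \<phi> Pos n x a b"
  using phi_linear[of x n 0 c] by (simp add: phi_zero)

lemma phi_star: "x \<in> V n \<Longrightarrow> \<phi> Pos n (st n x) a b = cnj (\<phi> Pos n x b a)"
  using embedding unfolding planar_embedding_def graph_planar_algebra_def by simp

lemma phi_act: "tg n T n \<Longrightarrow> \<phi> Pos n (ac n T) = gpa_act G Pos n (relabel \<phi> Pos T)"
  using embedding unfolding planar_embedding_def graph_planar_algebra_def by simp

text \<open>The identity tangle writes the image of x as a value of \<open>gpa_act\<close>, whose
  entries vanish by definition unless both paths have the right length and share source and
  target.\<close>

lemma phi_nonzero:
  assumes "x \<in> V n" "\<phi> Pos n x (v, es) (u, es') \<noteq> 0"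
  shows "es \<in> walks_from G v n" "es' \<in> walks_from G u n" "v = u"
    "endpoint G (v, es) = endpoint G (u, es')"
proof -
  have "\<phi> Pos n x = gpa_act G Pos n (relabel \<phi> Pos [(0, Box n x)])"
    using phi_act[of n "[(0, Box n x)]"] assms(1) by (simp add: ac_box)
  then show "es \<in> walks_from G v n" "es' \<in> walks_from G u n" "v = u"
    "endpoint G (v, es) = endpoint G (u, es')" using gpa_act_nonzero assms(2) by metis+
qed

text \<open>The start v of the paths is fixed and only their endpoints are weighted. The weight is a
  parameter because both h and \<open>vertex_weight G\<close> are used.\<close>

definition ptr :: "('v \<Rightarrow> real) \<Rightarrow> nat \<Rightarrow> 'q \<Rightarrow> complex" where
  "ptr g n x = (\<Sum>es\<in>walks_from G v n.
     complex_of_real (g (endpoint G (v, es))) * \<phi> Pos n x (v, es) (v, es))"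

lemma ptr_ac: "tg n T n \<Longrightarrow> ptr g n (ac n T) = state_trace G v g n (relabel \<phi> Pos T)"
  unfolding ptr_def state_trace_def
  by (intro sum.cong refl) (simp add: phi_act gpa_act_entry[OF v_sign])

lemma ptr_add: "x \<in> V n \<Longrightarrow> y \<in> V n \<Longrightarrow> ptr g n (x + y) = ptr g n x + ptr g n y"
  by (simp add: ptr_def phi_add algebra_simps sum.distrib)

lemma ptr_scal: "x \<in> V n \<Longrightarrow> ptr g n (scal Q c x) = c * ptr g n x"
  by (simp add: ptr_def phi_scal sum_distrib_left mult.left_commute)

lemma ptr_mult: "x \<in> V n \<Longrightarrow> y \<in> V n \<Longrightarrow> ptr g n (ml n x y) = ptr g n (ml n y x)"
  using state_trace_cyclic[OF bipartite, of n "[(0, Box n (\<phi> Pos n x))]" n "[(0, Box n (\<phi> Pos n y))]"]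
  by (simp add: mult_def ptr_ac relabel_def)

lemma phi_mult_star:
  assumes x: "x \<in> V n" and es: "es \<in> walks_from G v n"
  shows "\<phi> Pos n (ml n x (st n x)) (v, es) (v, es) = complex_of_real
    (\<Sum>\<tau>\<in>{\<tau> \<in> walks_from G v n. endpoint G (v, \<tau>) = endpoint G (v, es)}. (cmod (\<phi> Pos n x (v, es) (v, \<tau>)))\<^sup>2)"
proof -
  have "tg n [(0, Box n x), (0, Box n (st n x))] n" using x star_closed by simp
  then have "\<phi> Pos n (ml n x (st n x)) (v, es) (v, es) =
      state_sum G [(0, Box n (\<phi> Pos n x)), (0, Box n (\<phi> Pos n (st n x)))] v (endpoint G (v, es)) es es"
    unfolding mult_def by (simp add: phi_act gpa_act_entry[OF v_sign es es] relabel_def)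
  also have "\<dots> = (\<Sum>\<tau>\<in>{\<tau> \<in> walks_from G v n. endpoint G (v, \<tau>) = endpoint G (v, es)}.
      \<phi> Pos n x (v, es) (v, \<tau>) * \<phi> Pos n (st n x) (v, \<tau>) (v, es))"
    using walks_from_walk[OF es] walks_from_length[OF es] by (intro state_sum_mult[OF bipartite]) auto
  also have "\<dots> = complex_of_real
    (\<Sum>\<tau>\<in>{\<tau> \<in> walks_from G v n. endpoint G (v, \<tau>) = endpoint G (v, es)}. (cmod (\<phi> Pos n x (v, es) (v, \<tau>)))\<^sup>2)"
    unfolding of_real_sum by (intro sum.cong refl) (simp add: phi_star[OF x] flip: complex_norm_square)
  finally show ?thesis .
qed

lemma scalar_of_unit: "scalar_of Q Pos (scal Q c (unit0 Q Pos)) = c"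
  unfolding scalar_of_def using unit0_nonzero by (intro the_equality) auto

lemma Nil_walk: "[] \<in> walks_from G v 0"
  using v_verts by (auto simp: walks_from_def)

lemma phi_unit0: "\<phi> Pos 0 (unit0 Q Pos) (v, []) (v, []) = 1"
proof -
  show ?thesis unfolding unit0_def
    using v_verts by (simp add: phi_act gpa_act_entry[OF v_sign Nil_walk Nil_walk] relabel_def state_sum_Nil endpoint_def)
qed

text \<open>An element of level 0 is a multiple of the unit, whose image has entry 1 at the empty
  path at v. The scalar can therefore be read off at this one vertex.\<close>

lemma scalar_of_entry:
  assumes "tg 0 T 0"
  shows "scalar_of Q Pos (ac 0 T) = state_sum G (relabel \<phi> Pos T) v v [] []"
proof -
  obtain c where c: "ac 0 T = scal Q c (unit0 Q Pos)" using ac_closed[OF assms] space0[of Pos] by auto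
  have u: "unit0 Q Pos \<in> V 0" unfolding unit0_def by (rule ac_closed) simp
  have e: "[] \<in> walks_from G v 0" by (rule Nil_walk)
  have "c = \<phi> Pos 0 (ac 0 T) (v, []) (v, [])" unfolding c by (simp add: phi_scal[OF u] phi_unit0)
  also have "\<dots> = state_sum G (relabel \<phi> Pos T) v v [] []"
    using gpa_act_entry[OF v_sign e e] by (simp add: phi_act[OF assms] endpoint_def)
  finally show ?thesis by (simp add: c scalar_of_unit)
qed

lemma modulus_eq: "modulus Q = \<delta>"
  using scalar_of_entry[of "[(0, Cap), (0, Cup)]"] state_sum_loop[OF weighted v_verts]
  by (simp add: modulus_def relabel_def numeral_2_eq_2)

text \<open>In the right closure of x times its adjoint, nothing separates the left side of the box
  x from the outer region, which carries v. If all entries of x at v were 0, this closure would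
  vanish, against the positivity of \<open>tau_r\<close>.\<close>

lemma phi_faithful:
  assumes x: "x \<in> V n" "x \<noteq> 0"
  obtains a b where "\<phi> Pos n x (v, a) (v, b) \<noteq> 0"
proof -
  have "\<exists>a b. \<phi> Pos n x (v, a) (v, b) \<noteq> 0"
  proof (rule ccontr)
    assume "\<not> (\<exists>a b. \<phi> Pos n x (v, a) (v, b) \<noteq> 0)"
    then have z: "\<phi> Pos n x (v, a) (v, b) = 0" for a b by blast
    let ?T = "[(0, Box n x), (0, Box n (st n x))]"
    have T: "tg n ?T n" using x star_closed by simp
    have caps: "tg 0 (caps 0 n) (2 * n)" and cups: "tg (2 * n) (cups 0 n) 0"
      using tangle_caps[of 0 0 "sp Q" Pos n] tangle_cups[of 0 0 "sp Q" Pos n] by simp_all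
    have b: "tg (2 * n) [(0, Box n y)] (2 * n)" if "y \<in> V n" for y using that by simp
    have T2: "tg (2 * n) ?T (2 * n)" using x star_closed by simp
    have t1: "tg 0 (caps 0 n @ [(0, Box n (ac n ?T))] @ cups 0 n) 0"
      unfolding tangle_append using caps cups b[OF ac_closed[OF T]] by blast
    have t2: "tg 0 (caps 0 n @ ?T @ cups 0 n) 0"
      unfolding tangle_append using caps cups T2 by blast
    have "tau_r Q Pos n (ml n x (st n x)) = scalar_of Q Pos (ac 0 (caps 0 n @ ?T @ cups 0 n))"
      unfolding tau_r_def mult_def using ac_comp[OF T t1] by simp
    also have "\<dots> = state_sum G (relabel \<phi> Pos (caps 0 n @ ?T @ cups 0 n)) v v [] []"
      by (rule scalar_of_entry[OF t2])
    also have "relabel \<phi> Pos (caps 0 n @ ?T @ cups 0 n) = relabel \<phi> Pos (caps 0 n) @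
        [(0, Box n (\<phi> Pos n x))] @ ((0, Box n (\<phi> Pos n (st n x))) # relabel \<phi> Pos (cups 0 n))"
      by (simp add: relabel_append) (simp add: relabel_def)
    also have "state_sum G \<dots> v v [] [] = 0" by (rule state_sum_zero_box) (rule z)
    finally show False using tau_r_positive[OF x] by auto
  qed
  then show thesis using that by blast
qed

text \<open>The diagonal entries of x times its adjoint are the sums of squares along the rows of x,
  and \<open>phi_faithful\<close> provides a row that is not zero.\<close>

lemma ptr_mult_star_pos:
  assumes g: "\<And>w. w \<in> verts G \<Longrightarrow> g w > 0" and x: "x \<in> V n" "x \<noteq> 0"
  shows "\<exists>s>0. ptr g n (ml n x (st n x)) = complex_of_real s"
proof -
  let ?W = "\<lambda>es. {\<tau> \<in> walks_from G v n. endpoint G (v, \<tau>) = endpoint G (v, es)}"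
  define F where "F es = (\<Sum>\<tau>\<in>?W es. (cmod (\<phi> Pos n x (v, es) (v, \<tau>)))\<^sup>2)" for es
  have F0: "F es \<ge> 0" for es unfolding F_def by (intro sum_nonneg) simp
  obtain a b where ab: "\<phi> Pos n x (v, a) (v, b) \<noteq> 0" using phi_faithful x by blast
  note nz = phi_nonzero[OF x(1) ab]
  have fin: "finite (walks_from G v n)" by (rule finite_walks_from[OF bipartite])
  have "F a > 0" unfolding F_def using ab nz fin by (intro sum_pos2[of _ b]) auto
  then have "(\<Sum>es\<in>walks_from G v n. g (endpoint G (v, es)) * F es) > 0"
    using g[OF end_verts] F0 nz fin by (intro sum_pos2[of _ a]) (auto simp: less_imp_le)
  moreover have "ptr g n (ml n x (st n x)) =
      complex_of_real (\<Sum>es\<in>walks_from G v n. g (endpoint G (v, es)) * F es)"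
    unfolding ptr_def of_real_sum of_real_mult
    by (intro sum.cong refl) (simp only: phi_mult_star[OF x(1)] F_def)
  ultimately show ?thesis by blast
qed

lemma fin_dim: "\<exists>B. finite B \<and> V n \<subseteq> vs.span B"
proof -
  obtain B where "finite B" "V n = vs.span B" using finite_dim[of Pos n] by metis
  then show ?thesis by auto
qed

text \<open>The unit is the diagram of n vertical strings, that is, the empty list of
  layers.\<close>

sublocale alg: trace_star_algebra "scal Q" "V n" "ml n" "st n" "ac n []" "ptr h n" for n
proof (unfold_locales, goal_cases)
  case 1 show ?case by (rule V_sub)
next
  case 2 show ?case by (rule fin_dim)
next
  case 3 then show ?case by (rule mult_closed)
next
  case (4 x y z)
  have "ml n (ml n x y) z = ac n [(0, Box n x), (0, Box n y), (0, Box n z)]"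
    using 4 mult_ac[of n "[(0, Box n x), (0, Box n y)]" "[(0, Box n z)]"] by (simp add: mult_def ac_box)
  also have "\<dots> = ml n x (ml n y z)"
    using 4 mult_ac[of n "[(0, Box n x)]" "[(0, Box n y), (0, Box n z)]"] by (simp add: mult_def ac_box)
  finally show ?case .
next
  case (5 x y z)
  then show ?case using ac_box_add[of n n "[]" "[(0, Box n z)]" x y] by (simp add: mult_def)
next
  case (6 x y z)
  then show ?case using ac_box_add[of n n "[(0, Box n z)]" "[]" x y] by (simp add: mult_def)
next
  case (7 x y c)
  then show ?case using ac_box_scal[of n n "[]" "[(0, Box n y)]" x c] by (simp add: mult_def)
next
  case (8 x y c)
  then show ?case using ac_box_scal[of n n "[(0, Box n x)]" "[]" y c] by (simp add: mult_def)
next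
  case 9 show ?case by (rule ac_closed) simp
next
  case (10 x)
  then show ?case using mult_ac[of n "[]" "[(0, Box n x)]"] by (simp add: ac_box)
next
  case (11 x)
  then show ?case using mult_ac[of n "[(0, Box n x)]" "[]"] by (simp add: ac_box)
next
  case 12 then show ?case by (rule star_closed)
next
  case 13 then show ?case by (rule star_star)
next
  case (14 x y)
  then show ?case using star_antilinear[of x Pos n y 1] by simp
next
  case (15 x c)
  have "st n (0 + 0) = st n 0 + st n 0" using star_antilinear[of 0 Pos n 0 1] by simp
  then have "st n 0 = 0" by (simp only: add_0_left add_cancel_right_right)
  then show ?case using 15 star_antilinear[of x Pos n 0 c] by simp
next
  case (16 x y)
  then show ?case
    using star_ac[of n "[(0, Box n x), (0, Box n y)]"] by (simp add: mult_def relabel_def reflect_def)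
next
  case 17 then show ?case by (rule ptr_add)
next
  case 18 then show ?case by (rule ptr_scal)
next
  case 19 then show ?case by (rule ptr_mult)
next
  case 20 then show ?case by (intro ptr_mult_star_pos h_pos)
qed

text \<open>A layer records only the number of strings to its left, so the same list describes the
  diagram with a further string on the right.\<close>

lemma incl_ac: "tg n T n \<Longrightarrow> incl Q n (ac n T) = ac (Suc n) T"
  unfolding incl_def using ac_comp[of n T "Suc n" "[]" "[]"] ac_closed by simp

lemma incl_closed [simp]: "x \<in> V n \<Longrightarrow> incl Q n x \<in> V (Suc n)"
  unfolding incl_def by (rule ac_closed) simp

lemma incl_mult:
  assumes "x \<in> V n" "y \<in> V n"
  shows "incl Q n (ml n x y) = ml (Suc n) (incl Q n x) (incl Q n y)"
proof -
  have "incl Q n (ml n x y) = ac (Suc n) [(0, Box n x), (0, Box n y)]"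
    unfolding mult_def by (rule incl_ac) (use assms in simp)
  also have "\<dots> = ml (Suc n) (incl Q n x) (incl Q n y)"
    unfolding incl_def
    using mult_ac[of "Suc n" "[(0, Box n x)]" "[(0, Box n y)]"] assms by simp
  finally show ?thesis .
qed

lemma incl_star:
  assumes "x \<in> V n"
  shows "st (Suc n) (incl Q n x) = incl Q n (st n x)"
  unfolding incl_def
  using star_ac[of "Suc n" "[(0, Box n x)]"] assms by (simp add: relabel_def reflect_def)

lemma incl_scal: "x \<in> V n \<Longrightarrow> incl Q n (scal Q c x) = scal Q c (incl Q n x)"
  unfolding incl_def using ac_box_scal[of n "Suc n" "[]" "[]" x c] by simp

lemma incl_proj: "f \<in> alg.proj n \<Longrightarrow> incl Q n f \<in> alg.proj (Suc n)"
  by (simp add: alg.proj_def incl_star flip: incl_mult)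

section \<open>Conditional expectations and Jones elements\<close>

definition cond_exp :: "nat \<Rightarrow> 'q \<Rightarrow> 'q" where
  "cond_exp m x = ac m [(m, Cap), (0, Box (Suc m) x), (m, Cup)]"

text \<open>Neither \<open>cond_exp m\<close> nor \<open>jones m\<close> is normalised: both lack
  the usual factor 1 / \<delta>.\<close>

definition jones :: "nat \<Rightarrow> 'q" where
  "jones m = ac (Suc (Suc m)) [(m, Cup), (m, Cap)]"

lemma tg_cond_exp: "x \<in> V (Suc m) \<Longrightarrow> tg m [(m, Cap), (0, Box (Suc m) x), (m, Cup)] m"
  by simp

lemma tg_jones: "tg (Suc (Suc m)) [(m, Cup), (m, Cap)] (Suc (Suc m))"
  by simp

lemma cond_exp_closed [simp]: "x \<in> V (Suc m) \<Longrightarrow> cond_exp m x \<in> V m"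
  unfolding cond_exp_def by (rule ac_closed[OF tg_cond_exp])

lemma jones_closed [simp]: "jones m \<in> V (Suc (Suc m))"
  unfolding jones_def by (rule ac_closed[OF tg_jones])

lemma jones_star: "st (Suc (Suc m)) (jones m) = jones m"
  unfolding jones_def star_ac[OF tg_jones] by (simp add: relabel_def reflect_def)

lemma ac_move:
  assumes "move L R" "tg n (U @ L @ W) n" "tg n (U @ R @ W) n"
  shows "ac n (U @ L @ W) = ac n (U @ R @ W)"
proof (rule act_isotopic)
  show "isotopic (sp Q) Pos n (U @ L @ W) (U @ R @ W)"
    unfolding isotopic_def by (rule r_into_equivclp) (use assms in blast)
qed

lemma move_box_cap: "move [(0, Box m f), (m, Cap)] [(m, Cap), (0, Box m f)]"
  using exchange[of 0 "Box m f" 0 Cap] by simp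

lemma move_box_cup: "move [(0, Box m f), (m, Cup)] [(m, Cup), (0, Box m f)]"
  using exchange[of 0 "Box m f" 0 Cup] by simp

text \<open>The box f occupies the m strings to the left of the closed one, so it slides up past the
  maximum. For multiplication on the right it slides past the minimum instead.\<close>

lemma cond_exp_incl_left:
  assumes f: "f \<in> V m" and x: "x \<in> V (Suc m)"
  shows "cond_exp m (ml (Suc m) (incl Q m f) x) = ml m f (cond_exp m x)"
proof -
  let ?S = "[(0, Box m f), (0, Box (Suc m) x)]"
  have S: "tg (Suc m) ?S (Suc m)" using f x by simp
  have "ml (Suc m) (incl Q m f) x = ac (Suc m) ?S"
    using mult_ac[of "Suc m" "[(0, Box m f)]" "[(0, Box (Suc m) x)]"] f x
    by (simp add: ac_box incl_def)
  then have "cond_exp m (ml (Suc m) (incl Q m f) x) = ac m ([(m, Cap)] @ ?S @ [(m, Cup)])"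
    unfolding cond_exp_def using ac_comp[OF S, of m "[(m, Cap)]" "[(m, Cup)]"] ac_closed[OF S] by simp
  also have "\<dots> = ac m ([] @ [(0, Box m f), (m, Cap)] @ [(0, Box (Suc m) x), (m, Cup)])"
    using ac_move[OF move_box_cap, of m "[]" m f "[(0, Box (Suc m) x), (m, Cup)]"] f x by simp
  also have "\<dots> = ml m f (cond_exp m x)"
    unfolding cond_exp_def
    using mult_ac[of m "[(0, Box m f)]" "[(m, Cap), (0, Box (Suc m) x), (m, Cup)]"] f x
    by (simp add: ac_box)
  finally show ?thesis .
qed

lemma cond_exp_incl_right:
  assumes f: "f \<in> V m" and x: "x \<in> V (Suc m)"
  shows "cond_exp m (ml (Suc m) x (incl Q m f)) = ml m (cond_exp m x) f"
proof -
  let ?S = "[(0, Box (Suc m) x), (0, Box m f)]"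
  have S: "tg (Suc m) ?S (Suc m)" using f x by simp
  have "ml (Suc m) x (incl Q m f) = ac (Suc m) ?S"
    using mult_ac[of "Suc m" "[(0, Box (Suc m) x)]" "[(0, Box m f)]"] f x
    by (simp add: ac_box incl_def)
  then have "cond_exp m (ml (Suc m) x (incl Q m f)) = ac m ([(m, Cap)] @ ?S @ [(m, Cup)])"
    unfolding cond_exp_def using ac_comp[OF S, of m "[(m, Cap)]" "[(m, Cup)]"] ac_closed[OF S] by simp
  also have "\<dots> = ac m ([(m, Cap), (0, Box (Suc m) x)] @ [(m, Cup), (0, Box m f)] @ [])"
    using ac_move[OF move_box_cup, of m "[(m, Cap), (0, Box (Suc m) x)]" m f "[]"] f x by simp
  also have "\<dots> = ml m (cond_exp m x) f"
    unfolding cond_exp_def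
    using mult_ac[of m "[(m, Cap), (0, Box (Suc m) x), (m, Cup)]" "[(0, Box m f)]"] f x
    by (simp add: ac_box)
  finally show ?thesis .
qed

lemma jones_incl:
  assumes x: "x \<in> V (Suc m)"
  shows "ml (Suc (Suc m)) (jones m) (incl Q (Suc m) x) =
    ac (Suc (Suc m)) [(m, Cup), (m, Cap), (0, Box (Suc m) x)]"
  unfolding jones_def incl_def
  using mult_ac[of "Suc (Suc m)" "[(m, Cup), (m, Cap)]" "[(0, Box (Suc m) x)]"] x by simp

text \<open>The maximum of the upper \<open>jones m\<close> and the minimum of the lower one close
  the last string of x. What remains is \<open>cond_exp m x\<close> between a minimum and a maximum,
  and it slides up past the minimum.\<close>

lemma jones_incl_jones:
  assumes x: "x \<in> V (Suc m)"
  shows "ml (Suc (Suc m)) (ml (Suc (Suc m)) (jones m) (incl Q (Suc m) x)) (jones m) =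
    ml (Suc (Suc m)) (incl Q (Suc m) (incl Q m (cond_exp m x))) (jones m)"
proof -
  let ?T = "[(m, Cap), (0, Box (Suc m) x), (m, Cup)]"
  have y: "ac m ?T \<in> V m" using ac_closed[OF tg_cond_exp[OF x]] .
  have ii: "incl Q (Suc m) (incl Q m (ac m ?T)) = ac (Suc (Suc m)) [(0, Box m (ac m ?T))]"
    unfolding incl_def[of Q m] by (rule incl_ac) (use y in simp)
  have "ml (Suc (Suc m)) (ml (Suc (Suc m)) (jones m) (incl Q (Suc m) x)) (jones m) =
      ac (Suc (Suc m)) ([(m, Cup)] @ ?T @ [(m, Cap)])"
    unfolding jones_incl[OF x] unfolding jones_def
    using mult_ac[of "Suc (Suc m)" "[(m, Cup), (m, Cap), (0, Box (Suc m) x)]" "[(m, Cup), (m, Cap)]"] x by simp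
  also have "\<dots> = ac (Suc (Suc m)) ([(m, Cup)] @ [(0, Box m (ac m ?T))] @ [(m, Cap)])"
    by (rule ac_comp[OF tg_cond_exp[OF x], symmetric]) (use y in simp)
  also have "\<dots> = ac (Suc (Suc m)) ([] @ [(0, Box m (ac m ?T)), (m, Cup)] @ [(m, Cap)])"
    using ac_move[OF move_box_cup, of "Suc (Suc m)" "[]" m "ac m ?T" "[(m, Cap)]"] y by simp
  also have "\<dots> = ml (Suc (Suc m)) (incl Q (Suc m) (incl Q m (ac m ?T))) (jones m)"
    unfolding ii jones_def
    using mult_ac[of "Suc (Suc m)" "[(0, Box m (ac m ?T))]" "[(m, Cup), (m, Cap)]"] y by simp
  finally show ?thesis unfolding cond_exp_def .
qed

text \<open>The minimum of \<open>jones m\<close> is moved around the trace, from the top of the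
  diagram to the bottom, which lowers the level by two. This keeps the endpoint of the path and so
  works for every g.\<close>

lemma ptr_jones_incl:
  assumes x: "x \<in> V (Suc m)"
  shows "ptr g (Suc (Suc m)) (ml (Suc (Suc m)) (jones m) (incl Q (Suc m) x)) = ptr g m (cond_exp m x)"
proof -
  let ?X = "\<phi> Pos (Suc m) x"
  have t: "tg (Suc (Suc m)) [(m, Cup), (m, Cap), (0, Box (Suc m) x)] (Suc (Suc m))" using x by simp
  have "state_trace G v g (Suc (Suc m)) ([(m, Cup)] @ [(m, Cap), (0, Box (Suc m) ?X)]) =
      state_trace G v g m ([(m, Cap), (0, Box (Suc m) ?X)] @ [(m, Cup)])"
    by (rule state_trace_cyclic[OF bipartite]) simp_all
  then show ?thesis
    unfolding jones_incl[OF x] cond_exp_def ptr_ac[OF t] ptr_ac[OF tg_cond_exp[OF x]]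
    by (simp add: relabel_def)
qed

lemma ptr_cond_exp:
  assumes x: "x \<in> V (Suc m)"
  shows "ptr (vertex_weight G) m (cond_exp m x) = ptr (vertex_weight G) (Suc m) x"
proof -
  have "ptr (vertex_weight G) (Suc m) x =
      state_trace G v (vertex_weight G) (Suc m) [(0, Box (Suc m) (\<phi> Pos (Suc m) x))]"
    using ptr_ac[of "Suc m" "[(0, Box (Suc m) x)]"] x by (simp add: ac_box relabel_def)
  then show ?thesis
    unfolding cond_exp_def ptr_ac[OF tg_cond_exp[OF x]]
    using state_trace_cond_exp[OF weighted, of v m "\<phi> Pos (Suc m) x"] by (simp add: relabel_def)
qed

text \<open>A projection equals the product with its own adjoint, so its diagonal entries are
  nonnegative, and the inequality for h can be applied at the endpoint of each path
  separately.\<close>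

lemma ptr_incl_le:
  assumes f: "f \<in> alg.proj n"
  shows "Re (ptr h (Suc n) (incl Q n f)) \<le> r * Re (ptr h n f)"
proof -
  have fV: "f \<in> V n" using f alg.projD by blast
  define F where "F es = (\<Sum>\<tau>\<in>{\<tau> \<in> walks_from G v n. endpoint G (v, \<tau>) = endpoint G (v, es)}.
    (cmod (\<phi> Pos n f (v, es) (v, \<tau>)))\<^sup>2)" for es
  have F: "\<phi> Pos n f (v, es) (v, es) = complex_of_real (F es)" if "es \<in> walks_from G v n" for es
    using phi_mult_star[OF fV that] alg.projD(2,3)[OF f] by (simp add: F_def)
  have F0: "F es \<ge> 0" for es unfolding F_def by (intro sum_nonneg) simp
  have t: "tg (Suc n) [(0, Box n f)] (Suc n)" using fV by simp
  have "ptr h (Suc n) (incl Q n f) = (\<Sum>a\<in>walks_from G v n.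
      complex_of_real (\<Sum>c\<in>out_edges G (endpoint G (v, a)). h (tgt G c)) * \<phi> Pos n f (v, a) (v, a))"
    unfolding incl_def ptr_ac[OF t] using state_trace_incl[OF bipartite, of v h n "\<phi> Pos n f"]
    by (simp add: relabel_def)
  also have "\<dots> = complex_of_real (\<Sum>a\<in>walks_from G v n.
      (\<Sum>c\<in>out_edges G (endpoint G (v, a)). h (tgt G c)) * F a)"
    unfolding of_real_sum[of _ "walks_from G v n"] of_real_mult by (intro sum.cong refl) (simp only: F)
  finally have "Re (ptr h (Suc n) (incl Q n f)) = (\<Sum>a\<in>walks_from G v n.
      (\<Sum>c\<in>out_edges G (endpoint G (v, a)). h (tgt G c)) * F a)" by (simp only: Re_complex_of_real)
  also have "\<dots> \<le> (\<Sum>a\<in>walks_from G v n. r * h (endpoint G (v, a)) * F a)"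
    by (intro sum_mono mult_right_mono h_superharmonic end_verts F0)
  also have "\<dots> = r * Re (ptr h n f)"
  proof -
    have "ptr h n f = complex_of_real (\<Sum>a\<in>walks_from G v n. h (endpoint G (v, a)) * F a)"
      unfolding ptr_def of_real_sum of_real_mult by (intro sum.cong refl) (simp only: F)
    then have "Re (ptr h n f) = (\<Sum>a\<in>walks_from G v n. h (endpoint G (v, a)) * F a)"
      by (simp only: Re_complex_of_real)
    then show ?thesis by (simp add: sum_distrib_left mult.assoc)
  qed
  finally show ?thesis .
qed

section \<open>Bratteli multiplicities expressed by traces\<close>

lemma projections_eq: "projections Q n = alg.proj n"
  by (auto simp: projections_def alg.proj_def)

lemma central_projections_eq: "central_projections Q n = alg.cproj n"
  by (auto simp: central_projections_def alg.cproj_def projections_eq)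

lemma minimals_eq: "minimals Q n S = alg.minims n S"
  by (auto simp: minimals_def alg.minims_def)

lemmas minimals_simps = projections_eq central_projections_eq minimals_eq

abbreviation "mproj n \<equiv> alg.minims n (alg.proj n)"
abbreviation "mcent n \<equiv> alg.minims n (alg.cproj n)"

definition wt :: "nat \<Rightarrow> 'q \<Rightarrow> real" where
  "wt n p = Re (ptr h n (SOME f. f \<in> mproj n \<and> ml n f p = f))"

text \<open>All minimal projections below p are equivalent and have the same trace, so the choice in
  \<open>wt\<close> does not matter.\<close>

lemma wt_eq:
  assumes "p \<in> mcent n" "f \<in> mproj n" "ml n f p = f"
  shows "wt n p = Re (ptr h n f)"
proof -
  define f' where "f' = (SOME f. f \<in> mproj n \<and> ml n f p = f)"
  have "f' \<in> mproj n \<and> ml n f' p = f'" unfolding f'_def by (rule someI[of _ f]) (use assms in simp)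
  then have "ptr h n f' = ptr h n f" using alg.tr_minims_eq[OF assms(1) _ _ assms(2,3)] by blast
  then show ?thesis by (simp add: wt_def f'_def)
qed

lemma wt_pos:
  assumes "p \<in> mcent n"
  shows "wt n p > 0"
proof -
  obtain f where f: "f \<in> mproj n" "ml n f p = f" using alg.minims_below[OF assms] .
  show ?thesis unfolding wt_eq[OF assms f]
    by (rule alg.tr_proj(3)[OF alg.minims_projD(1)[OF f(1)] alg.minims_projD(5)[OF f(1)]])
qed

text \<open>The condition that \<open>bratteli_mult\<close> imposes on the witness S, for a fixed
  f.\<close>

definition decomp :: "nat \<Rightarrow> 'q \<Rightarrow> 'q \<Rightarrow> 'q set \<Rightarrow> bool" where
  "decomp n f q S \<longleftrightarrow> S \<subseteq> mproj (Suc n) \<and> finite S \<and> alg.orth (Suc n) S \<and>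
     ml (Suc n) (incl Q n f) q = \<Sum>S"

lemma decomp_exists:
  assumes "f \<in> alg.proj n" "q \<in> mcent (Suc n)"
  obtains S where "decomp n f q S"
proof -
  have "ml (Suc n) (incl Q n f) q \<in> alg.proj (Suc n)"
    by (rule alg.cproj_mul[OF alg.minims_cprojD(1)[OF assms(2)] incl_proj[OF assms(1)]])
  then obtain S where S: "finite S" "S \<subseteq> mproj (Suc n)" "alg.orth (Suc n) S"
    "\<Sum>S = ml (Suc n) (incl Q n f) q"
    by (rule alg.proj_decomp)
  have "decomp n f q S" unfolding decomp_def by (intro conjI S(1-3) S(4)[symmetric])
  then show thesis by (rule that)
qed

lemma decomp_below:
  assumes "decomp n f q S" "g \<in> S" "f \<in> V n" "q \<in> mcent (Suc n)"
  shows "g \<in> mproj (Suc n)" "ml (Suc n) g q = g" "ml (Suc n) (incl Q n f) g = g"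
    "ml (Suc n) g (incl Q n f) = g"
proof -
  let ?m = "ml (Suc n)" and ?i = "incl Q n f"
  have S: "S \<subseteq> mproj (Suc n)" "finite S" "alg.orth (Suc n) S" "?m ?i q = \<Sum>S"
    using assms(1) by (auto simp: decomp_def)
  show g: "g \<in> mproj (Suc n)" using S(1) assms(2) by blast
  have "S \<subseteq> alg.proj (Suc n)" by (rule subsetI) (rule alg.minims_projD(1)[OF subsetD[OF S(1)]])
  note sm = alg.orth_sum_mul[OF S(2) this S(3) assms(2), folded S(4)]
  note qD = alg.minims_cprojD[OF assms(4)]
  have iV: "?i \<in> V (Suc n)" using assms(3) by simp
  have gV: "g \<in> V (Suc n)" using alg.minims_projD(2)[OF g] .
  have gi: "?m g (?m ?i q) = g" "?m (?m ?i q) g = g" by (rule sm)+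
  have "?m g q = ?m (?m g (?m ?i q)) q" by (simp only: gi)
  also have "\<dots> = ?m g (?m ?i (?m q q))"
    by (simp only: alg.mul_assoc[OF gV alg.mul_closed[OF iV qD(3)] qD(3)] alg.mul_assoc[OF iV qD(3) qD(3)])
  also have "\<dots> = g" by (simp only: qD(4) gi)
  finally show gq: "?m g q = g" .
  have qg: "?m q g = g" by (simp only: gq qD(7)[OF gV])
  have "?m ?i g = ?m ?i (?m q g)" by (simp only: qg)
  also have "\<dots> = ?m (?m ?i q) g" by (rule alg.mul_assoc[OF iV qD(3) gV, symmetric])
  finally show "?m ?i g = g" by (simp only: gi)
  have "?m g ?i = ?m (?m g q) ?i" by (simp only: gq)
  also have "\<dots> = ?m g (?m q ?i)" by (rule alg.mul_assoc[OF gV qD(3) iV])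
  also have "\<dots> = ?m g (?m ?i q)" by (simp only: qD(7)[OF iV])
  finally show "?m g ?i = g" by (simp only: gi)
qed

text \<open>The members of S are minimal projections below q and have trace
  \<open>wt (Suc n) q\<close> each, so the trace counts them.\<close>

lemma decomp_card:
  assumes "decomp n f q S" "f \<in> V n" "q \<in> mcent (Suc n)"
  shows "Re (ptr h (Suc n) (ml (Suc n) (incl Q n f) q)) = real (card S) * wt (Suc n) q"
proof -
  have S: "S \<subseteq> mproj (Suc n)" "ml (Suc n) (incl Q n f) q = \<Sum>S"
    using assms(1) by (auto simp: decomp_def)
  have "ptr h (Suc n) (\<Sum>S) = (\<Sum>g\<in>S. ptr h (Suc n) g)"
    by (rule alg.tr_sum) (rule alg.minims_projD(2)[OF subsetD[OF S(1)]])
  moreover have "Re (ptr h (Suc n) g) = wt (Suc n) q" if "g \<in> S" for g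
    using wt_eq[OF assms(3)] decomp_below[OF assms(1) that assms(2,3)] by simp
  ultimately show ?thesis by (simp add: S(2))
qed

text \<open>Uniqueness behind the \<open>THE\<close>: two choices of f are linked by a partial
  isometry, whose inclusion shows that their products with q have equal trace. By
  \<open>decomp_card\<close> the trace determines the number of summands, as \<open>wt\<close> is
  positive.\<close>

lemma bratteli_mult_eq:
  assumes p: "p \<in> mcent n" and q: "q \<in> mcent (Suc n)"
    and f: "f \<in> mproj n" "ml n f p = f" and S: "decomp n f q S"
  shows "bratteli_mult Q n p q = card S"
  unfolding bratteli_mult_def minimals_simps
proof (rule the_equality)
  show "\<exists>f S'. f \<in> mproj n \<and> ml n f p = f \<and> S' \<subseteq> mproj (Suc n) \<and> finite S' \<and> card S' = card S \<and>
      (\<forall>g\<in>S'. \<forall>h\<in>S'. g \<noteq> h \<longrightarrow> ml (Suc n) g h = 0) \<and> ml (Suc n) (incl Q n f) q = \<Sum>S'"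
    by (rule exI[of _ f], rule exI[of _ S]) (use f S in \<open>simp add: decomp_def alg.orth_def\<close>)
next
  fix k
  assume "\<exists>f S'. f \<in> mproj n \<and> ml n f p = f \<and> S' \<subseteq> mproj (Suc n) \<and> finite S' \<and> card S' = k \<and>
      (\<forall>g\<in>S'. \<forall>h\<in>S'. g \<noteq> h \<longrightarrow> ml (Suc n) g h = 0) \<and> ml (Suc n) (incl Q n f) q = \<Sum>S'"
  then obtain f' S' where fS: "f' \<in> mproj n \<and> ml n f' p = f' \<and> S' \<subseteq> mproj (Suc n) \<and> finite S' \<and> card S' = k \<and>
      (\<forall>g\<in>S'. \<forall>h\<in>S'. g \<noteq> h \<longrightarrow> ml (Suc n) g h = 0) \<and> ml (Suc n) (incl Q n f') q = \<Sum>S'"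
    by (elim exE)
  then have f': "f' \<in> mproj n" "ml n f' p = f'" and S': "decomp n f' q S'" "card S' = k"
    by (simp_all add: decomp_def alg.orth_def)
  let ?m = "ml (Suc n)"
  note qD = alg.minims_cprojD[OF q]
  obtain u where u: "u \<in> V n" "ml n u (st n u) = f" "ml n (st n u) u = f'"
    "ml n f u = u" "ml n u f' = u"
    by (rule alg.minims_proj_equiv[OF p f f'])
  define i where "i = incl Q n u"
  have i: "i \<in> V (Suc n)" using u by (simp add: i_def)
  have i1: "incl Q n f = ?m i (st (Suc n) i)" "incl Q n f' = ?m (st (Suc n) i) i"
    using u by (auto simp: i_def incl_star simp flip: incl_mult)
  have "?m (incl Q n f) q = ?m i (?m (st (Suc n) i) q)"
    using i qD(3) by (simp add: i1 alg.mul_assoc)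
  then have "ptr h (Suc n) (?m (incl Q n f) q) = ptr h (Suc n) (?m (?m (st (Suc n) i) q) i)"
    using i qD(3) alg.tr_mul[of i "Suc n" "?m (st (Suc n) i) q"] by simp
  also have "?m (?m (st (Suc n) i) q) i = ?m (incl Q n f') q"
    unfolding i1(2) using i qD(3) alg.mul_assoc[of "st (Suc n) i" "Suc n" q i]
      alg.mul_assoc[of "st (Suc n) i" "Suc n" i q] by (simp only: qD(7)[OF i] alg.st_closed)
  finally have "real (card S) * wt (Suc n) q = real (card S') * wt (Suc n) q"
    unfolding decomp_card[OF S alg.minims_projD(2)[OF f(1)] q, symmetric]
      decomp_card[OF S'(1) alg.minims_projD(2)[OF f'(1)] q, symmetric] by (rule arg_cong)
  then show "k = card S" using wt_pos[OF q] S'(2) by simp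
qed

lemma bratteli_mult_trace:
  assumes p: "p \<in> mcent n" and q: "q \<in> mcent (Suc n)"
    and f: "f \<in> mproj n" "ml n f p = f"
  shows "real (bratteli_mult Q n p q) * wt (Suc n) q = Re (ptr h (Suc n) (ml (Suc n) (incl Q n f) q))"
proof -
  have fp: "f \<in> alg.proj n" "f \<in> V n" using alg.minims_projD[OF f(1)] by auto
  obtain S where S: "decomp n f q S" using decomp_exists[OF fp(1) q] by blast
  show ?thesis using decomp_card[OF S fp(2) q] bratteli_mult_eq[OF p q f S] by simp
qed

section \<open>Frobenius reciprocity and the edges that go down\<close>

lemma cond_exp_corner:
  assumes f: "f \<in> V m" "f' \<in> V m" and u: "u \<in> V (Suc m)" "u' \<in> V (Suc m)"
    and uf: "ml (Suc m) u (incl Q m f) = u" "ml (Suc m) u' (incl Q m f') = u'" and sf: "st m f = f"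
  shows "cond_exp m (ml (Suc m) (st (Suc m) u) u') =
    ml m f (ml m (cond_exp m (ml (Suc m) (st (Suc m) u) u')) f')"
proof -
  let ?m = "ml (Suc m)" and ?i = "incl Q m f" and ?i' = "incl Q m f'"
  let ?z = "?m (st (Suc m) u) u'"
  have V: "?i \<in> V (Suc m)" "?i' \<in> V (Suc m)" "st (Suc m) u \<in> V (Suc m)" "?z \<in> V (Suc m)"
    using f u by simp_all
  have "st (Suc m) u = st (Suc m) (?m u ?i)" by (simp only: uf)
  also have "\<dots> = ?m ?i (st (Suc m) u)" by (simp only: alg.st_mul[OF u(1) V(1)] incl_star[OF f(1)] sf)
  finally have "?z = ?m (?m ?i (st (Suc m) u)) (?m u' ?i')" using uf(2) by simp
  also have "\<dots> = ?m ?i (?m ?z ?i')" using V u by (simp add: alg.mul_assoc)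
  finally have "cond_exp m ?z = cond_exp m (?m ?i (?m ?z ?i'))" by (rule arg_cong)
  also have "\<dots> = ml m f (ml m (cond_exp m ?z) f')"
    using cond_exp_incl_left[OF f(1), of "?m ?z ?i'"] cond_exp_incl_right[OF f(2) V(4)] V by simp
  finally show ?thesis .
qed

text \<open>Frobenius reciprocity turns \<open>u = u (f \<otimes> 1)\<close> at level \<open>m + 1\<close> into a morphism from \<open>f\<close> at level
  \<open>m\<close> to level \<open>m + 2\<close>.  For a partial isometry \<open>u\<close> and a minimal projection \<open>f\<close>, its range
  projection is a multiple of \<open>bend m u\<close>.\<close>

definition bend :: "nat \<Rightarrow> 'q \<Rightarrow> 'q" where
  "bend m u = ml (Suc (Suc m)) (ml (Suc (Suc m)) (incl Q (Suc m) u) (jones m))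
     (incl Q (Suc m) (st (Suc m) u))"

lemma bend_closed [simp]: "u \<in> V (Suc m) \<Longrightarrow> bend m u \<in> V (Suc (Suc m))"
  by (simp add: bend_def)

lemma bend_star: "u \<in> V (Suc m) \<Longrightarrow> st (Suc (Suc m)) (bend m u) = bend m u"
  by (simp add: bend_def alg.st_mul incl_star jones_star alg.mul_assoc)

text \<open>In the middle of the product, st u u' stands between two copies of
  \<open>jones m\<close>, and \<open>jones_incl_jones\<close> replaces this by its conditional
  expectation. Squares and orthogonality of the elements \<open>bend m u\<close> are thereby decided
  at level m.\<close>

lemma bend_mult:
  assumes u: "u \<in> V (Suc m)" "u' \<in> V (Suc m)"
  shows "ml (Suc (Suc m)) (bend m u) (bend m u') =
    ml (Suc (Suc m)) (ml (Suc (Suc m)) (incl Q (Suc m) (ml (Suc m) u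
      (incl Q m (cond_exp m (ml (Suc m) (st (Suc m) u) u'))))) (jones m)) (incl Q (Suc m) (st (Suc m) u'))"
proof -
  let ?m = "ml (Suc (Suc m))" and ?e = "jones m" and ?i = "incl Q (Suc m)"
  let ?s = "st (Suc m)"
  define z where "z = incl Q m (cond_exp m (ml (Suc m) (?s u) u'))"
  have z: "z \<in> V (Suc m)" using u by (simp add: z_def)
  have V: "?i u \<in> V (Suc (Suc m))" "?i u' \<in> V (Suc (Suc m))" "?i (?s u) \<in> V (Suc (Suc m))"
    "?i (?s u') \<in> V (Suc (Suc m))" "?i z \<in> V (Suc (Suc m))" using u z by simp_all
  have "?m (?m ?e (?m (?i (?s u)) (?i u'))) ?e = ?m (?i z) ?e"
    using jones_incl_jones[of "ml (Suc m) (?s u) u'" m] u by (simp add: z_def incl_mult)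
  then have "?m (?m (?m ?e (?m (?i (?s u)) (?i u'))) ?e) (?i (?s u')) = ?m (?m (?i z) ?e) (?i (?s u'))"
    by simp
  then have key: "?m ?e (?m (?i (?s u)) (?m (?i u') (?m ?e (?i (?s u'))))) = ?m (?i z) (?m ?e (?i (?s u')))"
    using V by (simp add: alg.mul_assoc)
  have "?m (bend m u) (bend m u') =
      ?m (?i u) (?m ?e (?m (?i (?s u)) (?m (?i u') (?m ?e (?i (?s u'))))))"
    using V unfolding bend_def by (simp add: alg.mul_assoc)
  also have "\<dots> = ?m (?m (?m (?i u) (?i z)) ?e) (?i (?s u'))"
    unfolding key using V by (simp add: alg.mul_assoc)
  also have "?m (?i u) (?i z) = ?i (ml (Suc m) u z)" using incl_mult[OF u(1) z] by simp
  finally show ?thesis unfolding z_def .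
qed

text \<open>By cyclicity u moves to the other side of \<open>jones m\<close>, and
  \<open>ptr_jones_incl\<close> applies to st u u.\<close>

lemma ptr_bend:
  assumes u: "u \<in> V (Suc m)"
  shows "ptr h (Suc (Suc m)) (bend m u) = ptr h m (cond_exp m (ml (Suc m) (st (Suc m) u) u))"
proof -
  let ?m = "ml (Suc (Suc m))" and ?e = "jones m" and ?i = "incl Q (Suc m)"
  let ?s = "st (Suc m)"
  have V: "?i u \<in> V (Suc (Suc m))" "?i (?s u) \<in> V (Suc (Suc m))" "ml (Suc m) (?s u) u \<in> V (Suc m)"
    using u by simp_all
  have "bend m u = ?m (?i u) (?m ?e (?i (?s u)))"
    unfolding bend_def by (rule alg.mul_assoc) (use V in simp_all)
  then have "ptr h (Suc (Suc m)) (bend m u) = ptr h (Suc (Suc m)) (?m (?m ?e (?i (?s u))) (?i u))"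
    using V alg.tr_mul[of "?i u" "Suc (Suc m)" "?m ?e (?i (?s u))"] by simp
  also have "?m (?m ?e (?i (?s u))) (?i u) = ?m ?e (?i (ml (Suc m) (?s u) u))"
    using V u by (simp add: alg.mul_assoc incl_mult)
  finally show ?thesis using ptr_jones_incl[OF V(3)] by simp
qed

lemma ptr_weight_pos:
  assumes "f \<in> alg.proj n" "f \<noteq> 0"
  obtains s where "s > 0" "ptr (vertex_weight G) n f = complex_of_real s"
proof -
  have "vertex_weight G w > 0" if "w \<in> verts G" for w
    using vertex_weight_exists[OF weighted] that unfolding is_vertex_weight_def by blast
  from ptr_mult_star_pos[of "vertex_weight G", OF this alg.projD(1)[OF assms(1)] assms(2)]
  show thesis using that alg.projD[OF assms(1)] by auto
qed

text \<open>By the bimodule property the element lies in the corner of f at level m, which consists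
  of scalars because f is minimal.\<close>

lemma cond_exp_scalar:
  assumes f: "f \<in> mproj m"
    and u: "u \<in> V (Suc m)" "ml (Suc m) u (incl Q m f) = u"
      "u' \<in> V (Suc m)" "ml (Suc m) u' (incl Q m f) = u'"
  obtains c where "cond_exp m (ml (Suc m) (st (Suc m) u) u') = scal Q c f"
proof -
  note fD = alg.minims_projD[OF f]
  define E where "E = cond_exp m (ml (Suc m) (st (Suc m) u) u')"
  have E: "E \<in> V m" using u by (simp add: E_def)
  have corner: "E = ml m f (ml m E f)"
    unfolding E_def by (rule cond_exp_corner[OF fD(2) fD(2) u(1) u(3) u(2) u(4) fD(4)])
  have l: "ml m f E = E"
  proof -
    have "ml m f E = ml m f (ml m f (ml m E f))" by (simp only: corner[symmetric])
    also have "\<dots> = ml m (ml m f f) (ml m E f)"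
      by (rule alg.mul_assoc[symmetric]) (use fD(2) E in simp_all)
    finally show ?thesis by (simp only: fD(3) corner[symmetric])
  qed
  have r: "ml m E f = E"
  proof -
    have "ml m E f = ml m (ml m f (ml m E f)) f" by (simp only: corner[symmetric])
    also have "\<dots> = ml m f (ml m E (ml m f f))" using fD(2) E by (simp add: alg.mul_assoc)
    finally show ?thesis by (simp only: fD(3) corner[symmetric])
  qed
  obtain c where "E = scal Q c f" using alg.minims_proj_corner[OF f E l r] .
  then show thesis unfolding E_def by (rule that)
qed

text \<open>The scalar is the quotient of the traces of g and f for the weight
  \<open>vertex_weight G\<close>: this trace is preserved by \<open>cond_exp\<close> and positive on
  nonzero projections.\<close>

lemma cond_exp_min_proj:
  assumes f: "f \<in> mproj m" and g: "g \<in> mproj (Suc m)"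
    and u: "u \<in> V (Suc m)" "ml (Suc m) (st (Suc m) u) u = g" "ml (Suc m) u (incl Q m f) = u"
  obtains c where "c > 0" "cond_exp m g = scal Q (complex_of_real c) f"
proof -
  note fD = alg.minims_projD[OF f] and gD = alg.minims_projD[OF g]
  obtain c where c: "cond_exp m g = scal Q c f"
    by (rule cond_exp_scalar[OF f u(1) u(3) u(1) u(3), unfolded u(2)])
  obtain s where s: "s > 0" "ptr (vertex_weight G) m f = complex_of_real s"
    by (rule ptr_weight_pos[OF fD(1) fD(5)])
  obtain t where t: "t > 0" "ptr (vertex_weight G) (Suc m) g = complex_of_real t"
    by (rule ptr_weight_pos[OF gD(1) gD(5)])
  have "c * complex_of_real s = complex_of_real t"
    using ptr_cond_exp[OF gD(2)] unfolding c ptr_scal[OF fD(2)] s(2) t(2) .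
  then have "c = complex_of_real (t / s)" using s(1) by (simp add: field_simps)
  then show thesis using that[of "t / s"] c s(1) t(1) by simp
qed

text \<open>The element lies between f1 and f2, hence between the central projections p1 and p2,
  which are orthogonal.\<close>

lemma cond_exp_orth:
  assumes p: "p1 \<in> mcent m" "p2 \<in> mcent m" "p1 \<noteq> p2"
    and f: "f1 \<in> mproj m" "ml m f1 p1 = f1" "f2 \<in> mproj m" "ml m f2 p2 = f2"
    and u: "u \<in> V (Suc m)" "ml (Suc m) u (incl Q m f1) = u"
      "u' \<in> V (Suc m)" "ml (Suc m) u' (incl Q m f2) = u'"
  shows "cond_exp m (ml (Suc m) (st (Suc m) u) u') = 0"
proof -
  note f1 = alg.minims_projD[OF f(1)] and f2 = alg.minims_projD[OF f(3)]
  note p1 = alg.minims_cprojD[OF p(1)] and p2 = alg.minims_cprojD[OF p(2)]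
  define E where "E = cond_exp m (ml (Suc m) (st (Suc m) u) u')"
  have E: "E \<in> V m" using u by (simp add: E_def)
  have "E = ml m f1 (ml m E f2)"
    unfolding E_def by (rule cond_exp_corner[OF f1(2) f2(2) u(1) u(3) u(2) u(4) f1(4)])
  also have "\<dots> = ml m (ml m f1 p1) (ml m E (ml m f2 p2))" by (simp only: f)
  also have "\<dots> = ml m f1 (ml m (ml m p1 (ml m E f2)) p2)"
    using f1(2) f2(2) p1(3) p2(3) E by (simp add: alg.mul_assoc)
  also have "ml m (ml m p1 (ml m E f2)) p2 = ml m p2 (ml m p1 (ml m E f2))"
    by (rule p2(7)[symmetric]) (use f2(2) p1(3) E in simp)
  also have "\<dots> = ml m (ml m p2 p1) (ml m E f2)"
    by (rule alg.mul_assoc[symmetric]) (use f2(2) p1(3) p2(3) E in simp_all)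
  also have "ml m p2 p1 = 0" by (rule alg.minims_cproj_orth[OF p(2,1)]) (use p(3) in simp)
  finally show ?thesis using f1(2) f2(2) E by (simp add: E_def)
qed

text \<open>The element is a multiple of f. For the weight \<open>vertex_weight G\<close> its trace
  is that of st u u', hence that of u' st u = 0, whereas the trace of f is positive.\<close>

lemma cond_exp_orth_same:
  assumes f: "f \<in> mproj m"
    and u: "u \<in> V (Suc m)" "ml (Suc m) u (incl Q m f) = u"
      "u' \<in> V (Suc m)" "ml (Suc m) u' (incl Q m f) = u'" and o: "ml (Suc m) u' (st (Suc m) u) = 0"
  shows "cond_exp m (ml (Suc m) (st (Suc m) u) u') = 0"
proof -
  note fD = alg.minims_projD[OF f]
  let ?z = "ml (Suc m) (st (Suc m) u) u'"
  have z: "?z \<in> V (Suc m)" using u by simp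
  obtain c where c: "cond_exp m ?z = scal Q c f" by (rule cond_exp_scalar[OF f u])
  obtain s where s: "s > 0" "ptr (vertex_weight G) m f = complex_of_real s"
    by (rule ptr_weight_pos[OF fD(1) fD(5)])
  have "ptr (vertex_weight G) m (cond_exp m ?z) = ptr (vertex_weight G) (Suc m) (ml (Suc m) u' (st (Suc m) u))"
    unfolding ptr_cond_exp[OF z] by (rule ptr_mult) (use u in simp_all)
  also have "\<dots> = 0" unfolding o using ptr_scal[of 0 "Suc m" "vertex_weight G" 0] by simp
  finally have "c * complex_of_real s = 0" unfolding c ptr_scal[OF fD(2)] s(2) .
  then show ?thesis using s(1) c by simp
qed

text \<open>Let k q be a minimal projection below q at level m. An edge between q and p is
  represented by a summand g of k q with a string added, cut by p. A partial isometry u from g to f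
  bends it into a projection below f with a string added, which lies in the Jones ideal and has the
  trace of k q. The index set consists of the pairs (q, g).\<close>

lemma down_projections:
  assumes p: "p \<in> mcent (Suc m)" and f: "f \<in> mproj (Suc m)" "ml (Suc m) f p = f"
    and F: "F \<subseteq> mcent m"
  obtains D :: "('q \<times> 'q) set" and P where "finite D"
    "\<And>i. i \<in> D \<Longrightarrow> P i \<in> alg.proj (Suc (Suc m))"
    "\<And>i. i \<in> D \<Longrightarrow> ml (Suc (Suc m)) (P i) (incl Q (Suc m) f) = P i"
    "\<And>i j. i \<in> D \<Longrightarrow> j \<in> D \<Longrightarrow> i \<noteq> j \<Longrightarrow> ml (Suc (Suc m)) (P i) (P j) = 0"
    "\<And>i q. i \<in> D \<Longrightarrow> q \<in> mcent (Suc (Suc m)) \<Longrightarrow> ml (Suc (Suc m)) q (jones m) = 0 \<Longrightarrow>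
       ml (Suc (Suc m)) q (P i) = 0"
    "(\<Sum>i\<in>D. Re (ptr h (Suc (Suc m)) (P i))) = (\<Sum>q\<in>F. real (bratteli_mult Q m q p) * wt m q)"
proof -
  let ?m = "ml (Suc (Suc m))" and ?s = "st (Suc m)" and ?i = "incl Q (Suc m)"
  have finF: "finite F" using F alg.finite_minims_cproj finite_subset by metis
  note pD = alg.minims_cprojD[OF p] and fD = alg.minims_projD[OF f(1)]
  have "\<forall>q\<in>F. \<exists>k. k \<in> mproj m \<and> ml m k q = k"
    using F alg.minims_below by (metis subsetD)
  then obtain k where k: "\<And>q. q \<in> F \<Longrightarrow> k q \<in> mproj m" "\<And>q. q \<in> F \<Longrightarrow> ml m (k q) q = k q"
    by metis
  have "\<forall>q\<in>F. \<exists>S. decomp m (k q) p S"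
    using decomp_exists[OF alg.minims_projD(1)[OF k(1)] p] by metis
  then obtain S where S: "\<And>q. q \<in> F \<Longrightarrow> decomp m (k q) p (S q)" by metis
  have kV: "k q \<in> V m" if "q \<in> F" for q using alg.minims_projD(2)[OF k(1)[OF that]] .
  define D where "D = Sigma F S"
  have g: "snd i \<in> mproj (Suc m)" "ml (Suc m) (snd i) p = snd i"
    "ml (Suc m) (snd i) (incl Q m (k (fst i))) = snd i" if "i \<in> D" for i
    using decomp_below[OF S _ kV p, of "fst i" "snd i"] that by (auto simp: D_def)
  have k': "k (fst i) \<in> mproj m" "ml m (k (fst i)) (fst i) = k (fst i)" "fst i \<in> mcent m" if "i \<in> D" for i
    using k that F by (auto simp: D_def)
  \<comment> \<open>The direction matters: the range f places \<open>bend m u\<close> below f with a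
    string added, and the support g ties u to k q at level m.\<close>
  have "\<forall>i\<in>D. \<exists>u. u \<in> V (Suc m) \<and> ml (Suc m) u (?s u) = f \<and> ml (Suc m) (?s u) u = snd i \<and>
      ml (Suc m) f u = u \<and> ml (Suc m) u (snd i) = u"
  proof
    fix i assume i: "i \<in> D"
    show "\<exists>u. u \<in> V (Suc m) \<and> ml (Suc m) u (?s u) = f \<and> ml (Suc m) (?s u) u = snd i \<and>
      ml (Suc m) f u = u \<and> ml (Suc m) u (snd i) = u"
      by (rule alg.minims_proj_equiv[OF p f g(1,2)[OF i]]) blast
  qed
  then obtain U where U: "\<And>i. i \<in> D \<Longrightarrow> U i \<in> V (Suc m) \<and> ml (Suc m) (U i) (?s (U i)) = f \<and>
      ml (Suc m) (?s (U i)) (U i) = snd i \<and> ml (Suc m) f (U i) = U i \<and> ml (Suc m) (U i) (snd i) = U i"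
    by metis
  have u: "U i \<in> V (Suc m)" "ml (Suc m) (?s (U i)) (U i) = snd i" "ml (Suc m) f (U i) = U i"
    "ml (Suc m) (U i) (snd i) = U i" if "i \<in> D" for i using U[OF that] by simp_all
  have uk: "ml (Suc m) (U i) (incl Q m (k (fst i))) = U i" if i: "i \<in> D" for i
  proof -
    have "ml (Suc m) (ml (Suc m) (U i) (snd i)) (incl Q m (k (fst i))) =
        ml (Suc m) (U i) (ml (Suc m) (snd i) (incl Q m (k (fst i))))"
      by (rule alg.mul_assoc[OF u(1)[OF i] alg.minims_projD(2)[OF g(1)[OF i]]])
        (use alg.minims_projD(2)[OF k'(1)[OF i]] in simp)
    then show ?thesis by (simp only: g(3)[OF i] u(4)[OF i])
  qed
  have "\<forall>i\<in>D. \<exists>c. c > 0 \<and> cond_exp m (snd i) = scal Q (complex_of_real c) (k (fst i))"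
    using cond_exp_min_proj[OF k'(1) g(1) u(1,2) uk] by metis
  then obtain c where c: "\<And>i. i \<in> D \<Longrightarrow> c i > 0"
    "\<And>i. i \<in> D \<Longrightarrow> cond_exp m (snd i) = scal Q (complex_of_real (c i)) (k (fst i))" by metis
  \<comment> \<open>The square of \<open>bend m (U i)\<close> is c i times itself, whence the factor
    1 / c i.\<close>
  define P where "P i = scal Q (complex_of_real (1 / c i)) (bend m (U i))" for i
  have PV: "P i \<in> V (Suc (Suc m))" if "i \<in> D" for i using u(1)[OF that] by (simp add: P_def)
  have bb: "?m (bend m (U i)) (bend m (U i)) = scal Q (complex_of_real (c i)) (bend m (U i))"
    if i: "i \<in> D" for i
  proof -
    have kV': "k (fst i) \<in> V m" using alg.minims_projD(2)[OF k'(1)[OF i]] .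
    have "ml (Suc m) (U i) (incl Q m (cond_exp m (snd i))) = scal Q (complex_of_real (c i)) (U i)"
      unfolding c(2)[OF i] incl_scal[OF kV'] using u(1)[OF i] kV' uk[OF i] by (simp add: alg.mul_scl)
    then show ?thesis
      unfolding bend_mult[OF u(1)[OF i] u(1)[OF i]] u(2)[OF i] unfolding bend_def
      using u(1)[OF i] by (simp add: incl_scal alg.scl_mul)
  qed
  show thesis
  proof (rule that[of D P])
    show "finite D" unfolding D_def using finF S by (auto simp: decomp_def)
  next
    fix i assume i: "i \<in> D"
    have c0: "complex_of_real (c i) \<noteq> 0" using c(1)[OF i] by simp
    have bV: "bend m (U i) \<in> V (Suc (Suc m))" using u(1)[OF i] by simp
    have "?m (P i) (P i) = P i"
      unfolding P_def using bV c0 by (simp add: alg.scl_mul alg.mul_scl bb[OF i])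
    moreover have "st (Suc (Suc m)) (P i) = P i"
      unfolding P_def using bV by (simp add: alg.st_scl bend_star[OF u(1)[OF i]])
    ultimately show "P i \<in> alg.proj (Suc (Suc m))" using PV[OF i] by (simp add: alg.proj_def)
    have "?m (bend m (U i)) (?i f) = bend m (U i)"
    proof -
      have "?s (U i) = ?s (ml (Suc m) f (U i))" by (simp only: u(3)[OF i])
      also have "\<dots> = ml (Suc m) (?s (U i)) f"
        by (simp only: alg.st_mul[OF fD(2) u(1)[OF i]] fD(4))
      finally have "?i (?s (U i)) = ?m (?i (?s (U i))) (?i f)"
        using incl_mult[of "?s (U i)" "Suc m" f] u(1)[OF i] fD(2) by simp
      then show ?thesis
        unfolding bend_def using u(1)[OF i] fD(2) by (simp add: alg.mul_assoc)
    qed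
    then show "?m (P i) (?i f) = P i"
      unfolding P_def using bV fD(2) by (simp add: alg.scl_mul)
  next
    fix i j assume i: "i \<in> D" and j: "j \<in> D" and ij: "i \<noteq> j"
    have "cond_exp m (ml (Suc m) (?s (U i)) (U j)) = 0"
    \<comment> \<open>Different q are separated by their centres at level m; for equal q the
      orthogonality comes from two different summands of one decomposition.\<close>
    proof (cases "fst i = fst j")
      case False
      show ?thesis
        by (rule cond_exp_orth[OF k'(3)[OF i] k'(3)[OF j] False k'(1,2)[OF i] k'(1,2)[OF j]
          u(1)[OF i] uk[OF i] u(1)[OF j] uk[OF j]])
    next
      case True
      have ne: "snd j \<noteq> snd i" using ij True by (metis prod.expand)
      have gg: "ml (Suc m) (snd j) (snd i) = 0"
        using S[of "fst i"] i j ne True by (auto simp: decomp_def alg.orth_def D_def)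
      have giV: "snd i \<in> V (Suc m)" "st (Suc m) (snd i) = snd i" and gjV: "snd j \<in> V (Suc m)"
        using alg.minims_projD(2,4)[OF g(1)[OF i]] alg.minims_projD(2)[OF g(1)[OF j]] by auto
      have "?s (U i) = ?s (ml (Suc m) (U i) (snd i))" by (simp only: u(4)[OF i])
      also have "\<dots> = ml (Suc m) (snd i) (?s (U i))"
        by (simp only: alg.st_mul[OF u(1)[OF i] giV(1)] giV(2))
      finally have "ml (Suc m) (U j) (?s (U i)) =
          ml (Suc m) (ml (Suc m) (U j) (snd j)) (ml (Suc m) (snd i) (?s (U i)))"
        by (simp only: u(4)[OF j])
      also have "\<dots> = ml (Suc m) (U j) (ml (Suc m) (ml (Suc m) (snd j) (snd i)) (?s (U i)))"
        using u(1)[OF i] u(1)[OF j] giV gjV by (simp add: alg.mul_assoc)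
      also have "\<dots> = 0" using gg u(1)[OF i] u(1)[OF j] by simp
      finally have o: "ml (Suc m) (U j) (?s (U i)) = 0" .
      show ?thesis
        by (rule cond_exp_orth_same[OF k'(1)[OF i] u(1)[OF i] uk[OF i] u(1)[OF j] _ o])
          (use uk[OF j] True in simp)
    qed
    then have "?m (bend m (U i)) (bend m (U j)) = 0"
      unfolding bend_mult[OF u(1)[OF i] u(1)[OF j]]
      using u(1)[OF i] u(1)[OF j] incl_scal[of 0 m 0] incl_scal[of 0 "Suc m" 0] by simp
    then show "?m (P i) (P j) = 0"
      unfolding P_def using u(1)[OF i] u(1)[OF j] by (simp add: alg.scl_mul alg.mul_scl)
  next
    fix i q assume i: "i \<in> D" and q: "q \<in> mcent (Suc (Suc m))" "?m q (jones m) = 0"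
    note qD = alg.minims_cprojD[OF q(1)]
    have iV: "?i (U i) \<in> V (Suc (Suc m))" "?i (?s (U i)) \<in> V (Suc (Suc m))" using u(1)[OF i] by simp_all
    \<comment> \<open>\<open>bend\<close> has \<open>jones m\<close> as a factor, and the central q
      can be moved next to it.\<close>
    have "?m q (bend m (U i)) = ?m (?m (?m q (?i (U i))) (jones m)) (?i (?s (U i)))"
      unfolding bend_def using iV qD(3) by (simp add: alg.mul_assoc)
    also have "?m q (?i (U i)) = ?m (?i (U i)) q" by (rule qD(7)[OF iV(1)])
    also have "?m (?m (?i (U i)) q) (jones m) = ?m (?i (U i)) (?m q (jones m))"
      by (rule alg.mul_assoc) (use iV qD(3) in simp_all)
    finally have "?m q (bend m (U i)) = 0" using iV q(2) by simp
    then show "?m q (P i) = 0"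
      unfolding P_def using u(1)[OF i] qD(3) by (simp add: alg.mul_scl)
  next
    have trP: "Re (ptr h (Suc (Suc m)) (P i)) = wt m (fst i)" if i: "i \<in> D" for i
    proof -
      have kV': "k (fst i) \<in> V m" using alg.minims_projD(2)[OF k'(1)[OF i]] .
      have bV: "bend m (U i) \<in> V (Suc (Suc m))" using u(1)[OF i] by simp
      \<comment> \<open>The conditional expectation of g supplies a factor c i, which cancels the
        normalisation of \<open>P i\<close>.\<close>
      have "ptr h (Suc (Suc m)) (bend m (U i)) = complex_of_real (c i) * ptr h m (k (fst i))"
        unfolding ptr_bend[OF u(1)[OF i]] u(2)[OF i] c(2)[OF i] by (rule ptr_scal[OF kV'])
      then have "ptr h (Suc (Suc m)) (P i) = ptr h m (k (fst i))"
        unfolding P_def ptr_scal[OF bV] using c(1)[OF i] by simp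
      then show ?thesis using wt_eq[OF k'(3)[OF i] k'(1,2)[OF i]] by simp
    qed
    have "(\<Sum>i\<in>D. Re (ptr h (Suc (Suc m)) (P i))) = (\<Sum>i\<in>D. wt m (fst i))"
      using trP by (rule sum.cong[OF refl])
    also have "\<dots> = (\<Sum>q\<in>F. \<Sum>g\<in>S q. wt m q)"
      unfolding D_def by (subst sum.Sigma) (use finF S in \<open>auto simp: decomp_def case_prod_beta\<close>)
    also have "\<dots> = (\<Sum>q\<in>F. real (bratteli_mult Q m q p) * wt m q)"
    proof (rule sum.cong)
      fix q assume q: "q \<in> F"
      have "bratteli_mult Q m q p = card (S q)"
        by (rule bratteli_mult_eq[OF subsetD[OF F q] p k(1,2)[OF q] S[OF q]])
      then show "(\<Sum>g\<in>S q. wt m q) = real (bratteli_mult Q m q p) * wt m q" by simp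
    qed simp
    finally show "(\<Sum>i\<in>D. Re (ptr h (Suc (Suc m)) (P i))) =
        (\<Sum>q\<in>F. real (bratteli_mult Q m q p) * wt m q)" .
  qed
qed

text \<open>The products of f with a string added by the members of F, and the given P i, are
  orthogonal projections below f with a string added. Their traces add up to at most the trace of
  the latter, and \<open>ptr_incl_le\<close> brings in r. The two kinds are combined over a disjoint
  sum of index sets.\<close>

lemma up_bound:
  fixes P :: "'q \<times> 'q \<Rightarrow> 'q"
  assumes p: "p \<in> mcent n" and f: "f \<in> mproj n" "ml n f p = f"
    and F: "F \<subseteq> mcent (Suc n)" and D: "finite D"
    and P: "\<And>i. i \<in> D \<Longrightarrow> P i \<in> alg.proj (Suc n)"
    "\<And>i. i \<in> D \<Longrightarrow> ml (Suc n) (P i) (incl Q n f) = P i"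
    "\<And>i j. i \<in> D \<Longrightarrow> j \<in> D \<Longrightarrow> i \<noteq> j \<Longrightarrow> ml (Suc n) (P i) (P j) = 0"
    "\<And>i q. i \<in> D \<Longrightarrow> q \<in> F \<Longrightarrow> ml (Suc n) q (P i) = 0"
  shows "(\<Sum>q\<in>F. real (bratteli_mult Q n p q) * wt (Suc n) q) + (\<Sum>i\<in>D. Re (ptr h (Suc n) (P i)))
    \<le> r * wt n p"
proof -
  let ?m = "ml (Suc n)" and ?i = "incl Q n f"
  have finF: "finite F" using F alg.finite_minims_cproj finite_subset by metis
  note fD = alg.minims_projD[OF f(1)]
  have ip: "?i \<in> alg.proj (Suc n)" by (rule incl_proj[OF fD(1)])
  note iD = alg.projD[OF ip]
  define R where "R = case_sum (\<lambda>q. ?m ?i q) P"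
  note qD = alg.minims_cprojD[OF subsetD[OF F]]
  have RD: "R x \<in> alg.proj (Suc n) \<and> ?m (R x) ?i = R x" if "x \<in> F <+> D" for x
  proof (cases x)
    case (Inl q)
    then have q: "q \<in> F" using that by auto
    have "?m (?m ?i q) ?i = ?m ?i (?m ?i q)"
      using alg.mul_assoc[OF iD(1) qD(3)[OF q] iD(1)] qD(7)[OF q iD(1)] by simp
    also have "\<dots> = ?m ?i q" using alg.mul_assoc[OF iD(1) iD(1) qD(3)[OF q]] iD(2) by simp
    finally show ?thesis
      using alg.cproj_mul[OF qD(1)[OF q] ip] by (simp add: R_def Inl)
  next
    case (Inr i)
    then show ?thesis using that P(1,2) by (auto simp: R_def)
  qed
  have orth: "?m (R x) (R y) = 0" if xy: "x \<in> F <+> D" "y \<in> F <+> D" "x \<noteq> y" for x y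
  proof (cases x)
    case (Inl q)
    then have q: "q \<in> F" using that by auto
    note qq = qD(3)[OF q]
    show ?thesis
    proof (cases y)
      case (Inl q')
      then have q': "q' \<in> F" and ne: "q \<noteq> q'" using xy \<open>x = Inl q\<close> by auto
      have "?m (?m ?i q) (?m ?i q') = ?m ?i (?m (?m q ?i) q')"
        using iD(1) qq qD(3)[OF q'] by (simp add: alg.mul_assoc)
      also have "?m q ?i = ?m ?i q" by (rule qD(7)[OF q iD(1)])
      also have "?m (?m ?i q) q' = ?m ?i (?m q q')" by (rule alg.mul_assoc[OF iD(1) qq qD(3)[OF q']])
      also have "?m q q' = 0" by (rule alg.minims_cproj_orth[OF subsetD[OF F q] subsetD[OF F q'] ne])
      finally show ?thesis using iD(1) \<open>x = Inl q\<close> Inl by (simp add: R_def)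
    next
      case (Inr i)
      then have i: "i \<in> D" using xy by auto
      have "?m (?m ?i q) (P i) = ?m ?i (?m q (P i))"
        by (rule alg.mul_assoc[OF iD(1) qq alg.projD(1)[OF P(1)[OF i]]])
      then show ?thesis using P(4)[OF i q] iD(1) \<open>x = Inl q\<close> Inr by (simp add: R_def)
    qed
  next
    case (Inr i)
    then have i: "i \<in> D" using that by auto
    note PV = alg.projD(1)[OF P(1)[OF i]]
    show ?thesis
    proof (cases y)
      case (Inl q)
      then have q: "q \<in> F" using xy by auto
      have "?m (P i) (?m ?i q) = ?m (?m (P i) ?i) q"
        by (rule alg.mul_assoc[OF PV iD(1) qD(3)[OF q], symmetric])
      also have "\<dots> = ?m q (P i)" by (simp only: P(2)[OF i] qD(7)[OF q PV])
      finally show ?thesis using P(4)[OF i q] \<open>x = Inr i\<close> Inl by (simp add: R_def)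
    next
      case (Inr j)
      then show ?thesis using P(3)[OF i, of j] xy \<open>x = Inr i\<close> by (auto simp: R_def)
    qed
  qed
  have "(\<Sum>x\<in>F <+> D. Re (ptr h (Suc n) (R x))) \<le> Re (ptr h (Suc n) ?i)"
    by (rule alg.tr_orth_family_le) (use finF D ip RD orth in auto)
  also have "\<dots> \<le> r * Re (ptr h n f)" by (rule ptr_incl_le[OF fD(1)])
  also have "\<dots> = r * wt n p" by (simp only: wt_eq[OF p f])
  also have "(\<Sum>x\<in>F <+> D. Re (ptr h (Suc n) (R x))) =
      (\<Sum>q\<in>F. Re (ptr h (Suc n) (?m ?i q))) + (\<Sum>i\<in>D. Re (ptr h (Suc n) (P i)))"
    using finF D by (simp add: sum.Plus R_def)
  also have "(\<Sum>q\<in>F. Re (ptr h (Suc n) (?m ?i q))) =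
      (\<Sum>q\<in>F. real (bratteli_mult Q n p q) * wt (Suc n) q)"
    by (intro sum.cong refl) (simp only: bratteli_mult_trace[OF p subsetD[OF F] f])
  finally show ?thesis .
qed

section \<open>Row bounds and the norm of the principal graph\<close>

lemma principal_verticesD:
  assumes "(n, p) \<in> principal_vertices Q"
  shows "p \<in> mcent n" "n = Suc (Suc m) \<Longrightarrow> ml n p (jones m) = 0"
  using assms by (auto simp: principal_vertices_def minimals_simps jones_def)

text \<open>For n = 0 there are no edges down. For n = m + 1 the members of F1 belong to the
  principal graph and are thus annihilated by \<open>jones m\<close>, which makes the projections
  for the two directions orthogonal.\<close>

lemma principal_row_bound:
  assumes p: "p \<in> mcent n" and F1: "\<And>q. q \<in> F1 \<Longrightarrow> (Suc n, q) \<in> principal_vertices Q"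
    and F0: "\<And>q m. n = Suc m \<Longrightarrow> q \<in> F0 \<Longrightarrow> q \<in> mcent m" "n = 0 \<Longrightarrow> F0 = {}"
  shows "(\<Sum>q\<in>F1. real (bratteli_mult Q n p q) * wt (Suc n) q) +
    (\<Sum>q\<in>F0. real (bratteli_mult Q (n - 1) q p) * wt (n - 1) q) \<le> r * wt n p"
proof -
  obtain f where f: "f \<in> mproj n" "ml n f p = f" by (rule alg.minims_below[OF p])
  have F1': "F1 \<subseteq> mcent (Suc n)" using F1 principal_verticesD(1) by blast
  show ?thesis
  proof (cases n)
    case 0
    then show ?thesis using up_bound[OF p f F1', of "{}" "\<lambda>_. 0"] F0(2) by simp
  next
    case (Suc m)
    have F0': "F0 \<subseteq> mcent m" using F0(1)[OF Suc] by blast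
    obtain D :: "('q \<times> 'q) set" and P where D: "finite D"
      "\<And>i. i \<in> D \<Longrightarrow> P i \<in> alg.proj (Suc (Suc m))"
      "\<And>i. i \<in> D \<Longrightarrow> ml (Suc (Suc m)) (P i) (incl Q (Suc m) f) = P i"
      "\<And>i j. i \<in> D \<Longrightarrow> j \<in> D \<Longrightarrow> i \<noteq> j \<Longrightarrow> ml (Suc (Suc m)) (P i) (P j) = 0"
      "\<And>i q. i \<in> D \<Longrightarrow> q \<in> mcent (Suc (Suc m)) \<Longrightarrow> ml (Suc (Suc m)) q (jones m) = 0 \<Longrightarrow>
         ml (Suc (Suc m)) q (P i) = 0"
      "(\<Sum>i\<in>D. Re (ptr h (Suc (Suc m)) (P i))) = (\<Sum>q\<in>F0. real (bratteli_mult Q m q p) * wt m q)"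
      by (rule down_projections[OF p[unfolded Suc] f[unfolded Suc] F0']) blast
    have "ml (Suc (Suc m)) q (P i) = 0" if i: "i \<in> D" and q: "q \<in> F1" for i q
    proof -
      have "(Suc (Suc m), q) \<in> principal_vertices Q" using F1[OF q] by (simp only: Suc)
      from principal_verticesD(1)[OF this] principal_verticesD(2)[OF this refl]
      show ?thesis by (rule D(5)[OF i])
    qed
    with up_bound[OF p f F1', of D P, unfolded Suc] D(1-4) have
      "(\<Sum>q\<in>F1. real (bratteli_mult Q (Suc m) p q) * wt (Suc (Suc m)) q) +
        (\<Sum>i\<in>D. Re (ptr h (Suc (Suc m)) (P i))) \<le> r * wt (Suc m) p" by blast
    then show ?thesis unfolding D(6) Suc by simp
  qed
qed

definition real_adjacency :: "nat \<times> 'q \<Rightarrow> nat \<times> 'q \<Rightarrow> real" where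
  "real_adjacency = (\<lambda>(n, p) (m, q). if m = Suc n then real (bratteli_mult Q n p q)
     else if n = Suc m then real (bratteli_mult Q m q p) else 0)"

lemma principal_adjacency_eq:
  "principal_adjacency Q = (\<lambda>i j. complex_of_real (real_adjacency i j))"
  by (intro ext) (auto simp: principal_adjacency_def real_adjacency_def split: prod.split)

lemma real_adjacency_row_bound:
  assumes i: "i \<in> principal_vertices Q" and F: "finite F" "F \<subseteq> principal_vertices Q"
  shows "(\<Sum>j\<in>F. real_adjacency i j * (case j of (m, q) \<Rightarrow> wt m q)) \<le> r * (case i of (n, p) \<Rightarrow> wt n p)"
proof -
  obtain n p where np: "i = (n, p)" by (cases i)
  define a where "a j = real_adjacency i j * (case j of (m, q) \<Rightarrow> wt m q)" for j
  define F1 where "F1 = {q. (Suc n, q) \<in> F}"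
  \<comment> \<open>The condition on n guards against 0 - 1 = 0, which would make level 0 its own
    predecessor.\<close>
  define F0 where "F0 = {q. n \<noteq> 0 \<and> (n - 1, q) \<in> F}"
  have "a j = (if fst j = Suc n then a j else 0) + (if Suc (fst j) = n then a j else 0)" for j
    by (cases j) (auto simp: a_def np real_adjacency_def)
  then have "(\<Sum>j\<in>F. a j) = (\<Sum>j\<in>F. (if fst j = Suc n then a j else 0) + (if Suc (fst j) = n then a j else 0))"
    by (rule sum.cong[OF refl])
  also have "\<dots> = (\<Sum>j\<in>{j \<in> F. fst j = Suc n}. a j) + (\<Sum>j\<in>{j \<in> F. Suc (fst j) = n}. a j)"
    using F(1) by (simp add: sum.distrib sum.inter_filter)
  also have "{j \<in> F. fst j = Suc n} = Pair (Suc n) ` F1" by (auto simp: F1_def)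
  also have "{j \<in> F. Suc (fst j) = n} = Pair (n - 1) ` F0" by (auto simp: F0_def)
  also have "(\<Sum>j\<in>Pair (Suc n) ` F1. a j) = (\<Sum>q\<in>F1. real (bratteli_mult Q n p q) * wt (Suc n) q)"
    by (subst sum.reindex) (auto simp: inj_on_def a_def np real_adjacency_def)
  also have "(\<Sum>j\<in>Pair (n - 1) ` F0. a j) = (\<Sum>q\<in>F0. real (bratteli_mult Q (n - 1) q p) * wt (n - 1) q)"
    by (subst sum.reindex) (auto simp: inj_on_def a_def np real_adjacency_def F0_def intro!: sum.cong)
  also have "(\<Sum>q\<in>F1. real (bratteli_mult Q n p q) * wt (Suc n) q) +
    (\<Sum>q\<in>F0. real (bratteli_mult Q (n - 1) q p) * wt (n - 1) q) \<le> r * wt n p"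
  proof (rule principal_row_bound)
    show "p \<in> mcent n" using i principal_verticesD(1) unfolding np by blast
    show "(Suc n, q) \<in> principal_vertices Q" if "q \<in> F1" for q using that F(2) by (auto simp: F1_def)
    show "q \<in> mcent m" if "n = Suc m" "q \<in> F0" for q m
    proof -
      have "(m, q) \<in> principal_vertices Q" using that F(2) by (auto simp: F0_def)
      then show ?thesis by (rule principal_verticesD(1))
    qed
    show "F0 = {}" if "n = 0" using that by (simp add: F0_def)
  qed
  finally show ?thesis by (simp add: a_def np)
qed

lemma op_norm_principal_le:
  assumes "r \<ge> 0"
  shows "op_norm (principal_vertices Q) (principal_adjacency Q) \<le> ennreal r"
proof (rule op_norm_le, unfold principal_adjacency_eq, rule schur_test[where \<xi> = "\<lambda>(m, q). wt m q"])
  show "real_adjacency i j \<ge> 0" for i j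
    by (auto simp: real_adjacency_def split: prod.split)
  show "real_adjacency i j = real_adjacency j i" for i j
    by (auto simp: real_adjacency_def split: prod.split)
  show "r \<ge> 0" by fact
  show "finite {j \<in> principal_vertices Q. real_adjacency i j \<noteq> 0}" if "i \<in> principal_vertices Q" for i
  proof -
    obtain n p where np: "i = (n, p)" by (cases i)
    \<comment> \<open>Neighbours lie on the two adjacent levels, and each level has finitely many
      minimal central projections.\<close>
    have "{j \<in> principal_vertices Q. real_adjacency i j \<noteq> 0} \<subseteq>
        Pair (Suc n) ` mcent (Suc n) \<union> Pair (n - 1) ` mcent (n - 1)"
    proof
      fix j assume j: "j \<in> {j \<in> principal_vertices Q. real_adjacency i j \<noteq> 0}"
      obtain m q where mq: "j = (m, q)" by (cases j)
      have "q \<in> mcent m" using j principal_verticesD(1) unfolding mq by blast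
      moreover have "m = Suc n \<or> m = n - 1"
        using j by (auto simp: np mq real_adjacency_def split: if_splits)
      ultimately show "j \<in> Pair (Suc n) ` mcent (Suc n) \<union> Pair (n - 1) ` mcent (n - 1)"
        unfolding mq by blast
    qed
    then show ?thesis using alg.finite_minims_cproj
      by (meson finite_UnI finite_imageI finite_subset)
  qed
  show "(case i of (m, q) \<Rightarrow> wt m q) > 0" if "i \<in> principal_vertices Q" for i
    using that wt_pos principal_verticesD(1) by (cases i) auto
  show "(\<Sum>j\<in>F. real_adjacency i j * (case j of (m, q) \<Rightarrow> wt m q)) \<le> r * (case i of (n, p) \<Rightarrow> wt n p)"
    if "i \<in> principal_vertices Q" "finite F" "F \<subseteq> principal_vertices Q" for i F
    by (rule real_adjacency_row_bound[OF that])
qed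

end

text \<open>Without even vertices \<open>gpa_act\<close> would be 0 for every tangle without
  boundary strings and outer colour \<open>Pos\<close>, so that the unit and 0 would have the same
  image. The lemma supplies the base vertex.\<close>

lemma even_verts_nonempty:
  assumes Q: "subfactor_planar_algebra Q" and emb: "planar_embedding Q (graph_planar_algebra G) \<phi>"
  shows "even_verts G \<noteq> {}"
proof
  assume e: "even_verts G = {}"
  interpret subfactor_planar_algebra Q by (rule Q)
  interpret vs: vector_space "scal Q" by (rule vector_space)
  have zero: "0 \<in> sp Q Pos 0" using subspace[of Pos 0] by (simp add: vs.subspace_def)
  have unit: "unit0 Q Pos \<in> sp Q Pos 0" unfolding unit0_def by (rule act_closed) simp
  have "\<phi> Pos 0 (scal Q 1 0 + 0) = scal (graph_planar_algebra G) 1 (\<phi> Pos 0 0) + \<phi> Pos 0 0"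
    using emb zero unfolding planar_embedding_def by blast
  then have 0: "\<phi> Pos 0 0 = (\<lambda>_ _. 0)"
    by (auto simp: graph_planar_algebra_def fun_eq_iff)
  have "\<phi> Pos 0 (act Q Pos 0 []) = act (graph_planar_algebra G) Pos 0 (relabel \<phi> Pos [])"
    using emb unfolding planar_embedding_def by simp
  then have "\<phi> Pos 0 (unit0 Q Pos) = (\<lambda>_ _. 0)"
    using e by (auto simp: unit0_def graph_planar_algebra_def gpa_act_def paths_def sign_verts_def fun_eq_iff)
  then have "\<phi> Pos 0 (unit0 Q Pos) = \<phi> Pos 0 0" using 0 by simp
  moreover have "inj_on (\<phi> Pos 0) (sp Q Pos 0)" using emb unfolding planar_embedding_def by blast
  ultimately have "unit0 Q Pos = 0" using unit zero by (meson inj_onD)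
  then show False using unit0_nonzero by blast
qed

theorem theorem1p1:
  fixes \<Gamma> :: "('v, 'e) wgraph" and \<delta> :: real
    and Q :: "'q::ab_group_add planar_data"
    and \<phi> :: "sign \<Rightarrow> nat \<Rightarrow> 'q \<Rightarrow> ('v, 'e) path_matrix"
  assumes "weighted_graph \<Gamma> \<delta>"
    and "op_norm (verts \<Gamma>) (adjacency \<Gamma>) < ennreal \<delta>"
    and "subfactor_planar_algebra Q"
    and "planar_embedding Q (graph_planar_algebra \<Gamma>) \<phi>"
  shows "\<not> amenable Q"
proof -
  have bip: "bipartite_graph \<Gamma>" using assms(1) by (simp add: weighted_graph_def)
  obtain v where v: "v \<in> even_verts \<Gamma>" using even_verts_nonempty[OF assms(3,4)] by blast
  then have "v \<in> verts \<Gamma>" by (simp add: verts_def)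
  then obtain r h where rh: "0 \<le> r" "r < \<delta>" "\<And>w. w \<in> verts \<Gamma> \<Longrightarrow> h w > (0::real)"
    "\<And>w. w \<in> verts \<Gamma> \<Longrightarrow> (\<Sum>e\<in>out_edges \<Gamma> w. h (tgt \<Gamma> e)) \<le> r * h w"
    by (rule superharmonic_exists[OF bip _ assms(2)]) blast
  interpret subfactor_planar_algebra Q by (rule assms(3))
  interpret embedded_planar_algebra Q \<Gamma> \<delta> \<phi> v h r
    by unfold_locales (use assms(1,4) v rh(3,4) in auto)
  have "op_norm (principal_vertices Q) (principal_adjacency Q) \<le> ennreal r"
    by (rule op_norm_principal_le[OF rh(1)])
  \<comment> \<open>The modulus of \<open>Q\<close> is \<delta>, by evaluating a loop at v, and r
    was chosen strictly below it.\<close>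
  also have "\<dots> < ennreal (modulus Q)" using rh(1,2) by (simp add: modulus_eq ennreal_less_iff)
  finally show ?thesis by (simp add: amenable_def)
qed
end
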